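(* Let $X=(x_{ij})$ be an $n\times r$ matrix of indeterminates over $\mathbb{C}$ and let $\lambda$ be a partition with at most $n$ rows. The bideterminants $M_T$, for $T$ running over the Non-Crossing Tableaux of shape $\lambda$ with entries in $\{1,\dots,r\}$, form a basis of $D_\lambda$.
   Context: For a filling $T$ of the Young diagram of $\lambda$ with elements of $\{1,\dots,r\}$ having distinct, increasingly arranged entries in each column, $M_T=\prod_c P_{\{1,\dots,k_c\},J_c}$, where $c$ runs over the columns of $\lambda$, $k_c$ is the length of column $c$, $J_c$ is the set of entries of column $c$ of $T$, and $P_{I,J}$ is the minor of $X$ with row set $I$ and column set $J$. (That is, $M_T$ is the bideterminant of the pair $(T_\lambda,T)$, where $T_\lambda$ has all entries of row $i$ equal to $i$.) $D_\lambda$ is the $\mathbb{C}$-linear span of all such $M_T$. Two disjoint finite sets of integers $a=\{a_1<\dots<a_p\}$ and $b=\{b_1<\dots<b_q\}$ with $p\ge q$ are non-crossing if: (1) for no $1\le i\le q-1$ does $a_i<b_i<a_{i+1}<b_{i+1}$ or $b_i<a_i<b_{i+1}<a_{i+1}$ hold; and (2) if $p>q$, then $a_q<b_q<a_{q+1}$ does not hold. With $N=|\lambda|$, a multiplicity-free Non-Crossing Tableau of shape $\lambda$ is a set partition of $\{1,\dots,N\}$ into pairwise non-crossing blocks whose sizes are the column lengths of $\lambda$. Let $T$ be a filling of shape $\lambda$ with strictly increasing columns in which $v$ occurs $\mu_v$ times, and let $B_1,\dots,B_r$ be the consecutive segments of $\{1,\dots,N\}$ of lengths $\mu_1,\dots,\mu_r$.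 Then $T$ is a Non-Crossing Tableau (Semi-Noncrossing Tableau) if: (i) there is a multiplicity-free Non-Crossing Tableau $\hat T$ of shape $\lambda$, each block of which contains at most one element of each $B_v$, such that replacing every element of $B_v$ by $v$ (for all $v$) turns the multiset of blocks of $\hat T$ into the multiset of columns of $T$; and (ii) columns of equal length are arranged so that whenever a column $a$ is to the left of a different column $b$ of the same length, $a_s<b_s$ for the largest index $s$ with $a_s\neq b_s$. *)

theory Defs
  imports
    Complex_Main
    "HOL-Library.Poly_Mapping"
    "HOL-Library.Multiset"
    "HOL-Library.FuncSet"
    "HOL-Library.Disjoint_Sets"
    "Jordan_Normal_Form.Determinant"
    "Jordan_Normal_Form.DL_Submatrix"
begin

text \<open>Polynomials in the indeterminates \<open>x (i, j)\<close>: finitely supported maps from exponent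
  vectors to coefficients, with the convolution product of \<^theory>\<open>HOL-Library.Poly_Mapping\<close>.\<close>

type_synonym cpoly = "((nat \<times> nat) \<Rightarrow>\<^sub>0 nat) \<Rightarrow>\<^sub>0 complex"

definition indet :: "nat \<times> nat \<Rightarrow> cpoly" where
  "indet ij = Poly_Mapping.single (Poly_Mapping.single ij 1) 1"

definition cpoly_scale :: "complex \<Rightarrow> cpoly \<Rightarrow> cpoly" where
  "cpoly_scale a p = Poly_Mapping.single 0 a * p"

interpretation cpoly: vector_space cpoly_scale
proof (unfold_locales)
  fix a b :: complex and p q :: cpoly
  show "cpoly_scale a (p + q) = cpoly_scale a p + cpoly_scale a q"
    by (simp add: cpoly_scale_def algebra_simps)
  show "cpoly_scale (a + b) p = cpoly_scale a p + cpoly_scale b p"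
    by (simp add: cpoly_scale_def single_add algebra_simps)
  show "cpoly_scale a (cpoly_scale b p) = cpoly_scale (a * b) p"
    by (simp add: cpoly_scale_def mult_single flip: mult.assoc)
  show "cpoly_scale 1 p = p"
    by (simp add: cpoly_scale_def)
qed

text \<open>Matrices in \<^theory>\<open>Jordan_Normal_Form.Matrix\<close> are indexed from 0, whereas all row and
  column numbers below (and the subscripts of the indeterminates) start at 1; hence the shifts.\<close>

definition generic_mat :: "nat \<Rightarrow> nat \<Rightarrow> cpoly mat" where
  "generic_mat n r = mat n r (\<lambda>(i, j). indet (Suc i, Suc j))"

definition minor :: "cpoly mat \<Rightarrow> nat set \<Rightarrow> nat set \<Rightarrow> cpoly" where
  "minor A I J = det (submatrix A {i. Suc i \<in> I} {j. Suc j \<in> J})"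

definition is_partition :: "nat list \<Rightarrow> bool" where
  "is_partition lam \<longleftrightarrow> sorted_wrt (\<ge>) lam \<and> 0 \<notin> set lam"

definition young_diagram :: "nat list \<Rightarrow> (nat \<times> nat) set" where
  "young_diagram lam = {(i, j). 1 \<le> i \<and> i \<le> length lam \<and> 1 \<le> j \<and> j \<le> lam ! (i - 1)}"

definition columns :: "nat list \<Rightarrow> nat set" where
  "columns lam = snd ` young_diagram lam"

definition col_len :: "nat list \<Rightarrow> nat \<Rightarrow> nat" where
  "col_len lam c = card {i. (i, c) \<in> young_diagram lam}"

text \<open>Fillings are undefined outside the diagram, so that equality of fillings is equality of
  functions.\<close>

definition col_strict_fillings :: "nat list \<Rightarrow> nat \<Rightarrow> (nat \<times> nat \<Rightarrow> nat) set" where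
  "col_strict_fillings lam r = {T \<in> young_diagram lam \<rightarrow>\<^sub>E {1..r}.
     \<forall>i i' c. (i, c) \<in> young_diagram lam \<longrightarrow> (i', c) \<in> young_diagram lam \<longrightarrow> i < i' \<longrightarrow>
       T (i, c) < T (i', c)}"

definition col_entries :: "nat list \<Rightarrow> (nat \<times> nat \<Rightarrow> nat) \<Rightarrow> nat \<Rightarrow> nat set" where
  "col_entries lam T c = (\<lambda>i. T (i, c)) ` {1..col_len lam c}"

definition bideterminant :: "nat \<Rightarrow> nat \<Rightarrow> nat list \<Rightarrow> (nat \<times> nat \<Rightarrow> nat) \<Rightarrow> cpoly" where
  "bideterminant n r lam T =
     (\<Prod>c\<in>columns lam. minor (generic_mat n r) {1..col_len lam c} (col_entries lam T c))"

definition bidet_space :: "nat \<Rightarrow> nat \<Rightarrow> nat list \<Rightarrow> cpoly set" where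
  "bidet_space n r lam = cpoly.span (bideterminant n r lam ` col_strict_fillings lam r)"

definition nth_elem :: "nat set \<Rightarrow> nat \<Rightarrow> nat" where
  "nth_elem A i = sorted_list_of_set A ! (i - 1)"

definition noncrossing_larger_first :: "nat set \<Rightarrow> nat set \<Rightarrow> bool" where
  "noncrossing_larger_first a b \<longleftrightarrow>
     (let p = card a; q = card b; A = nth_elem a; B = nth_elem b in
       (\<forall>i\<in>{1..q - 1}.
          \<not> (A i < B i \<and> B i < A (i + 1) \<and> A (i + 1) < B (i + 1)) \<and>
          \<not> (B i < A i \<and> A i < B (i + 1) \<and> B (i + 1) < A (i + 1))) \<and>
       (p > q \<longrightarrow> \<not> (A q < B q \<and> B q < A (q + 1))))"

text \<open>The conditions are stated with the larger of the two sets first; for sets of equal size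
  they are symmetric. They are only used for disjoint nonempty finite sets.\<close>

definition noncrossing :: "nat set \<Rightarrow> nat set \<Rightarrow> bool" where
  "noncrossing a b \<longleftrightarrow>
     (if card b \<le> card a then noncrossing_larger_first a b else noncrossing_larger_first b a)"

definition multfree_nct :: "nat list \<Rightarrow> nat set set \<Rightarrow> bool" where
  "multfree_nct lam P \<longleftrightarrow>
     partition_on {1..sum_list lam} P \<and>
     pairwise noncrossing P \<and>
     image_mset card (mset_set P) = image_mset (col_len lam) (mset_set (columns lam))"

definition content :: "nat list \<Rightarrow> (nat \<times> nat \<Rightarrow> nat) \<Rightarrow> nat \<Rightarrow> nat" where
  "content lam T v = card {x \<in> young_diagram lam. T x = v}"

definition segment :: "(nat \<Rightarrow> nat) \<Rightarrow> nat \<Rightarrow> nat set" where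
  "segment \<mu> v = {(\<Sum>u\<in>{1..<v}. \<mu> u)<..(\<Sum>u\<in>{1..v}. \<mu> u)}"

text \<open>The last conjunct is the arrangement condition for columns of equal length; since columns
  increase strictly downwards, the \<open>s\<close>-th smallest entry of column \<open>c\<close> is \<open>T (s, c)\<close>.\<close>

definition nct :: "nat list \<Rightarrow> nat \<Rightarrow> (nat \<times> nat \<Rightarrow> nat) set" where
  "nct lam r = {T \<in> col_strict_fillings lam r.
     (\<exists>P. multfree_nct lam P \<and>
        (\<forall>b\<in>P. \<forall>v\<in>{1..r}. card (b \<inter> segment (content lam T) v) \<le> 1) \<and>
        image_mset (\<lambda>b. {v \<in> {1..r}. b \<inter> segment (content lam T) v \<noteq> {}}) (mset_set P)
          = image_mset (col_entries lam T) (mset_set (columns lam))) \<and>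
     (\<forall>c\<in>columns lam. \<forall>d\<in>columns lam.
        c < d \<longrightarrow> col_len lam c = col_len lam d \<longrightarrow> col_entries lam T c \<noteq> col_entries lam T d \<longrightarrow>
        (let s = Max {s \<in> {1..col_len lam c}. T (s, c) \<noteq> T (s, d)} in T (s, c) < T (s, d)))}"

end

theory Submission
  imports Defs
begin

text \<open>
  Give \<open>x\<^sub>i\<^sub>j\<close> the weight \<open>i j\<close>. By the rearrangement inequality the diagonal monomial of a minor has larger
  weight than all others, so the product \<open>m\<^sub>T\<close> of the \<open>x\<^bsub>i,T(i,c)\<^esub>\<close> over all cells \<open>(i, c)\<close>
  dominates \<open>M\<^sub>T\<close>; it records exactly the contents of the rows of \<open>T\<close>.

  A set partition is non-crossing iff, for every \<open>i\<close>, the arcs joining the \<open>i\<close>-th to the \<open>(i + 1)\<close>-st elements of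
  its blocks form a parenthesis matching: every closing element is matched to the last opening
  element before it that is still free, and no free opening element lies under an arc. As this
  greedy rule depends only on the positions, a non-crossing tableau is determined by its row contents;
  distinct ones have distinct dominating monomials, whence linear independence. Conversely, the greedy
  rule applied to the rows of a semistandard tableau links its cells to a non-crossing tableau with the same
  row contents, so there are at least as many non-crossing tableaux as semistandard ones. The bideterminants of the
  latter span by Garnir straightening, so the two families have the same span.
\<close>

section \<open>Dominating monomials\<close>

text \<open>The weight only grades the monomials, and dominating monomials of distinct tableaux may
  have equal weight. This is harmless: a bideterminant has no other monomial of at least that
  weight, so a linear relation can be tested at one dominating monomial of maximal weight. With
  repeated entries the positions fed to the greedy rule are not given by the row contents, because
  the set partition hides an arbitrary order among equal entries. As columns increase strictly, an
  opening element is never matched to a closing one with the same entry; so for every admissible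
  order the links obey the rule that looks only at strict inequalities between entries, and this
  rule has a unique solution. It yields the columns up to permutation; encoding columns as numbers
  that increase from left to right then fixes their places. Straightening aims at semistandard
  tableaux because at a violation \<open>g i < f i\<close> in adjacent columns every other Garnir
  term carries larger entries to the right, which terminates. The spanning set so obtained bounds
  the dimension from above, and an independent family of at least that size must span.\<close>

definition weight :: "((nat \<times> nat) \<Rightarrow>\<^sub>0 nat) \<Rightarrow> nat" where
  "weight m = (\<Sum>k\<in>Poly_Mapping.keys m. fst k * snd k * Poly_Mapping.lookup m k)"

lemma weight_superset:
  assumes "finite K" "Poly_Mapping.keys m \<subseteq> K"
  shows "weight m = (\<Sum>k\<in>K. fst k * snd k * Poly_Mapping.lookup m k)"
  unfolding weight_def using assms
  by (intro sum.mono_neutral_left) (auto simp: in_keys_iff)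

lemma weight_add: "weight (m + m') = weight m + weight m'"
proof -
  let ?K = "Poly_Mapping.keys m \<union> Poly_Mapping.keys m'"
  show ?thesis
    using weight_superset[of ?K "m + m'"] weight_superset[of ?K m] weight_superset[of ?K m']
      keys_add[of m m']
    by (simp add: lookup_add algebra_simps sum.distrib)
qed

lemma weight_zero [simp]: "weight 0 = 0"
  by (simp add: weight_def)

lemma weight_single: "weight (Poly_Mapping.single (i, j) 1) = i * j"
  by (simp add: weight_def)

lemma weight_sum: "weight (\<Sum>a\<in>A. f a) = (\<Sum>a\<in>A. weight (f a))"
  by (induction A rule: infinite_finite_induct) (auto simp: weight_add)

text \<open>Subtracting the monomial puts two demands into one condition: \<open>m\<close> has
  coefficient 1, as it could not be lighter than itself, and every other monomial is strictly
  lighter.\<close>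

definition leads :: "cpoly \<Rightarrow> ((nat \<times> nat) \<Rightarrow>\<^sub>0 nat) \<Rightarrow> bool" where
  "leads p m \<longleftrightarrow> (\<forall>k\<in>Poly_Mapping.keys (p - Poly_Mapping.single m 1). weight k < weight m)"

lemma leads_one: "leads 1 0"
  by (simp add: leads_def)

lemma leads_mult:
  assumes "leads p m" "leads q m'"
  shows "leads (p * q) (m + m')"
proof -
  let ?x = "Poly_Mapping.single m 1 :: cpoly" and ?y = "Poly_Mapping.single m' 1 :: cpoly"
  define p' q' where "p' = p - ?x" and "q' = q - ?y"
  have p': "weight k < weight m" if "k \<in> Poly_Mapping.keys p'" for k
    using assms(1) that by (auto simp: leads_def p'_def)
  have q': "weight k < weight m'" if "k \<in> Poly_Mapping.keys q'" for k
    using assms(2) that by (auto simp: leads_def q'_def)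
  have eq: "p * q - Poly_Mapping.single (m + m') 1 = p' * q' + (?x * q' + p' * ?y)"
    by (simp add: p'_def q'_def algebra_simps mult_single)
  have *: "weight k < weight (m + m')"
    if k: "k \<in> Poly_Mapping.keys (f * g)"
      and "\<And>a b. a \<in> Poly_Mapping.keys f \<Longrightarrow> b \<in> Poly_Mapping.keys g \<Longrightarrow> weight a + weight b < weight m + weight m'"
    for k and f g :: cpoly
  proof -
    obtain a b where "k = a + b" "a \<in> Poly_Mapping.keys f" "b \<in> Poly_Mapping.keys g"
      using k keys_mult[of f g] by blast
    then show ?thesis using that(2) by (simp add: weight_add)
  qed
  have "weight k < weight (m + m')" if "k \<in> Poly_Mapping.keys (p' * q')" for k
    by (rule *[OF that]) (use p' q' in \<open>auto intro: add_strict_mono\<close>)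
  moreover have "weight k < weight (m + m')" if "k \<in> Poly_Mapping.keys (?x * q')" for k
    by (rule *[OF that]) (use q' in \<open>auto split: if_splits\<close>)
  moreover have "weight k < weight (m + m')" if "k \<in> Poly_Mapping.keys (p' * ?y)" for k
    by (rule *[OF that]) (use p' in \<open>auto split: if_splits\<close>)
  ultimately show ?thesis
    unfolding leads_def eq
    using keys_add[of "p' * q'" "?x * q' + p' * ?y"] keys_add[of "?x * q'" "p' * ?y"] by (meson UnE subsetD)
qed

lemma leads_prod:
  assumes "\<And>a. a \<in> A \<Longrightarrow> leads (f a) (g a)"
  shows "leads (\<Prod>a\<in>A. f a) (\<Sum>a\<in>A. g a)"
  using assms by (induction A rule: infinite_finite_induct) (auto intro: leads_one leads_mult)

lemma lookup_leads:
  assumes "leads p m" "weight m \<le> weight k"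
  shows "Poly_Mapping.lookup p k = (if k = m then 1 else 0)"
proof -
  have "k \<notin> Poly_Mapping.keys (p - Poly_Mapping.single m 1)"
    using assms by (auto simp: leads_def)
  then have "Poly_Mapping.lookup p k = Poly_Mapping.lookup (Poly_Mapping.single m (1::complex)) k"
    by (simp add: in_keys_iff lookup_minus)
  then show ?thesis by (simp add: lookup_single when_def)
qed

lemma lookup_cpoly_scale: "Poly_Mapping.lookup (cpoly_scale a p) k = a * Poly_Mapping.lookup p k"
  by (simp add: cpoly_scale_def flip: mult_map_scale_conv_mult) (simp add: map.rep_eq when_def)

text \<open>In a vanishing combination take a member of maximal weight among those with nonzero
  coefficient. At its dominating monomial every other such member has coefficient 0, because at
  weights not below its own it contains only its own dominating monomial, which is a different
  one.\<close>

lemma independent_of_leads: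
  assumes leads: "\<And>t. t \<in> A \<Longrightarrow> leads (f t) (m t)" and inj: "inj_on m A"
  shows "inj_on f A" "cpoly.independent (f ` A)"
proof -
  show "inj_on f A"
  proof (rule inj_onI)
    fix s t assume st: "s \<in> A" "t \<in> A" "f s = f t"
    have "m s = m t" if "weight (m s) \<le> weight (m t)" "s \<in> A" "t \<in> A" "f s = f t" for s t
      using lookup_leads[OF leads[OF that(2)] that(1)] lookup_leads[OF leads[OF that(3)], of "m t"] that(4)
      by (auto split: if_splits)
    from this[of s t] this[of t s] st have "m s = m t"
      by (metis nle_le)
    then show "s = t" using inj st by (auto dest: inj_onD)
  qed
  then have inv: "the_inv_into A f (f t) = t" if "t \<in> A" for t
    using that by (simp add: the_inv_into_f_f)
  show "cpoly.independent (f ` A)"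
    unfolding cpoly.independent_explicit_module
  proof (intro allI impI)
    fix B :: "cpoly set" and u v
    assume B: "finite B" "B \<subseteq> f ` A" and z: "(\<Sum>v\<in>B. cpoly_scale (u v) v) = 0" and v: "v \<in> B"
    define \<mu> where "\<mu> = (\<lambda>v. m (the_inv_into A f v))"
    have \<mu>: "leads v (\<mu> v)" if "v \<in> B" for v
      using that B(2) leads inv unfolding \<mu>_def by auto
    have \<mu>_inj: "v = w" if vw: "v \<in> B" "w \<in> B" "\<mu> v = \<mu> w" for v w
    proof -
      obtain s t where "v = f s" "w = f t" "s \<in> A" "t \<in> A" using vw(1,2) B(2) by blast
      then show ?thesis using vw(3) inv inj unfolding \<mu>_def by (auto dest: inj_onD)
    qed
    show "u v = 0"
    proof (rule ccontr)
      assume "u v \<noteq> 0"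
      let ?C = "{v \<in> B. u v \<noteq> 0}"
      have "finite ?C" "?C \<noteq> {}" using B v \<open>u v \<noteq> 0\<close> by auto
      then have "Max ((\<lambda>x. weight (\<mu> x)) ` ?C) \<in> (\<lambda>x. weight (\<mu> x)) ` ?C"
        by (intro Max_in) auto
      then obtain w where w: "w \<in> ?C" "Max ((\<lambda>x. weight (\<mu> x)) ` ?C) = weight (\<mu> w)"
        by blast
      have w_max: "weight (\<mu> x) \<le> weight (\<mu> w)" if "x \<in> ?C" for x
        unfolding w(2)[symmetric] using that \<open>finite ?C\<close> by (intro Max_ge) auto
      have "0 = Poly_Mapping.lookup (\<Sum>v\<in>B. cpoly_scale (u v) v) (\<mu> w)"
        by (simp add: z)
      also have "\<dots> = (\<Sum>v\<in>B. u v * Poly_Mapping.lookup v (\<mu> w))"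
        by (simp add: lookup_sum lookup_cpoly_scale)
      also have "\<dots> = (\<Sum>v\<in>B. if v = w then u v else 0)"
      proof (rule sum.cong[OF refl])
        fix x assume x: "x \<in> B"
        show "u x * Poly_Mapping.lookup x (\<mu> w) = (if x = w then u x else 0)"
        proof (cases "u x = 0")
          case False
          then have "weight (\<mu> x) \<le> weight (\<mu> w)" using w_max x by auto
          then show ?thesis
            using lookup_leads[OF \<mu>[OF x], of "\<mu> w"] \<mu>_inj[OF x, of w] w(1) by auto
        qed auto
      qed
      also have "\<dots> = u w" using w(1) B by simp
      finally show False using w(1) by simp
    qed
  qed
qed

section \<open>Minors\<close>

text \<open>Columns are sequences of entries here, not sets, so that entries may be unsorted or
  repeated: the Garnir relations need an expression alternating in the positions. Positions start at
  0, rows at 1.\<close>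

definition colminor :: "nat \<Rightarrow> (nat \<Rightarrow> nat) \<Rightarrow> cpoly" where
  "colminor k f = (\<Sum>\<sigma> | \<sigma> permutes {..<k}. of_int (sign \<sigma>) * (\<Prod>i<k. indet (Suc (\<sigma> i), f i)))"

lemma colminor_eq_det: "colminor k f = det (mat k k (\<lambda>(i, j). indet (Suc i, f j)))"
  unfolding colminor_def
  by (subst det_col[of _ k]) (auto simp: atLeast0LessThan permutes_nat_less intro!: sum.cong prod.cong
      dest: permutes_in_image)

lemma colminor_cong: "(\<And>i. i < k \<Longrightarrow> f i = g i) \<Longrightarrow> colminor k f = colminor k g"
  unfolding colminor_def by (intro sum.cong arg_cong2[where f = "(*)"] prod.cong) auto

lemma colminor_permute:
  assumes "\<pi> permutes {..<k}"
  shows "colminor k (f \<circ> \<pi>) = of_int (sign \<pi>) * colminor k f"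
proof -
  let ?A = "mat k k (\<lambda>(i, j). indet (Suc j, f i))"
  \<comment> \<open>Transposing makes the entries index rows, so that permuting entries becomes a
    row permutation of the determinant.\<close>
  have tr: "colminor k g = det (mat k k (\<lambda>(i, j). indet (Suc j, g i)))" for g
    unfolding colminor_eq_det
    by (subst det_transpose[symmetric, of _ k]) (auto intro!: arg_cong[where f = det])
  have "colminor k (f \<circ> \<pi>) = det (mat k k (\<lambda>(i, j). ?A $$ (\<pi> i, j)))"
    unfolding tr using assms permutes_in_image[OF assms]
    by (intro arg_cong[where f = det] eq_matI) auto
  also have "\<dots> = of_int (sign \<pi>) * det ?A"
    by (rule det_permute_rows) (use assms in \<open>auto simp: atLeast0LessThan\<close>)
  finally show ?thesis by (simp add: tr)
qed

lemma colminor_not_inj: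
  assumes "\<not> inj_on f {..<k}"
  shows "colminor k f = 0"
proof -
  obtain i j where "i < k" "j < k" "i \<noteq> j" "f i = f j"
    using assms by (auto simp: inj_on_def)
  then show ?thesis unfolding colminor_eq_det
    by (intro det_identical_columns[of _ k i j]) (auto intro!: eq_vecI)
qed

text \<open>\<open>pick\<close> enumerates an index set increasingly. As \<open>f\<close> is
  increasing too, it meets the entries in the order of \<open>f\<close>, up to the shift from column
  numbers to matrix indices.\<close>

lemma minor_eq_colminor:
  assumes mono: "strict_mono_on {..<k} f" and range: "f ` {..<k} \<subseteq> {1..r}" and "k \<le> n"
  shows "minor (generic_mat n r) {1..k} (f ` {..<k}) = colminor k f"
proof -
  let ?I = "{i. Suc i \<in> {1..k}}" and ?J = "{j. Suc j \<in> f ` {..<k}}"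
  have inj: "inj_on f {..<k}" using mono by (rule strict_mono_on_imp_inj_on)
  have pos: "1 \<le> f i" "f i \<le> r" if "i < k" for i using range that by auto
  have rows: "{i. i < n \<and> i \<in> ?I} = {..<k}" using \<open>k \<le> n\<close> by auto
  have J: "?J = (\<lambda>i. f i - 1) ` {..<k}"
  proof safe
    fix j i assume "Suc j = f i" "i < k"
    then show "j \<in> (\<lambda>i. f i - 1) ` {..<k}" by (intro image_eqI[of _ _ i]) auto
  next
    fix i assume "i < k"
    then show "Suc (f i - 1) \<in> f ` {..<k}" using pos[of i] by simp
  qed
  have inj': "inj_on (\<lambda>i. f i - 1) {..<k}"
  proof (rule inj_onI)
    fix i j assume "i \<in> {..<k}" "j \<in> {..<k}" "f i - 1 = f j - 1"
    moreover have "f i = f j" using calculation pos[of i] pos[of j] by simp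
    ultimately show "i = j" using inj by (auto dest: inj_onD)
  qed
  have cols: "{j. j < r \<and> j \<in> ?J} = ?J"
    using pos J by force
  have pick_I: "pick ?I i = i" if "i < k" for i
  proof -
    have "pick ?I (card {a \<in> ?I. a < i}) = i"
      using that by (intro pick_card_in_set) auto
    moreover have "{a \<in> ?I. a < i} = {..<i}" using that by auto
    ultimately show ?thesis by simp
  qed
  have pick_J: "Suc (pick ?J i) = f i" if "i < k" for i
  proof -
    have "pick ?J (card {a \<in> ?J. a < f i - 1}) = f i - 1"
      using that J by (intro pick_card_in_set) auto
    moreover have "{a \<in> ?J. a < f i - 1} = (\<lambda>i. f i - 1) ` {..<i}"
    proof -
      have "f j - 1 < f i - 1 \<longleftrightarrow> j < i" if "j < k" for j
        using strict_mono_on_less[OF mono, of j i] that \<open>i < k\<close> pos[of j] pos[of i] by auto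
      then show ?thesis unfolding J using that by auto
    qed
    moreover have "card ((\<lambda>i. f i - 1) ` {..<i}) = i"
      using inj' that by (subst card_image) (auto intro: inj_on_subset)
    ultimately show ?thesis using pos[OF that] by simp
  qed
  have "submatrix (generic_mat n r) ?I ?J = mat k k (\<lambda>(i, j). indet (Suc i, f j))"
  proof (rule eq_matI)
    show d1: "dim_row (submatrix (generic_mat n r) ?I ?J) = dim_row (mat k k (\<lambda>(i, j). indet (Suc i, f j)))"
      by (simp add: dim_submatrix generic_mat_def rows[simplified])
    show d2: "dim_col (submatrix (generic_mat n r) ?I ?J) = dim_col (mat k k (\<lambda>(i, j). indet (Suc i, f j)))"
      unfolding dim_submatrix using cols J inj' by (simp add: generic_mat_def card_image)
    fix i j assume ij: "i < dim_row (mat k k (\<lambda>(i, j). indet (Suc i, f j)))" "j < dim_col (mat k k (\<lambda>(i, j). indet (Suc i, f j)))"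
    then have "submatrix (generic_mat n r) ?I ?J $$ (i, j) = generic_mat n r $$ (pick ?I i, pick ?J j)"
      using d1 d2 by (intro submatrix_index) (simp_all add: dim_submatrix)
    also have "\<dots> = indet (Suc i, f j)"
      using pick_I[of i] pick_J[of j] ij \<open>k \<le> n\<close> pos[of j] by (auto simp: generic_mat_def)
    finally show "submatrix (generic_mat n r) ?I ?J $$ (i, j) = mat k k (\<lambda>(i, j). indet (Suc i, f j)) $$ (i, j)"
      using ij by simp
  qed
  then show ?thesis by (simp add: minor_def colminor_eq_det)
qed

text \<open>Everything below the least moved point \<open>i\<close> is fixed, so both the image and
  the preimage of \<open>i\<close> lie above \<open>i\<close>; the inversion is formed by
  \<open>i\<close> and its preimage.\<close>

lemma permutes_inversion:
  fixes k :: nat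
  assumes \<sigma>: "\<sigma> permutes {..<k}" and "\<sigma> \<noteq> id"
  obtains i j where "i < j" "j < k" "\<sigma> j < \<sigma> i"
proof -
  define i where "i = (LEAST i. \<sigma> i \<noteq> i)"
  have ex: "\<exists>i. \<sigma> i \<noteq> i" using \<open>\<sigma> \<noteq> id\<close> by auto
  have i: "\<sigma> i \<noteq> i" unfolding i_def using ex by (rule LeastI_ex)
  have least: "\<sigma> j = j" if "j < i" for j using not_less_Least[of j] that unfolding i_def by auto
  have inj: "inj \<sigma>" using \<sigma> by (rule permutes_inj)
  have "i < k" using i \<sigma> by (auto simp: permutes_def)
  obtain j where j: "\<sigma> j = i" using permutes_surj[OF \<sigma>] by (metis surjD)
  have "\<not> \<sigma> i < i" using least[of "\<sigma> i"] inj i by (auto dest: injD)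
  moreover have "\<not> j < i" "j \<noteq> i" using least[of j] j i by auto
  moreover have "j < k" using permutes_in_image[OF \<sigma>, of j] j \<open>i < k\<close> by auto
  ultimately show ?thesis using that[of i j] i j by auto
qed

text \<open>Swapping the values at an inversion strictly increases the sum. Hence a maximising
  permutation is the identity, and all others stay strictly below it.\<close>

lemma strict_rearrangement:
  fixes f :: "nat \<Rightarrow> nat"
  assumes mono: "strict_mono_on {..<k} f" and \<sigma>: "\<sigma> permutes {..<k}" "\<sigma> \<noteq> id"
  shows "(\<Sum>i<k. Suc (\<sigma> i) * f i) < (\<Sum>i<k. Suc i * f i)"
proof -
  define F where "F = (\<lambda>\<sigma>. \<Sum>i<k. Suc (\<sigma> i) * f i)"
  have better: "\<exists>\<tau>. \<tau> permutes {..<k} \<and> F \<sigma> < F \<tau>" if \<sigma>: "\<sigma> permutes {..<k}" "\<sigma> \<noteq> id" for \<sigma>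
  proof -
    obtain i j where ij: "i < j" "j < k" "\<sigma> j < \<sigma> i" using permutes_inversion[OF \<sigma>] by blast
    let ?\<tau> = "\<sigma> \<circ> transpose i j"
    have split: "F \<rho> = Suc (\<rho> i) * f i + Suc (\<rho> j) * f j + (\<Sum>l\<in>{..<k} - {i, j}. Suc (\<rho> l) * f l)" for \<rho>
    proof -
      have "{..<k} = insert i (insert j ({..<k} - {i, j}))" using ij by auto
      then have "F \<rho> = sum (\<lambda>l. Suc (\<rho> l) * f l) (insert i (insert j ({..<k} - {i, j})))"
        unfolding F_def by simp
      then show ?thesis using ij by simp
    qed
    have "f i < f j" using strict_mono_onD[OF mono] ij by auto
    obtain d where d: "\<sigma> i = \<sigma> j + d" "d > 0" using ij(3) less_imp_add_positive by metis
    obtain e where e: "f j = f i + e" "e > 0" using \<open>f i < f j\<close> less_imp_add_positive by metis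
    \<comment> \<open>The right side exceeds the left by \<open>d * e\<close>.\<close>
    have "Suc (\<sigma> i) * f i + Suc (\<sigma> j) * f j < Suc (\<sigma> j) * f i + Suc (\<sigma> i) * f j"
      using d(2) e(2) unfolding d(1) e(1) by (simp add: algebra_simps)
    moreover have "(\<Sum>l\<in>{..<k} - {i, j}. Suc (?\<tau> l) * f l) = (\<Sum>l\<in>{..<k} - {i, j}. Suc (\<sigma> l) * f l)"
      by (intro sum.cong) (auto simp: transpose_def)
    ultimately have "F \<sigma> < F ?\<tau>" unfolding split by simp
    moreover have "?\<tau> permutes {..<k}"
      using ij \<sigma>(1) by (intro permutes_compose permutes_swap_id) auto
    ultimately show ?thesis by blast
  qed
  let ?P = "{\<sigma>. \<sigma> permutes {..<k}}"
  have fin: "finite (F ` ?P)" by (intro finite_imageI finite_permutations) auto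
  have "Max (F ` ?P) \<in> F ` ?P" by (rule Max_in[OF fin]) (use permutes_id in blast)
  then obtain \<rho> where \<rho>: "\<rho> permutes {..<k}" "Max (F ` ?P) = F \<rho>" by blast
  have max: "F \<tau> \<le> F \<rho>" if "\<tau> permutes {..<k}" for \<tau>
    unfolding \<rho>(2)[symmetric] using that by (intro Max_ge[OF fin]) auto
  have "\<rho> = id" using better[OF \<rho>(1)] max by (meson leD)
  then show ?thesis
    using better[OF \<sigma>] max unfolding F_def by fastforce
qed

lemma prod_single:
  "(\<Prod>i\<in>A. Poly_Mapping.single (m i) (1::'b::comm_semiring_1)) = Poly_Mapping.single (\<Sum>i\<in>A. m i :: 'a::comm_monoid_add) 1"
  by (induction A rule: infinite_finite_induct) (auto simp: mult_single)

lemma leads_colminor: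
  assumes "strict_mono_on {..<k} f"
  shows "leads (colminor k f) (\<Sum>i<k. Poly_Mapping.single (Suc i, f i) 1)"
proof -
  define m where "m = (\<lambda>\<sigma>. \<Sum>i<k. Poly_Mapping.single (Suc (\<sigma> i), f i) (1::nat))"
  let ?P = "{\<sigma>. \<sigma> permutes {..<k}}"
  have fin: "finite ?P" by (intro finite_permutations) auto
  have weight_m: "weight (m \<sigma>) = (\<Sum>i<k. Suc (\<sigma> i) * f i)" for \<sigma>
    by (simp add: m_def weight_sum weight_single del: One_nat_def mult_Suc)
  have "colminor k f = (\<Sum>\<sigma>\<in>?P. of_int (sign \<sigma>) * Poly_Mapping.single (m \<sigma>) 1)"
    by (simp add: colminor_def indet_def prod_single m_def)
  also have "\<dots> = Poly_Mapping.single (m id) 1 + (\<Sum>\<sigma>\<in>?P - {id}. of_int (sign \<sigma>) * Poly_Mapping.single (m \<sigma>) 1)"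
    using fin permutes_id by (subst sum.remove[of _ id]) auto
  finally have eq: "colminor k f - Poly_Mapping.single (m id) 1
    = (\<Sum>\<sigma>\<in>?P - {id}. of_int (sign \<sigma>) * Poly_Mapping.single (m \<sigma>) 1)" by simp
  have "weight x < weight (m id)"
    if x: "x \<in> Poly_Mapping.keys (colminor k f - Poly_Mapping.single (m id) 1)" for x
  proof -
    obtain \<sigma> where \<sigma>: "\<sigma> permutes {..<k}" "\<sigma> \<noteq> id"
      and "x \<in> Poly_Mapping.keys (of_int (sign \<sigma>) * Poly_Mapping.single (m \<sigma>) (1::complex))"
      using x keys_sum unfolding eq by fastforce
    then have "x = m \<sigma>"
      by (cases \<sigma> rule: sign_cases) (auto split: if_splits)
    then show ?thesis
      using strict_rearrangement[OF assms \<sigma>] by (simp add: weight_m)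
  qed
  then show ?thesis by (simp add: leads_def m_def)
qed

section \<open>Garnir relations\<close>

lemma cpoly_eq_uminus_self: "x = - x \<Longrightarrow> x = 0" for x :: cpoly
proof (rule poly_mapping_eqI)
  fix k assume "x = - x"
  then have "Poly_Mapping.lookup x k = Poly_Mapping.lookup (- x) k" by (rule arg_cong)
  then have "2 * Poly_Mapping.lookup x k = 0" by (simp only: lookup_uminus mult_2 eq_neg_iff_add_eq_0)
  then show "Poly_Mapping.lookup x k = Poly_Mapping.lookup 0 k" by simp
qed

lemma cpoly_scale_mult_right: "a * cpoly_scale c b = cpoly_scale c (a * b)"
  by (simp add: cpoly_scale_def algebra_simps)

lemma cpoly_scale_mult_left: "cpoly_scale c a * b = cpoly_scale c (a * b)"
  by (simp add: cpoly_scale_def algebra_simps)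

lemma cpoly_scale_of_int: "cpoly_scale (of_int c) p = of_int c * p"
  by (simp add: cpoly_scale_def single_of_int)

lemma mult_mem_span:
  assumes "x \<in> cpoly.span X"
  shows "a * x \<in> cpoly.span ((*) a ` X)"
  using assms
proof (induction rule: cpoly.span_induct_alt)
  case base
  then show ?case by (simp add: cpoly.span_zero)
next
  case (step c x y)
  then show ?case
    unfolding distrib_left cpoly_scale_mult_right
    by (intro cpoly.span_add cpoly.span_scale) (auto intro: cpoly.span_base)
qed

text \<open>Precomposing with the transposition of \<open>a\<close> and \<open>b\<close> only
  exchanges two factors from the same row: the product stays, the sign flips, and the sum equals its
  own negative.\<close>

lemma alternating_sum_eq_0:
  fixes X :: "'r \<Rightarrow> 'c \<Rightarrow> cpoly"
  assumes A: "finite A" "S \<subseteq> A" and ab: "a \<in> S" "b \<in> S" "a \<noteq> b" "\<rho> a = \<rho> b"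
  shows "(\<Sum>\<pi> | \<pi> permutes S. of_int (sign \<pi>) * (\<Prod>s\<in>A. X (\<rho> s) (h (\<pi> s)))) = 0"
proof (rule cpoly_eq_uminus_self)
  let ?t = "transpose a b"
  define F where "F = (\<lambda>\<pi>. of_int (sign \<pi>) * (\<Prod>s\<in>A. X (\<rho> s) (h (\<pi> s))))"
  have t: "?t permutes S" "?t permutes A" using ab A by (auto intro!: permutes_swap_id)
  have "finite S" using A by (rule finite_subset[rotated])
  have neg: "F (\<pi> \<circ> ?t) = - F \<pi>" if \<pi>: "\<pi> permutes S" for \<pi>
  proof -
    have "(\<Prod>s\<in>A. X (\<rho> s) (h ((\<pi> \<circ> ?t) s))) = (\<Prod>s\<in>A. X (\<rho> (?t s)) (h (\<pi> (?t s))))"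
      using ab by (intro prod.cong) (auto simp: transpose_def)
    also have "\<dots> = (\<Prod>s\<in>A. X (\<rho> s) (h (\<pi> s)))"
      using prod.permute[OF t(2), of "\<lambda>s. X (\<rho> s) (h (\<pi> s))"] by (simp add: o_def)
    moreover have "sign (\<pi> \<circ> ?t) = - sign \<pi>"
      using \<pi> t \<open>finite S\<close> ab by (subst sign_compose) (auto simp: permutation_permutes sign_swap_id)
    ultimately show ?thesis by (simp add: F_def)
  qed
  have "(\<Sum>\<pi> | \<pi> permutes S. F \<pi>) = (\<Sum>\<pi> | \<pi> permutes S. F (\<pi> \<circ> ?t))"
    by (rule sum_permutations_compose_right[OF t(1)])
  also have "\<dots> = (\<Sum>\<pi> | \<pi> permutes S. - F \<pi>)"
    by (intro sum.cong refl) (use neg in auto)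
  also have "\<dots> = - (\<Sum>\<pi> | \<pi> permutes S. F \<pi>)" by (rule sum_negf)
  finally show "(\<Sum>\<pi> | \<pi> permutes S. of_int (sign \<pi>) * (\<Prod>s\<in>A. X (\<rho> s) (h (\<pi> s))))
    = - (\<Sum>\<pi> | \<pi> permutes S. of_int (sign \<pi>) * (\<Prod>s\<in>A. X (\<rho> s) (h (\<pi> s))))"
    by (simp add: F_def)
qed

text \<open>In each term of the Leibniz expansions two positions of \<open>S\<close> get the same row,
  because there are only \<open>p\<close> rows.\<close>

lemma garnir_relation:
  assumes S: "S \<subseteq> {..<p + q}" "p < card S" and "q \<le> p"
  shows "(\<Sum>\<pi> | \<pi> permutes S.
    of_int (sign \<pi>) * (colminor p (\<lambda>s. h (\<pi> s)) * colminor q (\<lambda>s. h (\<pi> (p + s))))) = 0"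
proof -
  let ?P = "\<lambda>k. {\<sigma>. \<sigma> permutes {..<k::nat}}"
  \<comment> \<open>Row index of position \<open>s\<close> in the Leibniz term of
    \<open>\<sigma>\<close> and \<open>\<tau>\<close>: positions below \<open>p\<close> belong to
    the first column, the others, shifted down by \<open>p\<close>, to the second.\<close>
  define \<rho> where "\<rho> = (\<lambda>(\<sigma> :: nat \<Rightarrow> nat) (\<tau> :: nat \<Rightarrow> nat) s. if s < p then \<sigma> s else \<tau> (s - p))"
  have swap3: "(\<Sum>a\<in>A. \<Sum>b\<in>B. \<Sum>c\<in>C. F a b c) = (\<Sum>b\<in>B. \<Sum>c\<in>C. \<Sum>a\<in>A. F a b c)"
    for A B C :: "(nat \<Rightarrow> nat) set" and F :: "_ \<Rightarrow> _ \<Rightarrow> _ \<Rightarrow> cpoly"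
  proof -
    have "(\<Sum>a\<in>A. \<Sum>b\<in>B. \<Sum>c\<in>C. F a b c) = (\<Sum>b\<in>B. \<Sum>a\<in>A. \<Sum>c\<in>C. F a b c)" by (rule sum.swap)
    also have "\<dots> = (\<Sum>b\<in>B. \<Sum>c\<in>C. \<Sum>a\<in>A. F a b c)" by (intro sum.cong[OF refl] sum.swap)
    finally show ?thesis .
  qed
  have prod_split: "(\<Prod>i<p. indet (Suc (\<sigma> i), h (\<pi> i))) * (\<Prod>i<q. indet (Suc (\<tau> i), h (\<pi> (p + i))))
      = (\<Prod>s<p + q. indet (Suc (\<rho> \<sigma> \<tau> s), h (\<pi> s)))" for \<sigma> \<tau> \<pi>
  proof -
    have "{..<p + q} = {..<p} \<union> (+) p ` {..<q}"
      by (auto simp: image_iff) (metis le_add_diff_inverse less_diff_conv2 add.commute lessThan_iff not_le)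
    then have "(\<Prod>s<p + q. indet (Suc (\<rho> \<sigma> \<tau> s), h (\<pi> s)))
      = (\<Prod>s<p. indet (Suc (\<rho> \<sigma> \<tau> s), h (\<pi> s))) * (\<Prod>s\<in>(+) p ` {..<q}. indet (Suc (\<rho> \<sigma> \<tau> s), h (\<pi> s)))"
      by (simp, intro prod.union_disjoint) auto
    then show ?thesis by (simp add: prod.reindex \<rho>_def)
  qed
  have zero: "(\<Sum>\<pi> | \<pi> permutes S. of_int (sign \<pi>) * (\<Prod>s<p + q. indet (Suc (\<rho> \<sigma> \<tau> s), h (\<pi> s)))) = 0"
    if "\<sigma> permutes {..<p}" "\<tau> permutes {..<q}" for \<sigma> \<tau>
  proof -
    have "\<rho> \<sigma> \<tau> s < p" if "s \<in> S" for s
    proof (cases "s < p")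
      case False
      then have "s - p < q" using that S by auto
      then have "\<tau> (s - p) < q" using permutes_in_image[OF \<open>\<tau> permutes _\<close>, of "s - p"] by simp
      then show ?thesis using False \<open>q \<le> p\<close> by (simp add: \<rho>_def)
    qed (use permutes_in_image[OF \<open>\<sigma> permutes _\<close>, of s] in \<open>auto simp: \<rho>_def\<close>)
    then have "\<rho> \<sigma> \<tau> ` S \<subseteq> {..<p}" by auto
    then have "card (\<rho> \<sigma> \<tau> ` S) \<le> p" using card_mono[of "{..<p}"] by fastforce
    then have "\<not> inj_on (\<rho> \<sigma> \<tau>) S" using S(2) by (auto dest: card_image)
    then obtain a b where "a \<in> S" "b \<in> S" "a \<noteq> b" "\<rho> \<sigma> \<tau> a = \<rho> \<sigma> \<tau> b"
      by (auto simp: inj_on_def)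
    then show ?thesis
      using alternating_sum_eq_0[OF _ S(1), of a b "\<rho> \<sigma> \<tau>" "\<lambda>i j. indet (Suc i, j)" h] by simp
  qed
  have "(\<Sum>\<pi> | \<pi> permutes S.
      of_int (sign \<pi>) * (colminor p (\<lambda>s. h (\<pi> s)) * colminor q (\<lambda>s. h (\<pi> (p + s)))))
    = (\<Sum>\<pi> | \<pi> permutes S. of_int (sign \<pi>) * (\<Sum>\<sigma>\<in>?P p. \<Sum>\<tau>\<in>?P q.
        of_int (sign \<sigma> * sign \<tau>) * (\<Prod>s<p + q. indet (Suc (\<rho> \<sigma> \<tau> s), h (\<pi> s)))))"
    unfolding colminor_def sum_product prod_split[symmetric] by (simp add: algebra_simps)
  also have "\<dots> = (\<Sum>\<pi> | \<pi> permutes S. \<Sum>\<sigma>\<in>?P p. \<Sum>\<tau>\<in>?P q.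
      of_int (sign \<sigma> * sign \<tau>) * (of_int (sign \<pi>) * (\<Prod>s<p + q. indet (Suc (\<rho> \<sigma> \<tau> s), h (\<pi> s)))))"
    unfolding sum_distrib_left by (intro sum.cong refl) (simp add: algebra_simps)
  also have "\<dots> = (\<Sum>\<sigma>\<in>?P p. \<Sum>\<tau>\<in>?P q. of_int (sign \<sigma> * sign \<tau>) * (\<Sum>\<pi> | \<pi> permutes S.
      of_int (sign \<pi>) * (\<Prod>s<p + q. indet (Suc (\<rho> \<sigma> \<tau> s), h (\<pi> s)))))"
    unfolding sum_distrib_left by (rule swap3)
  also have "\<dots> = 0" using zero by (intro sum.neutral ballI) simp
  finally show ?thesis .
qed

section \<open>Sorting columns and straightening two of them\<close>

lemma sorting_permutation:
  fixes f :: "nat \<Rightarrow> nat"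
  assumes inj: "inj_on f {..<k}"
  obtains \<omega> where "\<omega> permutes {..<k}" "strict_mono_on {..<k} (f \<circ> \<omega>)"
proof -
  have c: "card (f ` {..<k}) = k" using inj by (simp add: card_image)
  obtain e where e: "bij_betw e {..<k} (f ` {..<k})" "strict_mono_on {..<k} e"
    using ex_bij_betw_strict_mono_card[of "f ` {..<k}"] unfolding c by auto
  define \<omega> where "\<omega> = (\<lambda>i. if i \<in> {..<k} then inv_into {..<k} f (e i) else i)"
  have "bij_betw (inv_into {..<k} f) (f ` {..<k}) {..<k}"
    using inj by (intro bij_betw_inv_into) (simp add: bij_betw_def)
  then have "bij_betw (inv_into {..<k} f \<circ> e) {..<k} {..<k}"
    by (rule bij_betw_trans[OF e(1)])
  then have "bij_betw \<omega> {..<k} {..<k}"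
    by (rule bij_betw_cong[THEN iffD1, rotated]) (simp add: \<omega>_def)
  then have "\<omega> permutes {..<k}" by (rule bij_imp_permutes) (simp add: \<omega>_def)
  moreover have "(f \<circ> \<omega>) i = e i" if "i < k" for i
    using that e(1) by (auto simp: \<omega>_def bij_betw_def intro!: f_inv_into_f)
  then have "strict_mono_on {..<k} (f \<circ> \<omega>)"
    using e(2) by (auto simp: strict_mono_on_def)
  ultimately show ?thesis by (rule that)
qed

text \<open>Brings the terms of a Garnir relation back to the strictly increasing columns that
  fillings have. The sum of the entries is recorded because straightening is measured by it.\<close>

lemma colminor_sorted:
  assumes "colminor k f \<noteq> 0"
  obtains f' c where "strict_mono_on {..<k} f'" "f' ` {..<k} = f ` {..<k}" "sum f' {..<k} = sum f {..<k}"
    "colminor k f = cpoly_scale c (colminor k f')"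
proof -
  have "inj_on f {..<k}" using assms colminor_not_inj by blast
  then obtain \<omega> where \<omega>: "\<omega> permutes {..<k}" "strict_mono_on {..<k} (f \<circ> \<omega>)"
    by (rule sorting_permutation)
  show ?thesis
  proof
    show "strict_mono_on {..<k} (f \<circ> \<omega>)" by (fact \<omega>(2))
    show "(f \<circ> \<omega>) ` {..<k} = f ` {..<k}"
      unfolding image_comp[symmetric] permutes_image[OF \<omega>(1)] ..
    show "sum (f \<circ> \<omega>) {..<k} = sum f {..<k}" by (rule sum.permute[OF \<omega>(1), symmetric])
    show "colminor k f = cpoly_scale (of_int (sign \<omega>)) (colminor k (f \<circ> \<omega>))"
      unfolding cpoly_scale_of_int colminor_permute[OF \<omega>(1)]
      by (simp add: mult.assoc[symmetric] flip: of_int_mult)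
  qed
qed

text \<open>The common part cancels. Equally many elements, and at least one, occur only in
  \<open>A\<close> or only in \<open>B\<close>; the former count at most \<open>M\<close> each, the
  latter at least \<open>M + 1\<close>.\<close>

lemma sum_less_of_exchange:
  fixes h :: "'a \<Rightarrow> nat"
  assumes fin: "finite A" "finite B" and "card A = card B" "A \<noteq> B"
    and le: "\<And>x. x \<in> A - B \<Longrightarrow> h x \<le> M" and gt: "\<And>x. x \<in> B - A \<Longrightarrow> M < h x"
  shows "sum h A < sum h B"
proof -
  have split: "sum h A = sum h (A \<inter> B) + sum h (A - B)" "sum h B = sum h (A \<inter> B) + sum h (B - A)"
    using sum.Int_Diff[OF fin(1), of h B] sum.Int_Diff[OF fin(2), of h A] by (simp_all add: Int_commute)
  have c: "card (A - B) = card (B - A)"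
    using card_Diff_subset_Int[of A B] card_Diff_subset_Int[of B A] fin \<open>card A = card B\<close>
    by (simp add: Int_commute)
  have "B - A \<noteq> {}"
  proof
    assume "B - A = {}"
    then have "A - B = {}" using c fin by (metis card_eq_0_iff finite_Diff)
    then show False using \<open>B - A = {}\<close> \<open>A \<noteq> B\<close> by blast
  qed
  then have pos: "card (B - A) > 0" using fin by (simp add: card_gt_0_iff)
  have "sum h (A - B) \<le> card (A - B) * M"
    using sum_bounded_above[of "A - B" h M] le by simp
  also have "\<dots> < card (B - A) * Suc M" using c pos by simp
  also have "\<dots> \<le> sum h (B - A)"
    using sum_bounded_below[of "B - A" "Suc M" h] gt by (simp add: Suc_le_eq)
  finally show ?thesis using split by simp
qed

text \<open>Apply the Garnir relation to the left column from index \<open>i\<close> on and the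
  right column up to index \<open>i\<close>. Permutations keeping the right part in place all give
  back the original product. Every other one brings entries of the left part, which are at least
  \<open>f i\<close>, into the right column in exchange for entries that are at most
  \<open>g i\<close>.\<close>

lemma garnir_straightening:
  fixes f g :: "nat \<Rightarrow> nat"
  assumes f: "strict_mono_on {..<p} f" "f ` {..<p} \<subseteq> V" and g: "strict_mono_on {..<q} g" "g ` {..<q} \<subseteq> V"
    and "q \<le> p" and i: "i < q" "g i < f i"
  shows "colminor p f * colminor q g \<in> cpoly.span
    {colminor p f' * colminor q g' | f' g'.
       strict_mono_on {..<p} f' \<and> f' ` {..<p} \<subseteq> V \<and> strict_mono_on {..<q} g' \<and> g' ` {..<q} \<subseteq> V \<and>
       sum f' {..<p} + sum g' {..<q} = sum f {..<p} + sum g {..<q} \<and> sum g {..<q} < sum g' {..<q}}"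
    (is "_ \<in> cpoly.span ?Z")
proof -
  define h where "h = (\<lambda>s. if s < p then f s else g (s - p))"
  \<comment> \<open>\<open>F\<close> has \<open>p - i\<close> positions in the left column and
    \<open>G\<close> has \<open>i + 1\<close> in the right one; together this is
    \<open>p + 1\<close>, one more than the number of rows.\<close>
  define S F G where "S = {i..p + i}" and "F = {i..<p}" and "G = {p..p + i}"
  have FG: "S = F \<union> G" "F \<inter> G = {}" "S - G = F" "finite F" "finite G" "finite S"
    using \<open>q \<le> p\<close> i by (auto simp: S_def F_def G_def)
  have S_sub: "S \<subseteq> {..<p + q}" using i by (auto simp: S_def)
  define t where "t = (\<lambda>\<pi>. of_int (sign \<pi>) * (colminor p (\<lambda>s. h (\<pi> s)) * colminor q (\<lambda>s. h (\<pi> (p + s)))))"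
  define H where "H = {\<pi>. \<pi> permutes S \<and> \<pi> ` G = G}"
  let ?c = "colminor p f * colminor q g"
  have finP: "finite {\<pi>. \<pi> permutes S}" using FG by (intro finite_permutations)
  have "(\<Sum>\<pi> | \<pi> permutes S. t \<pi>) = 0"
    unfolding t_def by (rule garnir_relation[OF S_sub _ \<open>q \<le> p\<close>]) (simp add: S_def)
  moreover have "(\<Sum>\<pi> | \<pi> permutes S. t \<pi>) = sum t H + sum t ({\<pi>. \<pi> permutes S} - H)"
    using finP by (subst add.commute, intro sum.subset_diff) (auto simp: H_def)
  ultimately have rel: "sum t H = - sum t ({\<pi>. \<pi> permutes S} - H)"
    by (simp add: eq_neg_iff_add_eq_0)

  \<comment> \<open>Such a permutation splits into one of \<open>F\<close> and one of
    \<open>G\<close>. Both signs occur twice, in \<open>sign \<pi>\<close> and in the permuted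
    minors, and cancel.\<close>
  have same: "t \<pi> = ?c" if \<pi>: "\<pi> \<in> H" for \<pi>
  proof -
    define \<pi>F \<pi>G where "\<pi>F = (\<lambda>x. if x \<in> F then \<pi> x else x)" and "\<pi>G = (\<lambda>x. if x \<in> G then \<pi> x else x)"
    have \<pi>S: "\<pi> permutes S" and \<pi>_G: "\<pi> ` G = G" using \<pi> by (auto simp: H_def)
    have inj: "inj_on \<pi> A" for A using permutes_inj[OF \<pi>S] by (rule inj_on_subset) simp
    have \<pi>_F: "\<pi> ` F = F"
      using inj_on_image_set_diff[OF inj[of S], of S G] permutes_image[OF \<pi>S] \<pi>_G FG by auto
    have "bij_betw \<pi>F F F"
      using inj[of F] \<pi>_F by (auto simp: bij_betw_def \<pi>F_def inj_on_def)
    then have pF: "\<pi>F permutes F" by (rule bij_imp_permutes) (simp add: \<pi>F_def)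
    have "bij_betw \<pi>G G G"
      using inj[of G] \<pi>_G by (auto simp: bij_betw_def \<pi>G_def inj_on_def)
    then have pG: "\<pi>G permutes G" by (rule bij_imp_permutes) (simp add: \<pi>G_def)
    have "\<pi> x = x" if "x \<notin> S" for x using \<pi>S that by (auto simp: permutes_def)
    then have comp: "\<pi> = \<pi>F \<circ> \<pi>G"
      using FG \<pi>_G by (auto simp: \<pi>F_def \<pi>G_def fun_eq_iff)
    have sgn: "sign \<pi> = sign \<pi>F * sign \<pi>G"
      unfolding comp using pF pG FG by (intro sign_compose) (auto simp: permutation_permutes)
    have "colminor p (\<lambda>s. h (\<pi> s)) = colminor p (f \<circ> \<pi>F)"
    proof (rule colminor_cong)
      fix s assume "s < p"
      then have "\<pi> s = \<pi>F s" by (auto simp: comp \<pi>G_def G_def)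
      moreover have "\<pi>F s < p" using \<open>s < p\<close> permutes_in_image[OF pF, of s] by (auto simp: F_def \<pi>F_def)
      ultimately show "h (\<pi> s) = (f \<circ> \<pi>F) s" by (simp add: h_def)
    qed
    also have "\<dots> = of_int (sign \<pi>F) * colminor p f"
      using pF by (intro colminor_permute permutes_subset[OF pF]) (auto simp: F_def)
    finally have cF: "colminor p (\<lambda>s. h (\<pi> s)) = of_int (sign \<pi>F) * colminor p f" .
    \<comment> \<open>\<open>\<pi>G\<close> acts on the positions \<open>p..p + i\<close>; shifting
      them down by \<open>p\<close> makes it a permutation of the indices of the right
      column.\<close>
    define \<omega> where "\<omega> = map_permutation G (\<lambda>x. x - p) \<pi>G"
    have inj_sub: "inj_on (\<lambda>x. x - p) G" by (auto simp: inj_on_def G_def)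
    have img: "(\<lambda>x. x - p) ` G = {..i}"
    proof (intro equalityI subsetI)
      fix x assume "x \<in> {..i}"
      then show "x \<in> (\<lambda>x. x - p) ` G" by (intro image_eqI[of _ _ "p + x"]) (auto simp: G_def)
    qed (auto simp: G_def)
    have "\<omega> permutes {..i}"
      unfolding \<omega>_def using inj_sub img pG by (intro map_permutation_permutes) (auto simp: bij_betw_def)
    then have p\<omega>: "\<omega> permutes {..<q}" by (rule permutes_subset) (use i in auto)
    have s\<omega>: "sign \<omega> = sign \<pi>G" unfolding \<omega>_def by (intro sign_map_permutation inj_sub pG FG)
    have \<omega>: "\<omega> s = (if s \<le> i then \<pi>G (p + s) - p else s)" for s
    proof (cases "s \<le> i")
      case True
      then have "p + s \<in> G" by (simp add: G_def)
      then have "inv_into G (\<lambda>x. x - p) s = p + s"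
        using inv_into_f_f[OF inj_sub, of "p + s"] by simp
      then show ?thesis using True img by (simp add: \<omega>_def map_permutation_def restrict_id_def)
    qed (use img in \<open>simp add: \<omega>_def map_permutation_def restrict_id_def\<close>)
    have "colminor q (\<lambda>s. h (\<pi> (p + s))) = colminor q (g \<circ> \<omega>)"
    proof (rule colminor_cong)
      fix s assume "s < q"
      show "h (\<pi> (p + s)) = (g \<circ> \<omega>) s"
      proof (cases "s \<le> i")
        case True
        then have "\<pi>G (p + s) \<in> G" using permutes_in_image[OF pG, of "p + s"] by (simp add: G_def)
        then have "\<pi>G (p + s) \<ge> p" by (simp add: G_def)
        moreover from this have "\<pi>F (\<pi>G (p + s)) = \<pi>G (p + s)" by (simp add: \<pi>F_def F_def)
        ultimately show ?thesis using True by (simp add: comp h_def \<omega>)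
      qed (simp add: comp h_def \<omega> \<pi>F_def \<pi>G_def F_def G_def)
    qed
    also have "\<dots> = of_int (sign \<pi>G) * colminor q g"
      using colminor_permute[OF p\<omega>] s\<omega> by simp
    finally have cG: "colminor q (\<lambda>s. h (\<pi> (p + s))) = of_int (sign \<pi>G) * colminor q g" .
    have sq: "of_int (sign \<sigma>) * of_int (sign \<sigma>) = (1 :: cpoly)" for \<sigma> :: "nat \<Rightarrow> nat"
      by (simp flip: of_int_mult)
    have "t \<pi> = (of_int (sign \<pi>F) * of_int (sign \<pi>F)) * (of_int (sign \<pi>G) * of_int (sign \<pi>G)) * ?c"
      unfolding t_def cF cG sgn of_int_mult by (simp only: mult_ac)
    then show ?thesis unfolding sq by simp
  qed

  have other: "t \<pi> \<in> cpoly.span ?Z" if \<pi>: "\<pi> \<in> {\<pi>. \<pi> permutes S} - H" for \<pi>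
  proof (cases "colminor p (\<lambda>s. h (\<pi> s)) = 0 \<or> colminor q (\<lambda>s. h (\<pi> (p + s))) = 0")
    case True
    then have "t \<pi> = 0" by (auto simp: t_def)
    then show ?thesis by (simp add: cpoly.span_zero)
  next
    case False
    have \<pi>S: "\<pi> permutes S" and \<pi>_G: "\<pi> ` G \<noteq> G" using \<pi> by (auto simp: H_def)
    have \<pi>A: "\<pi> permutes {..<p + q}" using permutes_subset[OF \<pi>S S_sub] .
    have hV: "h s \<in> V" if "s < p + q" for s
      using that f(2) g(2) by (auto simp: h_def)
    have h\<pi>V: "h (\<pi> s) \<in> V" if "s < p + q" for s
      using hV permutes_in_image[OF \<pi>A, of s] that by simp
    obtain f' c where f': "strict_mono_on {..<p} f'" "f' ` {..<p} = (\<lambda>s. h (\<pi> s)) ` {..<p}"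
      "sum f' {..<p} = (\<Sum>s<p. h (\<pi> s))" "colminor p (\<lambda>s. h (\<pi> s)) = cpoly_scale c (colminor p f')"
      using colminor_sorted[of p "\<lambda>s. h (\<pi> s)"] False by blast
    obtain g' d where g': "strict_mono_on {..<q} g'" "g' ` {..<q} = (\<lambda>s. h (\<pi> (p + s))) ` {..<q}"
      "sum g' {..<q} = (\<Sum>s<q. h (\<pi> (p + s)))" "colminor q (\<lambda>s. h (\<pi> (p + s))) = cpoly_scale d (colminor q g')"
      using colminor_sorted[of q "\<lambda>s. h (\<pi> (p + s))"] False by blast
    have shift: "(\<Sum>s<q. F (p + s)) = sum F {p..<p + q}" for F :: "nat \<Rightarrow> nat"
      using sum.shift_bounds_nat_ivl[of F 0 p q] by (simp add: add.commute atLeast0LessThan)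
    have cut: "(\<Sum>s<p. F s) + sum F {p..<p + q} = (\<Sum>s<p + q. F s)" for F :: "nat \<Rightarrow> nat"
      using sum.atLeastLessThan_concat[of 0 p "p + q" F] by (simp add: atLeast0LessThan)
    have total: "sum f' {..<p} + sum g' {..<q} = sum f {..<p} + sum g {..<q}"
    proof -
      have "sum f' {..<p} + sum g' {..<q} = (\<Sum>s<p + q. h (\<pi> s))"
        unfolding f'(3) g'(3) shift[of "\<lambda>s. h (\<pi> s)"] cut ..
      also have "\<dots> = (\<Sum>s<p + q. h s)"
        using sum.permute[OF \<pi>A, of h] by (simp add: o_def)
      also have "\<dots> = (\<Sum>s<p. h s) + (\<Sum>s<q. h (p + s))"
        unfolding shift cut ..
      finally show ?thesis by (simp add: h_def)
    qed
    have "sum g {..<q} < sum g' {..<q}"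
    proof -
      have split: "sum F {p..<p + q} = sum F G + sum F {p + Suc i..<p + q}" for F :: "nat \<Rightarrow> nat"
        using sum.atLeastLessThan_concat[of p "p + Suc i" "p + q" F] i
        by (simp add: G_def atLeastLessThanSuc_atLeastAtMost)
      \<comment> \<open>Beyond \<open>G\<close> the right column lies outside \<open>S\<close> and
        is unchanged. Inside, \<open>g i\<close> separates the entries that leave \<open>G\<close>
        from those that enter it.\<close>
      have "sum h G < sum h (\<pi> ` G)"
      proof (rule sum_less_of_exchange[where M = "g i"])
        show "card G = card (\<pi> ` G)"
          using permutes_inj[OF \<pi>S] by (subst card_image) (auto intro: inj_on_subset)
        show "h x \<le> g i" if "x \<in> G - \<pi> ` G" for x
        proof -
          have x: "p \<le> x" "x - p \<le> i" using that by (auto simp: G_def)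
          then have "g (x - p) \<le> g i"
            by (intro strict_mono_on_leD[OF g(1)]) (use x i in auto)
          then show ?thesis using x by (simp add: h_def)
        qed
        show "g i < h x" if "x \<in> \<pi> ` G - G" for x
        proof -
          have "x \<in> S" using that permutes_image[OF \<pi>S] FG(1) by blast
          then have x: "i \<le> x" "x < p" using that FG by (auto simp: F_def)
          then have "f i \<le> f x" by (intro strict_mono_on_leD[OF f(1)]) auto
          then show ?thesis using i x by (simp add: h_def)
        qed
      qed (use \<pi>_G FG in auto)
      also have "sum h (\<pi> ` G) = (\<Sum>s\<in>G. h (\<pi> s))"
        using permutes_inj[OF \<pi>S] by (subst sum.reindex) (auto intro: inj_on_subset)
      finally have "sum h G < (\<Sum>s\<in>G. h (\<pi> s))" .
      moreover have "sum h {p + Suc i..<p + q} = (\<Sum>s\<in>{p + Suc i..<p + q}. h (\<pi> s))"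
        using \<pi>S by (intro sum.cong) (auto simp: permutes_def S_def)
      ultimately have "(\<Sum>s<q. h (p + s)) < (\<Sum>s<q. h (\<pi> (p + s)))"
        unfolding shift[of h] shift[of "\<lambda>s. h (\<pi> s)"] split by simp
      then show ?thesis unfolding g'(3) by (simp add: h_def)
    qed
    then have "colminor p f' * colminor q g' \<in> ?Z"
      using f'(1,2) g'(1,2) total h\<pi>V by (intro CollectI exI[of _ f'] exI[of _ g']) auto
    then have "cpoly_scale (of_int (sign \<pi>) * c * d) (colminor p f' * colminor q g') \<in> cpoly.span ?Z"
      by (intro cpoly.span_scale cpoly.span_base)
    moreover have "t \<pi> = cpoly_scale (of_int (sign \<pi>) * c * d) (colminor p f' * colminor q g')"
      unfolding t_def f'(4) g'(4) cpoly_scale_of_int[symmetric]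
      by (simp add: cpoly_scale_mult_right cpoly_scale_mult_left mult_ac)
    ultimately show ?thesis by simp
  qed

  have "finite H" using finP by (rule finite_subset[rotated]) (auto simp: H_def)
  moreover have "id \<in> H" by (auto simp: H_def permutes_id)
  ultimately have "card H \<noteq> 0" by auto
  have "of_int (int (card H)) * ?c = sum t H" using same by simp
  then have "cpoly_scale (of_int (int (card H))) ?c \<in> cpoly.span ?Z"
    unfolding cpoly_scale_of_int rel using other
    by (auto intro!: cpoly.span_neg cpoly.span_sum)
  \<comment> \<open>The original product was counted \<open>card H\<close> times; dividing is
    possible in characteristic 0.\<close>
  then have "cpoly_scale (inverse (of_nat (card H))) (cpoly_scale (of_int (int (card H))) ?c) \<in> cpoly.span ?Z"
    by (rule cpoly.span_scale)
  then show ?thesis using \<open>card H \<noteq> 0\<close> by simp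
qed

section \<open>Bideterminants and semistandard tableaux\<close>

text \<open>The value 0 outside the diagram lets rows \<open>i\<close> and \<open>Suc i\<close> be
  compared without a special case for the last row.\<close>

definition row_len :: "nat list \<Rightarrow> nat \<Rightarrow> nat" where
  "row_len lam i = (if 1 \<le> i \<and> i \<le> length lam then lam ! (i - 1) else 0)"

lemma mem_young_diagram_row: "(i, c) \<in> young_diagram lam \<longleftrightarrow> 1 \<le> i \<and> 1 \<le> c \<and> c \<le> row_len lam i"
  by (auto simp: young_diagram_def row_len_def)

definition row_count :: "nat list \<Rightarrow> (nat \<times> nat \<Rightarrow> nat) \<Rightarrow> nat \<Rightarrow> nat \<Rightarrow> nat" where
  "row_count lam T i v = card {c \<in> {1..row_len lam i}. T (i, c) = v}"

text \<open>This is the monomial \<open>m\<^sub>T\<close> of the overview.\<close>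

definition row_monomial :: "nat list \<Rightarrow> (nat \<times> nat \<Rightarrow> nat) \<Rightarrow> (nat \<times> nat) \<Rightarrow>\<^sub>0 nat" where
  "row_monomial lam T = (\<Sum>x\<in>young_diagram lam. Poly_Mapping.single (fst x, T x) 1)"

definition ssyt :: "nat list \<Rightarrow> nat \<Rightarrow> (nat \<times> nat \<Rightarrow> nat) set" where
  "ssyt lam r = {T \<in> col_strict_fillings lam r.
     \<forall>i c. 1 \<le> c \<longrightarrow> (i, Suc c) \<in> young_diagram lam \<longrightarrow> T (i, c) \<le> T (i, Suc c)}"

lemma finite_young_diagram: "finite (young_diagram lam)"
proof (rule finite_subset)
  show "young_diagram lam \<subseteq> (\<Union>i\<in>{1..length lam}. {i} \<times> {1..lam ! (i - 1)})"
    by (auto simp: young_diagram_def)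
qed auto

lemma finite_columns: "finite (columns lam)"
  by (simp add: columns_def finite_young_diagram)

lemma finite_col_strict_fillings: "finite (col_strict_fillings lam r)"
  unfolding col_strict_fillings_def
  by (rule finite_subset[OF _ finite_PiE[of "young_diagram lam" "\<lambda>_. {1..r}"]]) (auto simp: finite_young_diagram)

text \<open>The exponent of the indeterminate with index \<open>(i, v)\<close> counts the
  occurrences of \<open>v\<close> in row \<open>i\<close>.\<close>

lemma row_monomial_eq_iff:
  "row_monomial lam T = row_monomial lam T' \<longleftrightarrow> (\<forall>i\<ge>1. \<forall>v. row_count lam T i v = row_count lam T' i v)"
proof -
  have lookup: "Poly_Mapping.lookup (row_monomial lam T) (i, v) = (if i \<ge> 1 then row_count lam T i v else 0)"
    for T i v
  proof -
    have "Poly_Mapping.lookup (row_monomial lam T) (i, v)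
        = (\<Sum>x\<in>young_diagram lam. if fst x = i \<and> T x = v then 1 else 0)"
      by (simp add: row_monomial_def lookup_sum lookup_single when_def del: One_nat_def)
    also have "\<dots> = card {x \<in> young_diagram lam. fst x = i \<and> T x = v}"
      using finite_young_diagram by (simp add: sum.If_cases Int_def)
    also have "{x \<in> young_diagram lam. fst x = i \<and> T x = v}
        = (if i \<ge> 1 then (\<lambda>c. (i, c)) ` {c \<in> {1..row_len lam i}. T (i, c) = v} else {})"
      by (auto simp: mem_young_diagram_row)
    also have "card \<dots> = (if i \<ge> 1 then row_count lam T i v else 0)"
      by (simp add: row_count_def card_image inj_on_def)
    finally show ?thesis .
  qed
  show ?thesis
  proof
    assume eq: "row_monomial lam T = row_monomial lam T'"
    show "\<forall>i\<ge>1. \<forall>v. row_count lam T i v = row_count lam T' i v"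
      using lookup[of T] lookup[of T'] unfolding eq by metis
  next
    assume eq: "\<forall>i\<ge>1. \<forall>v. row_count lam T i v = row_count lam T' i v"
    show "row_monomial lam T = row_monomial lam T'"
      by (rule poly_mapping_eqI) (metis eq lookup prod.collapse)
  qed
qed

lemma col_strict_fillingsD:
  assumes "T \<in> col_strict_fillings lam r"
  shows "(i, c) \<in> young_diagram lam \<Longrightarrow> T (i, c) \<in> {1..r}"
    and "x \<notin> young_diagram lam \<Longrightarrow> T x = undefined"
    and "(i, c) \<in> young_diagram lam \<Longrightarrow> (i', c) \<in> young_diagram lam \<Longrightarrow> i < i' \<Longrightarrow> T (i, c) < T (i', c)"
  using assms unfolding col_strict_fillings_def by (auto dest: PiE_arb PiE_mem)

lemma col_strict_fillingsI:
  assumes "\<And>i c. (i, c) \<in> young_diagram lam \<Longrightarrow> T (i, c) \<in> {1..r}"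
    and "\<And>x. x \<notin> young_diagram lam \<Longrightarrow> T x = undefined"
    and "\<And>i i' c. (i, c) \<in> young_diagram lam \<Longrightarrow> (i', c) \<in> young_diagram lam \<Longrightarrow> i < i' \<Longrightarrow> T (i, c) < T (i', c)"
  shows "T \<in> col_strict_fillings lam r"
  using assms unfolding col_strict_fillings_def PiE_def Pi_def extensional_def by force

context
  fixes lam :: "nat list"
  assumes part: "is_partition lam"
begin

lemma row_len_antimono:
  assumes "1 \<le> i" "i \<le> i'"
  shows "row_len lam i' \<le> row_len lam i"
proof (cases "i = i' \<or> i' > length lam")
  case False
  then show ?thesis
    using part assms sorted_wrt_nth_less[of "(\<ge>)" lam "i - 1" "i' - 1"]
    by (auto simp: row_len_def is_partition_def)
qed (auto simp: row_len_def)

text \<open>Row lengths decrease, so each column is an initial segment of the rows, and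
  \<open>col_len\<close>, defined as a cardinality, is also the number of its last row.\<close>

lemma mem_young_diagram_col: "(i, c) \<in> young_diagram lam \<longleftrightarrow> 1 \<le> c \<and> 1 \<le> i \<and> i \<le> col_len lam c"
proof (cases "1 \<le> c")
  case True
  let ?A = "{i. (i, c) \<in> young_diagram lam}"
  have fin: "finite ?A" using finite_young_diagram by (rule finite_imageI[of _ fst, THEN finite_subset[rotated]]) force
  have down: "i' \<in> ?A" if "i \<in> ?A" "1 \<le> i'" "i' \<le> i" for i i'
    using that row_len_antimono[of i' i] by (auto simp: mem_young_diagram_row)
  have "?A = {1..card ?A}"
  proof (cases "?A = {}")
    case False
    then have mem: "Max ?A \<in> ?A" using fin by (intro Max_in) auto
    have "?A = {1..Max ?A}"
    proof (intro equalityI subsetI)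
      fix x assume x: "x \<in> ?A"
      then have "x \<le> Max ?A" by (rule Max_ge[OF fin])
      moreover have "1 \<le> x" using x by (simp add: mem_young_diagram_row)
      ultimately show "x \<in> {1..Max ?A}" by (simp only: atLeastAtMost_iff)
    next
      fix x assume "x \<in> {1..Max ?A}"
      then show "x \<in> ?A" using down[OF mem] by (simp only: atLeastAtMost_iff)
    qed
    moreover from this have "card ?A = Max ?A" by (metis card_atLeastAtMost diff_Suc_1)
    ultimately show ?thesis by simp
  qed auto
  then show ?thesis using True unfolding col_len_def by (metis (no_types, lifting) atLeastAtMost_iff mem_Collect_eq)
qed (auto simp: mem_young_diagram_row)

lemma columns_eq: "columns lam = {1..row_len lam 1}"
proof -
  have "c \<in> columns lam \<longleftrightarrow> 1 \<le> c \<and> c \<le> row_len lam 1" for c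
  proof
    assume "c \<in> columns lam"
    then obtain i where "(i, c) \<in> young_diagram lam" by (auto simp: columns_def)
    then show "1 \<le> c \<and> c \<le> row_len lam 1"
      using row_len_antimono[of 1 i] by (auto simp: mem_young_diagram_row)
  next
    assume "1 \<le> c \<and> c \<le> row_len lam 1"
    then have "(1, c) \<in> young_diagram lam" by (simp add: mem_young_diagram_row)
    then show "c \<in> columns lam" unfolding columns_def by (rule image_eqI[rotated]) simp
  qed
  then show ?thesis by (simp add: set_eq_iff)
qed

lemma columns_iff: "c \<in> columns lam \<longleftrightarrow> 1 \<le> c \<and> 1 \<le> col_len lam c"
  using mem_young_diagram_col[of 1 c] by (auto simp: columns_eq mem_young_diagram_row)

lemma row_len_col_len: "1 \<le> i \<Longrightarrow> 1 \<le> c \<Longrightarrow> c \<le> row_len lam i \<longleftrightarrow> i \<le> col_len lam c"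
  using mem_young_diagram_col[of i c] by (auto simp: mem_young_diagram_row)

lemma col_len_antimono: "1 \<le> c \<Longrightarrow> c \<le> d \<Longrightarrow> col_len lam d \<le> col_len lam c"
  using row_len_col_len[of "col_len lam d" d] row_len_col_len[of "col_len lam d" c]
  by (cases "col_len lam d = 0") auto

lemma col_len_le_length: "1 \<le> c \<Longrightarrow> col_len lam c \<le> length lam"
  using row_len_col_len[of "col_len lam c" c]
  by (cases "col_len lam c = 0") (auto simp: row_len_def split: if_splits)

lemma young_diagram_eq_Sigma: "young_diagram lam = (\<lambda>(c, i). (Suc i, c)) ` (SIGMA c:columns lam. {..<col_len lam c})"
proof (intro equalityI subsetI)
  fix x assume "x \<in> young_diagram lam"
  then show "x \<in> (\<lambda>(c, i). (Suc i, c)) ` (SIGMA c:columns lam. {..<col_len lam c})"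
    by (cases x) (auto simp: mem_young_diagram_col columns_iff intro!: image_eqI[of _ _ "(snd x, fst x - 1)"])
qed (auto simp: mem_young_diagram_col columns_iff)

lemma sum_young_diagram:
  "(\<Sum>x\<in>young_diagram lam. f x) = (\<Sum>c\<in>columns lam. \<Sum>i<col_len lam c. f (Suc i, c))"
  unfolding young_diagram_eq_Sigma
  by (subst sum.reindex) (auto simp: inj_on_def sum.Sigma finite_columns case_prod_unfold)

lemma strict_mono_on_column:
  assumes "T \<in> col_strict_fillings lam r" "c \<in> columns lam"
  shows "strict_mono_on {..<col_len lam c} (\<lambda>i. T (Suc i, c))"
  using assms by (auto intro!: strict_mono_onI col_strict_fillingsD(3)[OF assms(1)] simp: mem_young_diagram_col columns_iff)

lemma column_range:
  assumes "T \<in> col_strict_fillings lam r" "c \<in> columns lam"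
  shows "(\<lambda>i. T (Suc i, c)) ` {..<col_len lam c} \<subseteq> {1..r}"
  using assms col_strict_fillingsD(1)[OF assms(1)] by (fastforce simp: mem_young_diagram_col columns_iff)

lemma bideterminant_eq:
  assumes T: "T \<in> col_strict_fillings lam r" and n: "length lam \<le> n"
  shows "bideterminant n r lam T = (\<Prod>c\<in>columns lam. colminor (col_len lam c) (\<lambda>i. T (Suc i, c)))"
  unfolding bideterminant_def
proof (rule prod.cong[OF refl])
  fix c assume c: "c \<in> columns lam"
  have "{1..col_len lam c} = Suc ` {..<col_len lam c}" by (simp add: image_Suc_lessThan)
  then have "col_entries lam T c = (\<lambda>i. T (Suc i, c)) ` {..<col_len lam c}"
    unfolding col_entries_def by (simp add: image_image)
  then show "minor (generic_mat n r) {1..col_len lam c} (col_entries lam T c)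
      = colminor (col_len lam c) (\<lambda>i. T (Suc i, c))"
    using minor_eq_colminor[OF strict_mono_on_column[OF T c] column_range[OF T c], of n] n
      col_len_le_length[of c] c by (simp add: columns_iff)
qed

lemma leads_bideterminant:
  assumes T: "T \<in> col_strict_fillings lam r" and n: "length lam \<le> n"
  shows "leads (bideterminant n r lam T) (row_monomial lam T)"
  unfolding bideterminant_eq[OF assms] row_monomial_def sum_young_diagram fst_conv
  by (intro leads_prod leads_colminor strict_mono_on_column[OF T])

text \<open>A row descent between columns \<open>c\<close> and \<open>Suc c\<close> is removed by
  straightening these two columns; the remaining columns are a common factor \<open>A\<close>. A
  bounded potential that grows in each step makes this terminate.\<close>

lemma bideterminant_in_span_ssyt:
  assumes T: "T \<in> col_strict_fillings lam r" and n: "length lam \<le> n"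
  shows "bideterminant n r lam T \<in> cpoly.span (bideterminant n r lam ` ssyt lam r)"
proof -
  let ?M = "bideterminant n r lam"
  \<comment> \<open>Straightening keeps the total of two adjacent columns and raises the sum of the
    right one, so weighting column sums by the column number gives a growing potential. The bound
    \<open>B\<close> comes from entries being at most \<open>r\<close>.\<close>
  define \<Psi> where "\<Psi> = (\<lambda>T :: nat \<times> nat \<Rightarrow> nat. \<Sum>c\<in>columns lam. c * (\<Sum>i<col_len lam c. T (Suc i, c)))"
  define B where "B = (\<Sum>c\<in>columns lam. c * (col_len lam c * r))"
  have \<Psi>_le: "\<Psi> T \<le> B" if "T \<in> col_strict_fillings lam r" for T
    unfolding \<Psi>_def B_def
  proof (intro sum_mono mult_le_mono2)
    fix c assume "c \<in> columns lam"
    then show "(\<Sum>i<col_len lam c. T (Suc i, c)) \<le> col_len lam c * r"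
      using sum_bounded_above[of "{..<col_len lam c}" "\<lambda>i. T (Suc i, c)" r] column_range[OF that, of c] by force
  qed
  show ?thesis using T
  proof (induction "B - \<Psi> T" arbitrary: T rule: less_induct)
    case (less T)
    note T = less.prems
    show ?case
    proof (cases "T \<in> ssyt lam r")
      case True
      then show ?thesis by (intro cpoly.span_base imageI)
    next
      case False
      then obtain i c where ic: "1 \<le> c" "(i, Suc c) \<in> young_diagram lam" "T (i, Suc c) < T (i, c)"
        using T by (auto simp: ssyt_def not_le)
      define p q where "p = col_len lam c" and "q = col_len lam (Suc c)"
      have qp: "q \<le> p" unfolding p_def q_def using ic by (intro col_len_antimono) auto
      have i: "1 \<le> i" "i \<le> q" using ic by (auto simp: mem_young_diagram_col q_def)
      have cols: "c \<in> columns lam" "Suc c \<in> columns lam"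
        using ic i qp by (auto simp: columns_iff p_def q_def)
      let ?rest = "columns lam - {c, Suc c}"
      define A where "A = (\<Prod>d\<in>?rest. colminor (col_len lam d) (\<lambda>i. T (Suc i, d)))"
      have rest: "columns lam - {c} - {Suc c} = ?rest" by blast
      have prod_split: "(\<Prod>d\<in>columns lam. F d) = F c * (F (Suc c) * (\<Prod>d\<in>?rest. F d))" for F :: "nat \<Rightarrow> cpoly"
        using cols finite_columns prod.remove[of "columns lam" c F] prod.remove[of "columns lam - {c}" "Suc c" F]
        unfolding rest by simp
      have sum_split: "(\<Sum>d\<in>columns lam. F d) = F c + (F (Suc c) + (\<Sum>d\<in>?rest. F d))" for F :: "nat \<Rightarrow> nat"
        using cols finite_columns sum.remove[of "columns lam" c F] sum.remove[of "columns lam - {c}" "Suc c" F]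
        unfolding rest by simp
      have M_split: "?M U = A * (colminor p (\<lambda>i. U (Suc i, c)) * colminor q (\<lambda>i. U (Suc i, Suc c)))"
        if U: "U \<in> col_strict_fillings lam r" "\<And>i d. d \<in> ?rest \<Longrightarrow> i < col_len lam d \<Longrightarrow> U (Suc i, d) = T (Suc i, d)" for U
      proof -
        have "(\<Prod>d\<in>?rest. colminor (col_len lam d) (\<lambda>i. U (Suc i, d))) = A"
          unfolding A_def by (intro prod.cong refl colminor_cong) (use U(2) in auto)
        then show ?thesis
          unfolding bideterminant_eq[OF U(1) n] unfolding prod_split by (simp add: p_def q_def mult.commute mult.left_commute)
      qed
      have \<Psi>_split: "\<Psi> U = c * (\<Sum>i<p. U (Suc i, c)) + Suc c * (\<Sum>i<q. U (Suc i, Suc c))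
          + (\<Sum>d\<in>?rest. d * (\<Sum>i<col_len lam d. U (Suc i, d)))" for U
        unfolding \<Psi>_def sum_split by (simp add: p_def q_def)
      let ?f = "\<lambda>i. T (Suc i, c)" and ?g = "\<lambda>i. T (Suc i, Suc c)"
      let ?Z = "{colminor p f' * colminor q g' | f' g'.
       strict_mono_on {..<p} f' \<and> f' ` {..<p} \<subseteq> {1..r} \<and> strict_mono_on {..<q} g' \<and> g' ` {..<q} \<subseteq> {1..r} \<and>
       sum f' {..<p} + sum g' {..<q} = sum ?f {..<p} + sum ?g {..<q} \<and> sum ?g {..<q} < sum g' {..<q}}"
      \<comment> \<open>Row \<open>i\<close> of the tableau is position \<open>i - 1\<close> of the
        sequences.\<close>
      have "colminor p ?f * colminor q ?g \<in> cpoly.span ?Z"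
        by (rule garnir_straightening[where i = "i - 1"])
          (use strict_mono_on_column[OF T] column_range[OF T] cols ic i qp in \<open>auto simp: p_def q_def\<close>)
      then have "A * (colminor p ?f * colminor q ?g) \<in> cpoly.span ((*) A ` ?Z)"
        by (rule mult_mem_span)
      then have "?M T \<in> cpoly.span ((*) A ` ?Z)"
        using M_split[OF T] by simp
      moreover have "(*) A ` ?Z \<subseteq> cpoly.span (?M ` ssyt lam r)"
      proof clarify
        fix f' g'
        assume f': "strict_mono_on {..<p} f'" "f' ` {..<p} \<subseteq> {1..r}"
          and g': "strict_mono_on {..<q} g'" "g' ` {..<q} \<subseteq> {1..r}"
          and total: "sum f' {..<p} + sum g' {..<q} = sum ?f {..<p} + sum ?g {..<q}"
          and gt: "sum ?g {..<q} < sum g' {..<q}"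
        define U where "U = (\<lambda>(j, d). if (j, d) \<in> young_diagram lam then
            if d = c then f' (j - 1) else if d = Suc c then g' (j - 1) else T (j, d) else undefined)"
        have U_c: "U (Suc j, c) = f' j" if "j < p" for j
          using that ic by (auto simp: U_def mem_young_diagram_col p_def)
        have U_Sc: "U (Suc j, Suc c) = g' j" if "j < q" for j
          using that ic by (auto simp: U_def mem_young_diagram_col q_def)
        have U_rest: "U (j, d) = T (j, d)" if "d \<noteq> c" "d \<noteq> Suc c" for j d
          using that col_strict_fillingsD(2)[OF T] by (auto simp: U_def)
        have U_in: "U \<in> col_strict_fillings lam r"
        proof (rule col_strict_fillingsI)
          fix j d assume jd: "(j, d) \<in> young_diagram lam"
          consider "d = c" "j - 1 < p" | "d = Suc c" "j - 1 < q" | "d \<noteq> c" "d \<noteq> Suc c"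
            using jd by (fastforce simp: mem_young_diagram_col p_def q_def)
          then show "U (j, d) \<in> {1..r}"
          proof cases
            case 3
            then show ?thesis using U_rest col_strict_fillingsD(1)[OF T jd] by simp
          qed (use jd f'(2) g'(2) in \<open>auto simp: U_def\<close>)
        next
          fix x assume "x \<notin> young_diagram lam"
          then show "U x = undefined" by (cases x) (simp add: U_def)
        next
          fix j j' d assume jd: "(j, d) \<in> young_diagram lam" "(j', d) \<in> young_diagram lam" "j < j'"
          consider "d = c" "j' - 1 < p" | "d = Suc c" "j' - 1 < q" | "d \<noteq> c" "d \<noteq> Suc c"
            using jd by (fastforce simp: mem_young_diagram_col p_def q_def)
          then show "U (j, d) < U (j', d)"
          proof cases
            case 1
            then have "f' (j - 1) < f' (j' - 1)"
              using jd by (intro strict_mono_onD[OF f'(1)]) (auto simp: mem_young_diagram_col)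
            then show ?thesis using 1 jd by (simp add: U_def)
          next
            case 2
            then have "g' (j - 1) < g' (j' - 1)"
              using jd by (intro strict_mono_onD[OF g'(1)]) (auto simp: mem_young_diagram_col)
            then show ?thesis using 2 jd by (simp add: U_def)
          next
            case 3
            then show ?thesis using U_rest col_strict_fillingsD(3)[OF T jd] by simp
          qed
        qed
        have M_U: "?M U = A * (colminor p f' * colminor q g')"
          using M_split[OF U_in] U_rest U_c U_Sc
          by (simp add: colminor_cong[of p "\<lambda>i. U (Suc i, c)" f'] colminor_cong[of q "\<lambda>i. U (Suc i, Suc c)" g'])
        have "\<Psi> T < \<Psi> U"
        proof -
          have "(\<Sum>d\<in>?rest. d * (\<Sum>i<col_len lam d. U (Suc i, d))) = (\<Sum>d\<in>?rest. d * (\<Sum>i<col_len lam d. T (Suc i, d)))"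
            by (intro sum.cong refl arg_cong2[where f = "(*)"]) (auto simp: U_rest)
          moreover have "(\<Sum>i<p. U (Suc i, c)) = sum f' {..<p}" "(\<Sum>i<q. U (Suc i, Suc c)) = sum g' {..<q}"
            by (auto intro!: sum.cong simp: U_c U_Sc)
          moreover have "c * sum ?f {..<p} + c * sum ?g {..<q} = c * sum f' {..<p} + c * sum g' {..<q}"
            using total by (metis distrib_left)
          ultimately show ?thesis unfolding \<Psi>_split using gt by simp
        qed
        then have "B - \<Psi> U < B - \<Psi> T" using \<Psi>_le[OF U_in] by simp
        then show "A * (colminor p f' * colminor q g') \<in> cpoly.span (?M ` ssyt lam r)"
          using less.hyps[OF _ U_in] unfolding M_U by simp
      qed
      ultimately show ?thesis
        using cpoly.span_minimal[OF _ cpoly.subspace_span] by blast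
    qed
  qed
qed

end

section \<open>Greedy matchings and non-crossing orders\<close>

lemma count_image_mset_mset_set:
  "finite A \<Longrightarrow> count (image_mset f (mset_set A)) v = card {a \<in> A. f a = v}"
  by (simp add: count_image_mset vimage_def Int_def conj_commute)

lemma image_mset_eq_of_card_fibres:
  assumes "finite A" "finite B"
    and "\<And>v. card {a \<in> A. f a = v} = card {b \<in> B. g b = v}"
  shows "image_mset f (mset_set A) = image_mset g (mset_set B)"
  using assms by (intro multiset_eqI) (simp add: count_image_mset_mset_set)

text \<open>Both sequences are the sorted list of one and the same multiset of values.\<close>

lemma mono_eq_of_card_fibres:
  fixes f g :: "nat \<Rightarrow> nat"
  assumes f: "\<And>i j. 1 \<le> i \<Longrightarrow> i \<le> j \<Longrightarrow> j \<le> m \<Longrightarrow> f i \<le> f j"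
    and g: "\<And>i j. 1 \<le> i \<Longrightarrow> i \<le> j \<Longrightarrow> j \<le> m \<Longrightarrow> g i \<le> g j"
    and fibres: "\<And>v. card {j \<in> {1..m}. f j = v} = card {j \<in> {1..m}. g j = v}"
    and j: "j \<in> {1..m}"
  shows "f j = g j"
proof -
  have sorted: "sorted (map h [1..<Suc m])" if "\<And>i j. 1 \<le> i \<Longrightarrow> i \<le> j \<Longrightarrow> j \<le> m \<Longrightarrow> h i \<le> h j" for h :: "nat \<Rightarrow> nat"
    by (subst sorted_iff_nth_mono) (use that in \<open>auto simp del: upt_Suc\<close>)
  have "mset (map f [1..<Suc m]) = mset (map g [1..<Suc m])"
    using image_mset_eq_of_card_fibres[OF _ _ fibres]
    by (simp add: atLeastLessThanSuc_atLeastAtMost flip: mset_set_upto_eq_mset_upto del: upt_Suc)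
  then have "map f [1..<Suc m] = map g [1..<Suc m]"
    using sorted[of f] sorted[of g] f g by (metis properties_for_sort)
  then show ?thesis using j by (simp add: map_eq_conv del: upt_Suc)
qed

lemma sorting_permutation_from_1:
  fixes f :: "nat \<Rightarrow> nat"
  assumes inj: "inj_on f {1..k}"
  obtains \<pi> where "bij_betw \<pi> {1..k} {1..k}" "strict_mono_on {1..k} (f \<circ> \<pi>)"
proof -
  have Suc: "bij_betw Suc {..<k} {1..k}" by (simp add: bij_betw_def image_Suc_lessThan)
  have pred: "bij_betw (\<lambda>i. i - 1) {1..k} {..<k}"
    by (rule bij_betw_byWitness[where f' = Suc]) auto
  have "inj_on (f \<circ> Suc) {..<k}" using inj Suc by (auto simp: bij_betw_def intro: comp_inj_on)
  then obtain \<omega> where \<omega>: "\<omega> permutes {..<k}" "strict_mono_on {..<k} (f \<circ> Suc \<circ> \<omega>)"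
    by (rule sorting_permutation)
  have "bij_betw (Suc \<circ> \<omega> \<circ> (\<lambda>i. i - 1)) {1..k} {1..k}"
    using pred permutes_imp_bij[OF \<omega>(1)] Suc by (intro bij_betw_trans[of _ _ "{..<k}"])
  moreover have "strict_mono_on {1..k} (f \<circ> (Suc \<circ> \<omega> \<circ> (\<lambda>i. i - 1)))"
    using strict_mono_onD[OF \<omega>(2)] by (auto intro!: strict_mono_onI)
  ultimately show ?thesis by (rule that)
qed

lemma bij_betw_Collect_comp: "bij_betw f A B \<Longrightarrow> bij_betw f {a \<in> A. P (f a)} {b \<in> B. P b}"
  unfolding bij_betw_def inj_on_def by blast

text \<open>The \<open>M\<close> openers sit in row \<open>i\<close> with entries \<open>b\<close>, the \<open>m\<close> closers in row \<open>i + 1\<close> with entries \<open>a\<close>;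
  opener \<open>k\<close> precedes closer \<open>j\<close> iff \<open>b k < a j\<close>, so among equal entries closers come first.\<close>

definition greedy_link :: "nat \<Rightarrow> (nat \<Rightarrow> nat) \<Rightarrow> nat \<Rightarrow> (nat \<Rightarrow> nat) \<Rightarrow> (nat \<Rightarrow> nat) \<Rightarrow> bool" where
  "greedy_link M b m a \<phi> \<longleftrightarrow> (\<forall>j\<in>{1..m}. \<phi> j \<in> {1..M} \<and> b (\<phi> j) < a j \<and> \<phi> j \<notin> \<phi> ` {1..<j} \<and>
     (\<forall>k\<in>{1..M}. \<phi> j < k \<longrightarrow> b k < a j \<longrightarrow> k \<in> \<phi> ` {1..<j}))"

lemma greedy_link_cong:
  assumes "\<And>k. k \<in> {1..M} \<Longrightarrow> b k = b' k" "\<And>j. j \<in> {1..m} \<Longrightarrow> a j = a' j"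
  shows "greedy_link M b m a \<phi> \<longleftrightarrow> greedy_link M b' m a' \<phi>"
  unfolding greedy_link_def using assms by (auto simp del: atLeastAtMost_iff)

text \<open>By induction the same openers are used up before closer \<open>j\<close>. If the two
  choices for \<open>j\<close> differed, the larger one would be a free opener before closer
  \<open>j\<close> beyond the smaller one, which the greedy rule forbids.\<close>

lemma greedy_link_unique:
  assumes \<phi>: "greedy_link M b m a \<phi>" and \<psi>: "greedy_link M b m a \<psi>" and "j \<in> {1..m}"
  shows "\<phi> j = \<psi> j"
  using \<open>j \<in> {1..m}\<close>
proof (induction j rule: less_induct)
  case (less j)
  then have "\<phi> ` {1..<j} = \<psi> ` {1..<j}" by (intro image_cong) auto
  then show ?case
    using \<phi> \<psi> less.prems unfolding greedy_link_def by (metis linorder_neqE_nat)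
qed

text \<open>The openers \<open>1..j\<close> all precede closer \<open>j\<close>, and only
  \<open>j - 1\<close> openers are used before it. So a free one remains, and the last free one is
  taken.\<close>

lemma greedy_link_exists:
  assumes "m \<le> M" and ba: "\<And>j k. 1 \<le> k \<Longrightarrow> k \<le> j \<Longrightarrow> j \<le> m \<Longrightarrow> b k < a j"
  obtains \<phi> where "greedy_link M b m a \<phi>"
proof -
  have "\<exists>\<phi>. greedy_link M b m a \<phi>" using assms
  proof (induction m)
    case 0
    then show ?case by (simp add: greedy_link_def)
  next
    case (Suc m)
    then obtain \<phi> where \<phi>: "greedy_link M b m a \<phi>" by fastforce
    define C where "C = {k \<in> {1..M}. b k < a (Suc m)} - \<phi> ` {1..m}"
    have "\<not> {1..Suc m} \<subseteq> \<phi> ` {1..m}"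
    proof
      assume "{1..Suc m} \<subseteq> \<phi> ` {1..m}"
      then have "card {1..Suc m} \<le> card (\<phi> ` {1..m})" by (intro card_mono) auto
      also have "\<dots> \<le> card {1..m}" by (rule card_image_le) simp
      finally show False by simp
    qed
    then obtain k where "k \<in> {1..Suc m}" "k \<notin> \<phi> ` {1..m}" by blast
    then have "k \<in> C" using Suc.prems by (auto simp: C_def)
    have "finite C" by (simp add: C_def)
    have Max_in_C: "Max C \<in> C" using \<open>finite C\<close> \<open>k \<in> C\<close> by (intro Max_in) auto
    define \<psi> where "\<psi> = \<phi>(Suc m := Max C)"
    have img: "\<psi> ` {1..<j} = \<phi> ` {1..<j}" if "j \<le> Suc m" for j
      using that by (intro image_cong) (auto simp: \<psi>_def)
    have "greedy_link M b (Suc m) a \<psi>"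
      unfolding greedy_link_def
    proof
      fix j assume j: "j \<in> {1..Suc m}"
      show "\<psi> j \<in> {1..M} \<and> b (\<psi> j) < a j \<and> \<psi> j \<notin> \<psi> ` {1..<j} \<and>
        (\<forall>k\<in>{1..M}. \<psi> j < k \<longrightarrow> b k < a j \<longrightarrow> k \<in> \<psi> ` {1..<j})"
      proof (cases "j = Suc m")
        case True
        have "k \<in> \<phi> ` {1..m}" if "k \<in> {1..M}" "Max C < k" "b k < a (Suc m)" for k
        proof (rule ccontr)
          assume "k \<notin> \<phi> ` {1..m}"
          then have "k \<in> C" using that by (simp add: C_def)
          then have "k \<le> Max C" by (rule Max_ge[OF \<open>finite C\<close>])
          then show False using that by simp
        qed
        then show ?thesis
          using Max_in_C img[of "Suc m"] unfolding True by (simp add: \<psi>_def C_def atLeastLessThanSuc_atLeastAtMost)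
      next
        case False
        then have "j \<in> {1..m}" "\<psi> j = \<phi> j" using j by (auto simp: \<psi>_def)
        then show ?thesis using \<phi> img[of j] by (simp add: greedy_link_def)
      qed
    qed
    then show ?case by blast
  qed
  then show ?thesis using that by blast
qed

lemma greedy_link_inj_on:
  assumes "greedy_link M b m a \<phi>"
  shows "inj_on \<phi> {1..m}"
proof (rule linorder_inj_onI)
  fix i j assume "i < j" "i \<in> {1..m}" "j \<in> {1..m}"
  then have "\<phi> i \<in> \<phi> ` {1..<j}" "\<phi> j \<notin> \<phi> ` {1..<j}" using assms by (auto simp: greedy_link_def)
  then show "\<phi> i \<noteq> \<phi> j" by metis
qed auto

text \<open>The order \<open>e\<close> replaces the set partition: it refines the order of the entries of \<open>T\<close>, and ranking the
  cells by \<open>e\<close> turns the columns into the blocks. The last conjunct covers both non-crossing conditions,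
  the second one being the case that \<open>d\<close> ends in row \<open>i\<close>.\<close>

definition noncrossing_order :: "nat list \<Rightarrow> (nat \<times> nat \<Rightarrow> nat) \<Rightarrow> (nat \<times> nat \<Rightarrow> nat) \<Rightarrow> bool" where
  "noncrossing_order lam T e \<longleftrightarrow> inj_on e (young_diagram lam) \<and>
     (\<forall>x\<in>young_diagram lam. \<forall>y\<in>young_diagram lam. T x < T y \<longrightarrow> e x < e y) \<and>
     (\<forall>i c d. (Suc i, c) \<in> young_diagram lam \<longrightarrow> (i, d) \<in> young_diagram lam \<longrightarrow>
        e (i, c) < e (i, d) \<longrightarrow> e (i, d) < e (Suc i, c) \<longrightarrow>
        (Suc i, d) \<in> young_diagram lam \<and> e (Suc i, d) < e (Suc i, c))"

context
  fixes lam :: "nat list"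
  assumes part: "is_partition lam"
begin

lemma ssyt_row_mono:
  assumes S: "S \<in> ssyt lam r" and "1 \<le> c" "c \<le> d" "d \<le> row_len lam i" "1 \<le> i"
  shows "S (i, c) \<le> S (i, d)"
  using \<open>c \<le> d\<close> \<open>d \<le> row_len lam i\<close>
proof (induction d rule: dec_induct)
  case (step d)
  then have "S (i, d) \<le> S (i, Suc d)"
    using S assms by (auto simp: ssyt_def mem_young_diagram_row)
  then show ?case using step by simp
qed simp

text \<open>Each row increases weakly and is therefore the sorted list of its content.\<close>

lemma ssyt_eq_of_row_count:
  assumes "S \<in> ssyt lam r" "S' \<in> ssyt lam r" "\<And>i v. 1 \<le> i \<Longrightarrow> row_count lam S i v = row_count lam S' i v"
  shows "S = S'"
proof
  fix x :: "nat \<times> nat"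
  obtain i c where x: "x = (i, c)" by (cases x)
  show "S x = S' x"
  proof (cases "x \<in> young_diagram lam")
    case True
    then have "S (i, c) = S' (i, c)"
      using assms ssyt_row_mono[OF assms(1)] ssyt_row_mono[OF assms(2)] unfolding x mem_young_diagram_row row_count_def
      by (intro mono_eq_of_card_fibres[of "row_len lam i" "\<lambda>c. S (i, c)" "\<lambda>c. S' (i, c)"]) auto
    then show ?thesis by (simp add: x)
  next
    case False
    then show ?thesis using assms by (auto simp: ssyt_def col_strict_fillingsD(2))
  qed
qed

text \<open>\<open>\<pi> i j\<close> is the column of the \<open>j\<close>-th cell of row
  \<open>i\<close> in the order \<open>e\<close>. Greedy links relate such ranks, not
  columns.\<close>

lemma row_enumeration:
  fixes e :: "nat \<times> nat \<Rightarrow> nat"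
  assumes "inj_on e (young_diagram lam)"
  obtains \<pi> where "\<And>i. 1 \<le> i \<Longrightarrow> bij_betw (\<pi> i) {1..row_len lam i} {1..row_len lam i}"
    and "\<And>i j k. 1 \<le> i \<Longrightarrow> j \<in> {1..row_len lam i} \<Longrightarrow> k \<in> {1..row_len lam i} \<Longrightarrow>
      e (i, \<pi> i j) < e (i, \<pi> i k) \<longleftrightarrow> j < k"
proof -
  have "\<exists>\<rho>. bij_betw \<rho> {1..row_len lam i} {1..row_len lam i} \<and>
      strict_mono_on {1..row_len lam i} ((\<lambda>c. e (i, c)) \<circ> \<rho>)" if "1 \<le> i" for i
  proof -
    have "inj_on (\<lambda>c. e (i, c)) {1..row_len lam i}"
    proof (rule inj_onI)
      fix c d assume "c \<in> {1..row_len lam i}" "d \<in> {1..row_len lam i}" "e (i, c) = e (i, d)"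
      then have "(i, c) = (i, d)" using that by (intro inj_onD[OF assms]) (auto simp: mem_young_diagram_row)
      then show "c = d" by simp
    qed
    then obtain \<rho> where "bij_betw \<rho> {1..row_len lam i} {1..row_len lam i}"
      "strict_mono_on {1..row_len lam i} ((\<lambda>c. e (i, c)) \<circ> \<rho>)"
      by (rule sorting_permutation_from_1)
    then show ?thesis by blast
  qed
  then obtain \<pi> where \<pi>: "\<And>i. 1 \<le> i \<Longrightarrow> bij_betw (\<pi> i) {1..row_len lam i} {1..row_len lam i} \<and>
      strict_mono_on {1..row_len lam i} ((\<lambda>c. e (i, c)) \<circ> \<pi> i)" by metis
  show ?thesis
  proof
    show "bij_betw (\<pi> i) {1..row_len lam i} {1..row_len lam i}" if "1 \<le> i" for i
      using \<pi>[OF that] by blast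
    show "e (i, \<pi> i j) < e (i, \<pi> i k) \<longleftrightarrow> j < k"
      if "1 \<le> i" "j \<in> {1..row_len lam i}" "k \<in> {1..row_len lam i}" for i j k
      using strict_mono_on_less[of "{1..row_len lam i}" "(\<lambda>c. e (i, c)) \<circ> \<pi> i" j k] \<pi>[OF that(1)] that by simp
  qed
qed

text \<open>\<open>\<phi>\<close> sends the rank of a cell to the rank of the cell above it. An
  opener ranked after \<open>\<phi> j\<close> with an entry smaller than that of closer
  \<open>j\<close> lies under the arc of that column; the non-crossing condition then puts its own
  closer earlier, so it has been used. Only strict inequalities of entries occur, so the order that
  \<open>e\<close> chooses among equal entries of the two rows does not affect the link.\<close>

lemma noncrossing_order_greedy:
  assumes T: "T \<in> col_strict_fillings lam r" and e: "noncrossing_order lam T e" and i: "1 \<le> i"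
    and \<pi>: "\<And>i. 1 \<le> i \<Longrightarrow> bij_betw (\<pi> i) {1..row_len lam i} {1..row_len lam i}"
    and \<pi>_mono: "\<And>i j k. 1 \<le> i \<Longrightarrow> j \<in> {1..row_len lam i} \<Longrightarrow> k \<in> {1..row_len lam i} \<Longrightarrow>
      e (i, \<pi> i j) < e (i, \<pi> i k) \<longleftrightarrow> j < k"
    and \<phi>: "\<And>j. j \<in> {1..row_len lam (Suc i)} \<Longrightarrow> \<phi> j \<in> {1..row_len lam i} \<and> \<pi> i (\<phi> j) = \<pi> (Suc i) j"
  shows "greedy_link (row_len lam i) (\<lambda>k. T (i, \<pi> i k)) (row_len lam (Suc i)) (\<lambda>j. T (Suc i, \<pi> (Suc i) j)) \<phi>"
  unfolding greedy_link_def
proof (intro ballI conjI impI)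
  fix j assume j: "j \<in> {1..row_len lam (Suc i)}"
  let ?c = "\<pi> (Suc i) j"
  show "\<phi> j \<in> {1..row_len lam i}" using \<phi>[OF j] by blast
  have c: "?c \<in> {1..row_len lam (Suc i)}" using \<pi>[of "Suc i"] j by (auto simp: bij_betw_def)
  have link: "\<pi> i (\<phi> j) = ?c" using \<phi>[OF j] by blast
  have below: "(Suc i, ?c) \<in> young_diagram lam" using c by (simp add: mem_young_diagram_row)
  moreover have "(i, ?c) \<in> young_diagram lam"
    using c row_len_antimono[OF part i, of "Suc i"] i by (simp add: mem_young_diagram_row)
  ultimately show "T (i, \<pi> i (\<phi> j)) < T (Suc i, ?c)"
    unfolding link by (intro col_strict_fillingsD(3)[OF T]) auto
  show "\<phi> j \<notin> \<phi> ` {1..<j}"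
  proof
    assume "\<phi> j \<in> \<phi> ` {1..<j}"
    then obtain j' where j': "j' \<in> {1..<j}" "\<phi> j' = \<phi> j" by force
    then have "\<pi> (Suc i) j' = \<pi> (Suc i) j" using \<phi>[of j'] link j by auto
    then show False using bij_betw_imp_inj_on[OF \<pi>[of "Suc i"]] j j'(1) by (auto dest: inj_onD)
  qed
  fix k assume k: "k \<in> {1..row_len lam i}" "\<phi> j < k" "T (i, \<pi> i k) < T (Suc i, ?c)"
  let ?d = "\<pi> i k"
  have d: "(i, ?d) \<in> young_diagram lam" using \<pi>[OF i] k(1) i by (auto simp: bij_betw_def mem_young_diagram_row)
  have "e (i, ?c) < e (i, ?d)" using \<pi>_mono[OF i, of "\<phi> j" k] \<phi>[OF j] k link by simp
  moreover have "e (i, ?d) < e (Suc i, ?c)" using e d below k(3) by (simp add: noncrossing_order_def)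
  ultimately have 1: "(Suc i, ?d) \<in> young_diagram lam" "e (Suc i, ?d) < e (Suc i, ?c)"
    using e d below by (auto simp: noncrossing_order_def)
  then have "?d \<in> \<pi> (Suc i) ` {1..row_len lam (Suc i)}"
    using bij_betw_imp_surj_on[OF \<pi>[of "Suc i"]] by (simp add: mem_young_diagram_row)
  then obtain j' where j': "j' \<in> {1..row_len lam (Suc i)}" "?d = \<pi> (Suc i) j'" by blast
  then have "j' < j" using 1(2) \<pi>_mono[of "Suc i" j' j] j by simp
  moreover have "\<phi> j' = k"
    by (rule inj_onD[OF bij_betw_imp_inj_on[OF \<pi>[OF i]]]) (use \<phi>[OF j'(1)] j'(2) k(1) in auto)
  ultimately show "k \<in> \<phi> ` {1..<j}" using j' by (intro image_eqI[of _ _ j']) auto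
qed

text \<open>Sorted by \<open>e\<close> and \<open>e'\<close>, corresponding rows read the same word,
  so by uniqueness of greedy links the ranks are joined from row to row in the same way in
  \<open>T\<close> and \<open>T'\<close>. A correspondence of columns fixed in the first row thus
  persists downwards.\<close>

lemma noncrossing_fillings_same_columns:
  assumes T: "T \<in> col_strict_fillings lam r" and e: "noncrossing_order lam T e"
    and T': "T' \<in> col_strict_fillings lam r" and e': "noncrossing_order lam T' e'"
    and count: "\<And>i v. 1 \<le> i \<Longrightarrow> row_count lam T i v = row_count lam T' i v"
  obtains \<tau> where "bij_betw \<tau> (columns lam) (columns lam)"
    and "\<And>i c. (i, c) \<in> young_diagram lam \<Longrightarrow> (i, \<tau> c) \<in> young_diagram lam \<and> T' (i, \<tau> c) = T (i, c)"
proof -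
  obtain \<pi> where \<pi>: "\<And>i. 1 \<le> i \<Longrightarrow> bij_betw (\<pi> i) {1..row_len lam i} {1..row_len lam i}"
    and \<pi>_mono: "\<And>i j k. 1 \<le> i \<Longrightarrow> j \<in> {1..row_len lam i} \<Longrightarrow> k \<in> {1..row_len lam i} \<Longrightarrow>
      e (i, \<pi> i j) < e (i, \<pi> i k) \<longleftrightarrow> j < k"
    using row_enumeration[of e] e unfolding noncrossing_order_def by metis
  obtain \<pi>' where \<pi>': "\<And>i. 1 \<le> i \<Longrightarrow> bij_betw (\<pi>' i) {1..row_len lam i} {1..row_len lam i}"
    and \<pi>'_mono: "\<And>i j k. 1 \<le> i \<Longrightarrow> j \<in> {1..row_len lam i} \<Longrightarrow> k \<in> {1..row_len lam i} \<Longrightarrow>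
      e' (i, \<pi>' i j) < e' (i, \<pi>' i k) \<longleftrightarrow> j < k"
    using row_enumeration[of e'] e' unfolding noncrossing_order_def by metis
  have row: "U (i, \<rho> i j) \<le> U (i, \<rho> i k)"
    if U: "noncrossing_order lam U f" and \<rho>: "\<And>i. 1 \<le> i \<Longrightarrow> bij_betw (\<rho> i) {1..row_len lam i} {1..row_len lam i}"
      and \<rho>_mono: "\<And>i j k. 1 \<le> i \<Longrightarrow> j \<in> {1..row_len lam i} \<Longrightarrow> k \<in> {1..row_len lam i} \<Longrightarrow>
        f (i, \<rho> i j) < f (i, \<rho> i k) \<longleftrightarrow> j < k"
      and "1 \<le> i" "1 \<le> j" "j \<le> k" "k \<le> row_len lam i" for U f \<rho> i j k
  proof (rule ccontr)
    assume "\<not> U (i, \<rho> i j) \<le> U (i, \<rho> i k)"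
    moreover have "(i, \<rho> i l) \<in> young_diagram lam" if "1 \<le> l" "l \<le> row_len lam i" for l
      using \<rho>[OF \<open>1 \<le> i\<close>] that \<open>1 \<le> i\<close> by (auto simp: bij_betw_def mem_young_diagram_row)
    ultimately have "f (i, \<rho> i k) < f (i, \<rho> i j)"
      using U that by (auto simp: noncrossing_order_def)
    then show False using \<rho>_mono[of i k j] that by simp
  qed
  have count_row: "card {j \<in> {1..row_len lam i}. U (i, \<rho> i j) = v} = row_count lam U i v"
    if \<rho>: "\<And>i. 1 \<le> i \<Longrightarrow> bij_betw (\<rho> i) {1..row_len lam i} {1..row_len lam i}" and "1 \<le> i" for U \<rho> i v
    unfolding row_count_def
  proof (rule bij_betw_same_card)
    show "bij_betw (\<rho> i) {j \<in> {1..row_len lam i}. U (i, \<rho> i j) = v} {c \<in> {1..row_len lam i}. U (i, c) = v}"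
      by (rule bij_betw_Collect_comp[OF \<rho>[OF \<open>1 \<le> i\<close>]])
  qed
  have U_eq: "T (i, \<pi> i j) = T' (i, \<pi>' i j)" if i: "1 \<le> i" and j: "j \<in> {1..row_len lam i}" for i j
  proof (rule mono_eq_of_card_fibres[OF _ _ _ j])
    show "T (i, \<pi> i k) \<le> T (i, \<pi> i l)" if "1 \<le> k" "k \<le> l" "l \<le> row_len lam i" for k l
      by (rule row[OF e \<pi> \<pi>_mono i that])
    show "T' (i, \<pi>' i k) \<le> T' (i, \<pi>' i l)" if "1 \<le> k" "k \<le> l" "l \<le> row_len lam i" for k l
      by (rule row[OF e' \<pi>' \<pi>'_mono i that])
    show "card {j \<in> {1..row_len lam i}. T (i, \<pi> i j) = v} = card {j \<in> {1..row_len lam i}. T' (i, \<pi>' i j) = v}" for v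
      using count_row[OF \<pi> i, of T v] count_row[OF \<pi>' i, of T' v] count[OF i] by metis
  qed
  have ex_link: "\<exists>\<phi>. \<forall>j\<in>{1..row_len lam (Suc i)}. \<phi> j \<in> {1..row_len lam i} \<and> \<rho> i (\<phi> j) = \<rho> (Suc i) j"
    if \<rho>: "\<And>i. 1 \<le> i \<Longrightarrow> bij_betw (\<rho> i) {1..row_len lam i} {1..row_len lam i}" and "1 \<le> i" for \<rho> i
  proof -
    have "\<exists>k. k \<in> {1..row_len lam i} \<and> \<rho> i k = \<rho> (Suc i) j" if j: "j \<in> {1..row_len lam (Suc i)}" for j
    proof -
      have "\<rho> (Suc i) j \<in> {1..row_len lam (Suc i)}" using \<rho>[of "Suc i"] j by (auto simp: bij_betw_def)
      then have "\<rho> (Suc i) j \<in> {1..row_len lam i}" using row_len_antimono[OF part \<open>1 \<le> i\<close>, of "Suc i"] by simp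
      then have "\<rho> (Suc i) j \<in> \<rho> i ` {1..row_len lam i}" using bij_betw_imp_surj_on[OF \<rho>[OF \<open>1 \<le> i\<close>]] by simp
      then show ?thesis by force
    qed
    then show ?thesis by metis
  qed
  \<comment> \<open>Every column has a cell in row 1, so matching the cells of equal rank there
    already defines the map on all columns.\<close>
  define \<tau> where "\<tau> = (\<lambda>c. \<pi>' 1 (inv_into {1..row_len lam 1} (\<pi> 1) c))"
  have \<tau>: "\<forall>j\<in>{1..row_len lam i}. \<pi>' i j = \<tau> (\<pi> i j)" if "1 \<le> i" for i
    using that
  proof (induction i rule: dec_induct)
    case base
    then show ?case using bij_betw_imp_inj_on[OF \<pi>[of 1]] by (simp add: \<tau>_def)
  next
    case (step i)
    obtain \<phi> where \<phi>: "\<And>j. j \<in> {1..row_len lam (Suc i)} \<Longrightarrow> \<phi> j \<in> {1..row_len lam i} \<and> \<pi> i (\<phi> j) = \<pi> (Suc i) j"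
      using ex_link[OF \<pi> step(1)] by blast
    obtain \<psi> where \<psi>: "\<And>j. j \<in> {1..row_len lam (Suc i)} \<Longrightarrow> \<psi> j \<in> {1..row_len lam i} \<and> \<pi>' i (\<psi> j) = \<pi>' (Suc i) j"
      using ex_link[OF \<pi>' step(1)] by blast
    have g: "greedy_link (row_len lam i) (\<lambda>k. T (i, \<pi> i k)) (row_len lam (Suc i)) (\<lambda>j. T (Suc i, \<pi> (Suc i) j)) \<phi>"
      by (rule noncrossing_order_greedy[OF T e step(1) \<pi> \<pi>_mono \<phi>])
    have "greedy_link (row_len lam i) (\<lambda>k. T' (i, \<pi>' i k)) (row_len lam (Suc i)) (\<lambda>j. T' (Suc i, \<pi>' (Suc i) j)) \<psi>"
      by (rule noncrossing_order_greedy[OF T' e' step(1) \<pi>' \<pi>'_mono \<psi>])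
    then have g': "greedy_link (row_len lam i) (\<lambda>k. T (i, \<pi> i k)) (row_len lam (Suc i)) (\<lambda>j. T (Suc i, \<pi> (Suc i) j)) \<psi>"
      using greedy_link_cong[of "row_len lam i" "\<lambda>k. T (i, \<pi> i k)" "\<lambda>k. T' (i, \<pi>' i k)" "row_len lam (Suc i)"
        "\<lambda>j. T (Suc i, \<pi> (Suc i) j)" "\<lambda>j. T' (Suc i, \<pi>' (Suc i) j)" \<psi>] U_eq[of i] U_eq[of "Suc i"] step(1)
      by simp
    show ?case
    proof
      fix j assume j: "j \<in> {1..row_len lam (Suc i)}"
      have "\<pi>' (Suc i) j = \<pi>' i (\<phi> j)" using \<psi>[OF j] greedy_link_unique[OF g g' j] by simp
      also have "\<dots> = \<tau> (\<pi> i (\<phi> j))" using step.IH \<phi>[OF j] by blast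
      finally show "\<pi>' (Suc i) j = \<tau> (\<pi> (Suc i) j)" using \<phi>[OF j] by simp
    qed
  qed
  show ?thesis
  proof
    have "bij_betw (\<pi>' 1 \<circ> inv_into {1..row_len lam 1} (\<pi> 1)) {1..row_len lam 1} {1..row_len lam 1}"
      using \<pi>[of 1] \<pi>'[of 1] by (intro bij_betw_trans[OF bij_betw_inv_into]) auto
    then show "bij_betw \<tau> (columns lam) (columns lam)"
      by (simp add: \<tau>_def columns_eq[OF part] o_def)
    fix i c assume "(i, c) \<in> young_diagram lam"
    then have ic: "1 \<le> i" "c \<in> {1..row_len lam i}" by (auto simp: mem_young_diagram_row)
    then have "c \<in> \<pi> i ` {1..row_len lam i}" using bij_betw_imp_surj_on[OF \<pi>] by simp
    then obtain j where j: "j \<in> {1..row_len lam i}" "c = \<pi> i j" by blast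
    then have \<tau>c: "\<tau> c = \<pi>' i j" using \<tau>[OF ic(1)] by simp
    then have "\<tau> c \<in> {1..row_len lam i}" using \<pi>'[OF ic(1)] j by (auto simp: bij_betw_def)
    then show "(i, \<tau> c) \<in> young_diagram lam \<and> T' (i, \<tau> c) = T (i, c)"
      using ic U_eq[OF ic(1) j(1)] j(2) \<tau>c by (simp add: mem_young_diagram_row)
  qed
qed

end

section \<open>Arranging the columns\<close>

lemma sum_digits_less:
  fixes f :: "nat \<Rightarrow> nat"
  assumes "\<And>i. i \<in> {1..<s} \<Longrightarrow> f i < B" "1 \<le> s" "0 < B"
  shows "(\<Sum>i\<in>{1..<s}. f i * B ^ i) < B ^ s"
  using \<open>1 \<le> s\<close> assms(1)
proof (induction s rule: dec_induct)
  case base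
  then show ?case using \<open>0 < B\<close> by simp
next
  case (step s)
  then have "(\<Sum>i\<in>{1..<s}. f i * B ^ i) < B ^ s" by simp
  moreover have "Suc (f s) * B ^ s \<le> B * B ^ s" using step by (intro mult_le_mono1) (simp add: Suc_le_eq)
  ultimately show ?case using step by (simp add: atLeastLessThanSuc)
qed

text \<open>The digits of \<open>f\<close> below \<open>s\<close> contribute less than
  \<open>B ^ s\<close>, which the larger digit of \<open>g\<close> at \<open>s\<close> outweighs;
  lower digits of \<open>g\<close> only add to its side.\<close>

lemma colex_less:
  fixes f g :: "nat \<Rightarrow> nat"
  assumes "\<And>i. i \<in> {1..K} \<Longrightarrow> f i < B" and s: "s \<in> {1..K}" "f s < g s"
    and eq: "\<And>i. i \<in> {1..K} \<Longrightarrow> s < i \<Longrightarrow> f i = g i"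
  shows "(\<Sum>i\<in>{1..K}. f i * B ^ i) < (\<Sum>i\<in>{1..K}. g i * B ^ i)"
proof -
  have split: "(\<Sum>i\<in>{1..K}. h i) = (\<Sum>i\<in>{1..<s}. h i) + (h s + (\<Sum>i\<in>{Suc s..K}. h i))" for h :: "nat \<Rightarrow> nat"
    using s sum.atLeastLessThan_concat[of 1 s "Suc K" h] sum.atLeast_Suc_lessThan[of s "Suc K" h]
    by (simp add: atLeastLessThanSuc_atLeastAtMost)
  have "0 < B" using assms(1)[OF s(1)] by simp
  then have "(\<Sum>i\<in>{1..<s}. f i * B ^ i) < B ^ s"
    using assms(1) s by (intro sum_digits_less) auto
  moreover have "Suc (f s) * B ^ s \<le> g s * B ^ s" using s by (intro mult_le_mono1) simp
  moreover have "(\<Sum>i\<in>{Suc s..K}. f i * B ^ i) = (\<Sum>i\<in>{Suc s..K}. g i * B ^ i)"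
    using eq s by (intro sum.cong) auto
  ultimately show ?thesis unfolding split by simp
qed

lemma digits_eq:
  fixes f g :: "nat \<Rightarrow> nat"
  assumes f: "\<And>i. i \<in> {1..K} \<Longrightarrow> f i < B" and g: "\<And>i. i \<in> {1..K} \<Longrightarrow> g i < B"
    and eq: "(\<Sum>i\<in>{1..K}. f i * B ^ i) = (\<Sum>i\<in>{1..K}. g i * B ^ i)" and i: "i \<in> {1..K}"
  shows "f i = g i"
proof (rule ccontr)
  assume "f i \<noteq> g i"
  define D where "D = {i \<in> {1..K}. f i \<noteq> g i}"
  have D: "finite D" "i \<in> D" using i \<open>f i \<noteq> g i\<close> by (auto simp: D_def)
  then have "Max D \<in> D" by (intro Max_in) auto
  then have s: "Max D \<in> {1..K}" "f (Max D) \<noteq> g (Max D)" by (auto simp: D_def)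
  have above: "f j = g j" if "j \<in> {1..K}" "Max D < j" for j
  proof (rule ccontr)
    assume "f j \<noteq> g j"
    then have "j \<le> Max D" using that(1) by (intro Max_ge[OF D(1)]) (simp add: D_def)
    then show False using that(2) by simp
  qed
  consider "f (Max D) < g (Max D)" | "g (Max D) < f (Max D)" using s(2) by linarith
  then show False
  proof cases
    case 1
    have "(\<Sum>i\<in>{1..K}. f i * B ^ i) < (\<Sum>i\<in>{1..K}. g i * B ^ i)" by (rule colex_less[where s = "Max D"]) (use f s(1) 1 above in auto)
    then show False using eq by simp
  next
    case 2
    have "(\<Sum>i\<in>{1..K}. g i * B ^ i) < (\<Sum>i\<in>{1..K}. f i * B ^ i)"
      by (rule colex_less[where s = "Max D"]) (use g s(1) 2 above in auto)
    then show False using eq by simp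
  qed
qed

lemma nth_elem_image:
  fixes f :: "nat \<Rightarrow> nat"
  assumes "strict_mono_on {1..k} f" "i \<in> {1..k}"
  shows "nth_elem (f ` {1..k}) i = f i"
proof -
  let ?xs = "map f [1..<Suc k]"
  have "sorted_wrt (<) ?xs"
    using strict_mono_onD[OF assms(1)] by (auto simp: sorted_wrt_iff_nth_less simp del: upt_Suc)
  then have "sorted_list_of_set (set ?xs) = ?xs"
    by (intro sorted_list_of_set.idem_if_sorted_distinct) (simp_all add: strict_sorted_iff)
  moreover have "set ?xs = f ` {1..k}" by (simp add: atLeastLessThanSuc_atLeastAtMost del: upt_Suc)
  moreover have "?xs ! (i - 1) = f i" using assms(2) by (subst nth_map) (auto simp del: upt_Suc)
  ultimately show ?thesis by (simp add: nth_elem_def del: upt_Suc)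
qed

text \<open>Cells below the bottom of a column count as \<open>r + 1\<close>, so that shorter columns get larger codes
  and the code increases weakly over all columns, not only over columns of equal length.\<close>

definition column_code :: "nat list \<Rightarrow> nat \<Rightarrow> (nat \<times> nat \<Rightarrow> nat) \<Rightarrow> nat \<Rightarrow> nat" where
  "column_code lam r T c =
     (\<Sum>i\<in>{1..length lam}. (if (i, c) \<in> young_diagram lam then T (i, c) else r + 1) * (r + 2) ^ i)"

text \<open>The last conjunct of \<open>nct\<close>, named separately because it concerns only the
  order of the columns, whereas \<open>noncrossing_order\<close> concerns their contents.\<close>

definition arranged :: "nat list \<Rightarrow> (nat \<times> nat \<Rightarrow> nat) \<Rightarrow> bool" where
  "arranged lam T \<longleftrightarrow> (\<forall>c\<in>columns lam. \<forall>d\<in>columns lam.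
     c < d \<longrightarrow> col_len lam c = col_len lam d \<longrightarrow> col_entries lam T c \<noteq> col_entries lam T d \<longrightarrow>
     (let s = Max {s \<in> {1..col_len lam c}. T (s, c) \<noteq> T (s, d)} in T (s, c) < T (s, d)))"

context
  fixes lam :: "nat list"
  assumes part: "is_partition lam"
begin

lemma col_len_mem_length: "c \<in> columns lam \<Longrightarrow> i \<in> {1..col_len lam c} \<Longrightarrow> i \<in> {1..length lam}"
  using col_len_le_length[OF part, of c] by (auto simp: columns_iff[OF part])

lemma strict_mono_on_column':
  assumes "T \<in> col_strict_fillings lam r" "c \<in> columns lam"
  shows "strict_mono_on {1..col_len lam c} (\<lambda>i. T (i, c))"
  using assms
  by (auto intro!: strict_mono_onI col_strict_fillingsD(3)[OF assms(1)]
      simp: mem_young_diagram_col[OF part] columns_iff[OF part])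

lemma column_eq_of_entries_eq:
  assumes T: "T \<in> col_strict_fillings lam r" and cd: "c \<in> columns lam" "d \<in> columns lam"
    and "col_len lam c = col_len lam d" "col_entries lam T c = col_entries lam T d" "i \<in> {1..col_len lam c}"
  shows "T (i, c) = T (i, d)"
  using nth_elem_image[OF strict_mono_on_column'[OF T cd(1)], of i]
    nth_elem_image[OF strict_mono_on_column'[OF T cd(2)], of i] assms
  by (simp add: col_entries_def)

lemma column_digit_less:
  assumes "T \<in> col_strict_fillings lam r"
  shows "(if (i, c) \<in> young_diagram lam then T (i, c) else r + 1) < r + 2"
  using col_strict_fillingsD(1)[OF assms, of i c] by auto

lemma column_code_less:
  assumes T: "T \<in> col_strict_fillings lam r" and cd: "c \<in> columns lam" "d \<in> columns lam" "c < d"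
    and len: "col_len lam c = col_len lam d" and s: "s \<in> {1..col_len lam c}" "T (s, c) < T (s, d)"
    and above: "\<And>i. i \<in> {1..col_len lam c} \<Longrightarrow> s < i \<Longrightarrow> T (i, c) = T (i, d)"
  shows "column_code lam r T c < column_code lam r T d"
  unfolding column_code_def
proof (rule colex_less[OF column_digit_less[OF T]])
  show "s \<in> {1..length lam}" using col_len_mem_length[OF cd(1) s(1)] .
  show "(if (s, c) \<in> young_diagram lam then T (s, c) else r + 1) < (if (s, d) \<in> young_diagram lam then T (s, d) else r + 1)"
    using s cd len by (simp add: mem_young_diagram_col[OF part] columns_iff[OF part])
  fix i assume "i \<in> {1..length lam}" "s < i"
  then show "(if (i, c) \<in> young_diagram lam then T (i, c) else r + 1) = (if (i, d) \<in> young_diagram lam then T (i, d) else r + 1)"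
    using above[of i] cd len by (simp add: mem_young_diagram_col[OF part] columns_iff[OF part])
qed

text \<open>The deciding digit belongs to the bottom cell of \<open>c\<close>: an entry at most
  \<open>r\<close> meets the filler \<open>r + 1\<close>, and further down both columns have the
  filler.\<close>

lemma column_code_less_of_shorter:
  assumes T: "T \<in> col_strict_fillings lam r" and cd: "c \<in> columns lam" "d \<in> columns lam"
    and len: "col_len lam d < col_len lam c"
  shows "column_code lam r T c < column_code lam r T d"
  unfolding column_code_def
proof (rule colex_less[OF column_digit_less[OF T]])
  let ?s = "col_len lam c"
  show "?s \<in> {1..length lam}" using col_len_mem_length[OF cd(1), of ?s] len by simp
  have "T (?s, c) \<le> r"
    using col_strict_fillingsD(1)[OF T, of ?s c] cd by (simp add: mem_young_diagram_col[OF part] columns_iff[OF part])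
  then show "(if (?s, c) \<in> young_diagram lam then T (?s, c) else r + 1) < (if (?s, d) \<in> young_diagram lam then T (?s, d) else r + 1)"
    using cd len by (simp add: mem_young_diagram_col[OF part] columns_iff[OF part])
  fix i assume "i \<in> {1..length lam}" "?s < i"
  then show "(if (i, c) \<in> young_diagram lam then T (i, c) else r + 1) = (if (i, d) \<in> young_diagram lam then T (i, d) else r + 1)"
    using len by (simp add: mem_young_diagram_col[OF part])
qed

lemma last_difference:
  assumes T: "T \<in> col_strict_fillings lam r" and cd: "c \<in> columns lam" "d \<in> columns lam"
    and len: "col_len lam c = col_len lam d" and ne: "i \<in> {1..col_len lam c}" "T (i, c) \<noteq> T (i, d)"
  defines "s \<equiv> Max {s \<in> {1..col_len lam c}. T (s, c) \<noteq> T (s, d)}"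
  shows "s \<in> {1..col_len lam c}" "T (s, c) \<noteq> T (s, d)"
    "\<And>i. i \<in> {1..col_len lam c} \<Longrightarrow> s < i \<Longrightarrow> T (i, c) = T (i, d)"
proof -
  let ?D = "{s \<in> {1..col_len lam c}. T (s, c) \<noteq> T (s, d)}"
  have fin: "finite ?D" by simp
  have "s \<in> ?D" unfolding s_def using ne by (intro Max_in) auto
  then show "s \<in> {1..col_len lam c}" "T (s, c) \<noteq> T (s, d)" by auto
  fix i assume i: "i \<in> {1..col_len lam c}" "s < i"
  show "T (i, c) = T (i, d)"
  proof (rule ccontr)
    assume "T (i, c) \<noteq> T (i, d)"
    then have "i \<le> s" unfolding s_def using i by (intro Max_ge[OF fin]) auto
    then show False using i by simp
  qed
qed

text \<open>Columns get shorter to the right, which settles different lengths; the arrangement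
  settles equal ones. Being weakly increasing over all columns, the codes can be recovered from
  their multiset.\<close>

lemma column_code_mono:
  assumes T: "T \<in> col_strict_fillings lam r" and "arranged lam T" and cd: "1 \<le> c" "c \<le> d" "d \<le> row_len lam 1"
  shows "column_code lam r T c \<le> column_code lam r T d"
proof -
  have cols: "c \<in> columns lam" "d \<in> columns lam" using cd by (auto simp: columns_eq[OF part])
  consider "c = d" | "col_len lam d < col_len lam c" | "c < d" "col_len lam c = col_len lam d"
    using col_len_antimono[OF part cd(1,2)] cd(2) by linarith
  then show ?thesis
  proof cases
    case 2
    then show ?thesis using column_code_less_of_shorter[OF T cols] by simp
  next
    case 3
    show ?thesis
    proof (cases "\<exists>i\<in>{1..col_len lam c}. T (i, c) \<noteq> T (i, d)")
      case True
      then obtain i where i: "i \<in> {1..col_len lam c}" "T (i, c) \<noteq> T (i, d)" by blast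
      then have "col_entries lam T c \<noteq> col_entries lam T d"
        using column_eq_of_entries_eq[OF T cols 3(2)] by blast
      then have "T (Max {s \<in> {1..col_len lam c}. T (s, c) \<noteq> T (s, d)}, c) < T (Max {s \<in> {1..col_len lam c}. T (s, c) \<noteq> T (s, d)}, d)"
        using \<open>arranged lam T\<close> cols 3 unfolding arranged_def Let_def by blast
      then show ?thesis
        by (intro less_imp_le column_code_less[OF T cols 3 last_difference(1)[OF T cols 3(2) i]]
            last_difference(3)[OF T cols 3(2) i])
    next
      case False
      then have "column_code lam r T c = column_code lam r T d"
        unfolding column_code_def using 3 cols
        by (intro sum.cong refl arg_cong2[where f = "(*)"])
          (simp add: mem_young_diagram_col[OF part] columns_iff[OF part])
      then show ?thesis by simp
    qed
  qed auto
qed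

text \<open>The last row in which two columns of equal length differ decides which code is larger,
  so a pair in the wrong order would show up as a descent of the codes.\<close>

lemma arrangedI:
  assumes T: "T \<in> col_strict_fillings lam r"
    and mono: "\<And>c d. c \<in> columns lam \<Longrightarrow> d \<in> columns lam \<Longrightarrow> c < d \<Longrightarrow> col_len lam c = col_len lam d \<Longrightarrow>
      column_code lam r T c \<le> column_code lam r T d"
  shows "arranged lam T"
  unfolding arranged_def Let_def
proof (intro ballI impI)
  fix c d assume cols: "c \<in> columns lam" "d \<in> columns lam" and "c < d"
    and len: "col_len lam c = col_len lam d" and ne: "col_entries lam T c \<noteq> col_entries lam T d"
  obtain i where i: "i \<in> {1..col_len lam c}" "T (i, c) \<noteq> T (i, d)"
    using ne len unfolding col_entries_def by (metis (no_types, lifting) image_cong)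
  let ?s = "Max {s \<in> {1..col_len lam c}. T (s, c) \<noteq> T (s, d)}"
  note s = last_difference[OF T cols len i]
  have "\<not> T (?s, d) < T (?s, c)"
  proof
    assume less: "T (?s, d) < T (?s, c)"
    have "column_code lam r T d < column_code lam r T c"
      unfolding column_code_def
    proof (rule colex_less[OF column_digit_less[OF T]])
      show "?s \<in> {1..length lam}" using col_len_mem_length[OF cols(1) s(1)] .
      show "(if (?s, d) \<in> young_diagram lam then T (?s, d) else r + 1) < (if (?s, c) \<in> young_diagram lam then T (?s, c) else r + 1)"
        using s(1) less cols len by (simp add: mem_young_diagram_col[OF part] columns_iff[OF part])
      fix i assume "i \<in> {1..length lam}" "?s < i"
      then show "(if (i, d) \<in> young_diagram lam then T (i, d) else r + 1) = (if (i, c) \<in> young_diagram lam then T (i, c) else r + 1)"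
        using s(3)[of i] cols len by (simp add: mem_young_diagram_col[OF part] columns_iff[OF part])
    qed
    then show False using mono[OF cols \<open>c < d\<close> len] by simp
  qed
  then show "T (?s, c) < T (?s, d)" using s(2) by simp
qed

text \<open>The correspondence \<open>\<tau>\<close> preserves entries and column lengths, hence
  codes. Both code sequences are then sorted versions of one multiset, so they agree column by
  column, and the digits give back the entries.\<close>

lemma arranged_noncrossing_unique:
  assumes T: "T \<in> col_strict_fillings lam r" "noncrossing_order lam T e" "arranged lam T"
    and T': "T' \<in> col_strict_fillings lam r" "noncrossing_order lam T' e'" "arranged lam T'"
    and count: "\<And>i v. 1 \<le> i \<Longrightarrow> row_count lam T i v = row_count lam T' i v"
  shows "T = T'"
proof -
  obtain \<tau> where bij: "bij_betw \<tau> (columns lam) (columns lam)"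
    and \<tau>: "\<And>i c. (i, c) \<in> young_diagram lam \<Longrightarrow> (i, \<tau> c) \<in> young_diagram lam \<and> T' (i, \<tau> c) = T (i, c)"
    using noncrossing_fillings_same_columns[OF part T(1,2) T'(1,2) count] by blast
  \<comment> \<open>\<open>\<tau>\<close> maps the columns that meet row \<open>i\<close>
    injectively into themselves, hence onto themselves by finiteness. So no other column is sent
    among them, and column lengths are preserved.\<close>
  have reflects: "(i, c) \<in> young_diagram lam" if c: "c \<in> columns lam" and i: "(i, \<tau> c) \<in> young_diagram lam" for i c
  proof -
    have "1 \<le> i" using i by (simp add: mem_young_diagram_row)
    then have sub: "{1..row_len lam i} \<subseteq> columns lam"
      using row_len_antimono[OF part, of 1 i] by (auto simp: columns_eq[OF part])
    have "\<tau> ` {1..row_len lam i} \<subseteq> {1..row_len lam i}"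
      using \<tau>[of i] \<open>1 \<le> i\<close> by (auto simp: mem_young_diagram_row)
    then have "\<tau> ` {1..row_len lam i} = {1..row_len lam i}"
      using inj_on_subset[OF bij_betw_imp_inj_on[OF bij] sub] by (intro endo_inj_surj) auto
    moreover have "\<tau> c \<in> {1..row_len lam i}" using i by (simp add: mem_young_diagram_row)
    ultimately obtain d where d: "d \<in> {1..row_len lam i}" "\<tau> c = \<tau> d" by (metis imageE)
    then have "c = d" using inj_onD[OF bij_betw_imp_inj_on[OF bij], of c d] c sub by blast
    then show ?thesis using d \<open>1 \<le> i\<close> by (simp add: mem_young_diagram_row)
  qed
  have code: "column_code lam r T c = column_code lam r T' (\<tau> c)" if "c \<in> columns lam" for c
    unfolding column_code_def
    by (intro sum.cong refl arg_cong2[where f = "(*)"]) (use \<tau> reflects[OF that] in auto)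
  have eq: "column_code lam r T c = column_code lam r T' c" if "c \<in> {1..row_len lam 1}" for c
  proof (rule mono_eq_of_card_fibres[OF _ _ _ that])
    show "card {c \<in> {1..row_len lam 1}. column_code lam r T c = v} = card {c \<in> {1..row_len lam 1}. column_code lam r T' c = v}" for v
    proof -
      have "card {c \<in> columns lam. column_code lam r T' (\<tau> c) = v} = card {c \<in> columns lam. column_code lam r T' c = v}"
        by (rule bij_betw_same_card[OF bij_betw_Collect_comp[OF bij]])
      moreover have "{c \<in> columns lam. column_code lam r T' (\<tau> c) = v} = {c \<in> columns lam. column_code lam r T c = v}"
        using code by auto
      ultimately show ?thesis by (simp add: columns_eq[OF part])
    qed
  qed (use column_code_mono[OF T(1,3)] column_code_mono[OF T'(1,3)] in auto)
  show ?thesis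
  proof
    fix x :: "nat \<times> nat"
    obtain i c where x: "x = (i, c)" by (cases x)
    show "T x = T' x"
    proof (cases "x \<in> young_diagram lam")
      case True
      then have c: "c \<in> columns lam" and i: "i \<in> {1..col_len lam c}"
        by (auto simp: x mem_young_diagram_col[OF part] columns_iff[OF part])
      have "(if (i, c) \<in> young_diagram lam then T (i, c) else r + 1) = (if (i, c) \<in> young_diagram lam then T' (i, c) else r + 1)"
        using eq[of c] c col_len_mem_length[OF c i] column_digit_less[OF T(1)] column_digit_less[OF T'(1)]
        unfolding columns_eq[OF part] column_code_def
        by (intro digits_eq[where K = "length lam" and B = "r + 2"
              and f = "\<lambda>i. if (i, c) \<in> young_diagram lam then T (i, c) else r + 1"
              and g = "\<lambda>i. if (i, c) \<in> young_diagram lam then T' (i, c) else r + 1"])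
      then show ?thesis using True by (simp add: x)
    next
      case False
      then show ?thesis using col_strict_fillingsD(2)[OF T(1)] col_strict_fillingsD(2)[OF T'(1)] by simp
    qed
  qed
qed

end

section \<open>From semistandard to non-crossing tableaux\<close>

text \<open>The \<open>m\<close> cells of a row that are linked downwards must take over the columns
  of the cells below them; the other cells are distributed freely over the columns
  \<open>m + 1..M\<close>.\<close>

lemma extend_link:
  fixes \<phi> \<rho> :: "nat \<Rightarrow> nat"
  assumes "m \<le> M" and \<phi>: "inj_on \<phi> {1..m}" "\<phi> ` {1..m} \<subseteq> {1..M}" and \<rho>: "bij_betw \<rho> {1..m} {1..m}"
  obtains \<sigma> where "bij_betw \<sigma> {1..M} {1..M}" "\<And>j. j \<in> {1..m} \<Longrightarrow> \<sigma> (\<phi> j) = \<rho> j"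
proof -
  let ?A = "\<phi> ` {1..m}"
  have "card ({1..M} - ?A) = card {m + 1..M}"
    using \<phi> by (subst card_Diff_subset) (auto simp: card_image)
  then obtain h where h: "bij_betw h ({1..M} - ?A) {m + 1..M}"
    using finite_same_card_bij[of "{1..M} - ?A" "{m + 1..M}"] by auto
  define \<sigma> where "\<sigma> = (\<lambda>x. if x \<in> ?A then \<rho> (inv_into {1..m} \<phi> x) else h x)"
  have "bij_betw (\<rho> \<circ> inv_into {1..m} \<phi>) ?A {1..m}"
    using \<phi>(1) \<rho> by (intro bij_betw_trans[OF bij_betw_inv_into]) (auto simp: bij_betw_def)
  then have "bij_betw \<sigma> ?A {1..m}"
    by (rule bij_betw_cong[THEN iffD1, rotated]) (simp add: \<sigma>_def)
  moreover have "bij_betw \<sigma> ({1..M} - ?A) {m + 1..M}"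
    using h by (rule bij_betw_cong[THEN iffD1, rotated]) (simp add: \<sigma>_def)
  ultimately have "bij_betw \<sigma> (?A \<union> ({1..M} - ?A)) ({1..m} \<union> {m + 1..M})"
    by (rule bij_betw_combine) auto
  moreover have "?A \<union> ({1..M} - ?A) = {1..M}" "{1..m} \<union> {m + 1..M} = {1..M}"
    using \<phi>(2) \<open>m \<le> M\<close> by auto
  ultimately have "bij_betw \<sigma> {1..M} {1..M}" by simp
  moreover have "\<sigma> (\<phi> j) = \<rho> j" if "j \<in> {1..m}" for j
    using that \<phi>(1) by (simp add: \<sigma>_def)
  ultimately show ?thesis by (rule that)
qed

lemma lex_pair_less_iff:
  fixes a b :: nat
  assumes "b < B" "b' < B"
  shows "a * B + b < a' * B + b' \<longleftrightarrow> a < a' \<or> (a = a' \<and> b < b')"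
proof -
  have *: "x * B + y < x' * B + y'" if "x < x'" "y < B" for x x' y y'
  proof -
    have "Suc x * B \<le> x' * B" using that by (intro mult_le_mono1) simp
    then show ?thesis using that by simp
  qed
  show ?thesis using *[of a a' b b'] *[of a' a b' b] assms by (cases a a' rule: linorder_cases) auto
qed

context
  fixes lam :: "nat list"
  assumes part: "is_partition lam"
begin

text \<open>Each row of \<open>S\<close> is permuted so that greedily linked cells come to lie in
  one column, which keeps the row contents. Column strictness is the inequality in the greedy rule;
  non-crossing is its choice of the last free opener.\<close>

lemma noncrossing_filling_exists:
  assumes S: "S \<in> ssyt lam r"
  obtains T e where "T \<in> col_strict_fillings lam r" "noncrossing_order lam T e"
    "\<And>i v. 1 \<le> i \<Longrightarrow> row_count lam T i v = row_count lam S i v"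
proof -
  let ?R = "row_len lam" and ?K = "length lam"
  have S_csf: "S \<in> col_strict_fillings lam r" using S by (simp add: ssyt_def)
  have "\<exists>\<phi>. greedy_link (?R i) (\<lambda>k. S (i, k)) (?R (Suc i)) (\<lambda>j. S (Suc i, j)) \<phi>" if i: "1 \<le> i" for i
  proof -
    \<comment> \<open>Semistandardness guarantees enough openers: it places the first
      \<open>j\<close> cells of row \<open>i\<close> before the \<open>j\<close>-th cell of row
      \<open>Suc i\<close>.\<close>
    have "S (i, k) < S (Suc i, j)" if "1 \<le> k" "k \<le> j" "j \<le> ?R (Suc i)" for j k
    proof -
      have j: "j \<le> ?R i" using that(3) row_len_antimono[OF part i, of "Suc i"] by simp
      then have "S (i, k) \<le> S (i, j)" using ssyt_row_mono[OF part S that(1,2)] i by simp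
      also have "\<dots> < S (Suc i, j)"
        using that i j by (intro col_strict_fillingsD(3)[OF S_csf]) (auto simp: mem_young_diagram_row)
      finally show ?thesis .
    qed
    then obtain \<phi> where "greedy_link (?R i) (\<lambda>k. S (i, k)) (?R (Suc i)) (\<lambda>j. S (Suc i, j)) \<phi>"
      using greedy_link_exists[of "?R (Suc i)" "?R i" "\<lambda>k. S (i, k)" "\<lambda>j. S (Suc i, j)"]
        row_len_antimono[OF part i, of "Suc i"] by auto
    then show ?thesis by blast
  qed
  then obtain \<phi> where \<phi>: "\<And>i. 1 \<le> i \<Longrightarrow> greedy_link (?R i) (\<lambda>k. S (i, k)) (?R (Suc i)) (\<lambda>j. S (Suc i, j)) (\<phi> i)"
    by metis
  \<comment> \<open>\<open>\<pi> i j\<close> is the new column of cell \<open>(i, j)\<close>. Rows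
    are treated from the bottom upwards, since linked cells copy the columns already assigned below
    them and the unlinked ones fill up. All rows beyond \<open>?K\<close> are empty, which starts
    the induction.\<close>
  have "\<exists>\<pi>. \<forall>i'\<ge>1. bij_betw (\<pi> i') {1..?R i'} {1..?R i'} \<and> (\<forall>j\<in>{1..?R (Suc i')}. \<pi> i' (\<phi> i' j) = \<pi> (Suc i') j)"
  proof -
    have "\<exists>\<pi>. \<forall>i'\<ge>i. bij_betw (\<pi> i') {1..?R i'} {1..?R i'} \<and> (\<forall>j\<in>{1..?R (Suc i')}. \<pi> i' (\<phi> i' j) = \<pi> (Suc i') j)"
      if "i \<le> Suc ?K" "1 \<le> i" for i
      using that
    proof (induction rule: inc_induct)
      case base
      have "?R i' = 0" if "Suc ?K \<le> i'" for i' using that by (simp add: row_len_def)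
      then show ?case by (intro exI[of _ "\<lambda>_. id"]) (simp add: bij_betw_def)
    next
      case (step i)
      then obtain \<pi> where \<pi>: "\<And>i'. Suc i \<le> i' \<Longrightarrow> bij_betw (\<pi> i') {1..?R i'} {1..?R i'} \<and>
          (\<forall>j\<in>{1..?R (Suc i')}. \<pi> i' (\<phi> i' j) = \<pi> (Suc i') j)" by auto
      have g: "greedy_link (?R i) (\<lambda>k. S (i, k)) (?R (Suc i)) (\<lambda>j. S (Suc i, j)) (\<phi> i)" using \<phi> step by simp
      have "?R (Suc i) \<le> ?R i" using row_len_antimono[OF part, of i "Suc i"] step by simp
      moreover have "\<phi> i ` {1..?R (Suc i)} \<subseteq> {1..?R i}" using g unfolding greedy_link_def by blast
      moreover have "bij_betw (\<pi> (Suc i)) {1..?R (Suc i)} {1..?R (Suc i)}" using \<pi> by blast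
      ultimately obtain \<sigma> where \<sigma>: "bij_betw \<sigma> {1..?R i} {1..?R i}"
        "\<And>j. j \<in> {1..?R (Suc i)} \<Longrightarrow> \<sigma> (\<phi> i j) = \<pi> (Suc i) j"
        using extend_link[OF _ greedy_link_inj_on[OF g]] by metis
      have "bij_betw ((\<pi>(i := \<sigma>)) i') {1..?R i'} {1..?R i'} \<and>
          (\<forall>j\<in>{1..?R (Suc i')}. (\<pi>(i := \<sigma>)) i' (\<phi> i' j) = (\<pi>(i := \<sigma>)) (Suc i') j)" if "i \<le> i'" for i'
        using \<sigma> \<pi>[of i'] that by (cases "i' = i") auto
      then show ?case by blast
    qed
    from this[of 1] show ?thesis by simp
  qed
  then obtain \<pi> where \<pi>: "\<And>i. 1 \<le> i \<Longrightarrow> bij_betw (\<pi> i) {1..?R i} {1..?R i}"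
    and link: "\<And>i j. 1 \<le> i \<Longrightarrow> j \<in> {1..?R (Suc i)} \<Longrightarrow> \<pi> i (\<phi> i j) = \<pi> (Suc i) j" by blast
  define \<iota> where "\<iota> = (\<lambda>i. inv_into {1..?R i} (\<pi> i))"
  have \<iota>_bij: "bij_betw (\<iota> i) {1..?R i} {1..?R i}" if "1 \<le> i" for i
    unfolding \<iota>_def by (rule bij_betw_inv_into[OF \<pi>[OF that]])
  have \<iota>_in: "\<iota> i c \<in> {1..?R i}" if "(i, c) \<in> young_diagram lam" for i c
    using bij_betwE[OF \<iota>_bij[of i]] that by (simp add: mem_young_diagram_row)
  have \<pi>_\<iota>: "\<pi> i (\<iota> i c) = c" if "(i, c) \<in> young_diagram lam" for i c
    unfolding \<iota>_def using bij_betw_inv_into_right[OF \<pi>[of i]] that by (simp add: mem_young_diagram_row)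
  have \<iota>_\<pi>: "\<iota> i (\<pi> i j) = j" if "1 \<le> i" "j \<in> {1..?R i}" for i j
    unfolding \<iota>_def using bij_betw_inv_into_left[OF \<pi>[of i]] that by simp
  have \<phi>_in: "\<phi> i j \<in> {1..?R i}" if "1 \<le> i" "j \<in> {1..?R (Suc i)}" for i j
    using \<phi>[OF that(1)] that(2) unfolding greedy_link_def by blast
  have \<iota>_link: "\<iota> i c = \<phi> i (\<iota> (Suc i) c)" if "(Suc i, c) \<in> young_diagram lam" "1 \<le> i" for i c
    using \<iota>_\<pi>[OF that(2) \<phi>_in[OF that(2) \<iota>_in[OF that(1)]]] link[OF that(2) \<iota>_in[OF that(1)]] \<pi>_\<iota>[OF that(1)] by simp
  have above: "(i, c) \<in> young_diagram lam" if "(Suc i, c) \<in> young_diagram lam" "1 \<le> i" for i c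
    using that by (simp add: mem_young_diagram_col[OF part])

  define T where "T = (\<lambda>(i, c). if (i, c) \<in> young_diagram lam then S (i, \<iota> i c) else undefined)"
  \<comment> \<open>One number for the lexicographic order by entry, then lower rows first, then
    position in the row of \<open>S\<close>. The bases exceed the possible values of
    \<open>?K - i\<close> and of \<open>j\<close>. Putting lower rows first among equal entries
    places closers before openers, in accordance with the strict inequalities of
    \<open>greedy_link\<close>.\<close>
  define E where "E = (\<lambda>i j. (S (i, j) * Suc ?K + (?K - i)) * Suc (?R 1) + j)"
  define e where "e = (\<lambda>(i, c). E i (\<iota> i c))"
  have T_S: "T (i, c) = S (i, \<iota> i c)" if "(i, c) \<in> young_diagram lam" for i c using that by (simp add: T_def)
  have \<iota>_cell: "(i, \<iota> i c) \<in> young_diagram lam" if "(i, c) \<in> young_diagram lam" for i c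
    using \<iota>_in[OF that] that by (simp add: mem_young_diagram_row)
  have T_step: "T (i, c) < T (Suc i, c)" if "(Suc i, c) \<in> young_diagram lam" "1 \<le> i" for i c
    using \<phi>[OF that(2)] \<iota>_in[OF that(1)] unfolding T_S[OF that(1)] T_S[OF above[OF that]] \<iota>_link[OF that] greedy_link_def
    by blast
  have T_csf: "T \<in> col_strict_fillings lam r"
  proof (rule col_strict_fillingsI)
    show "T (i, c) \<in> {1..r}" if "(i, c) \<in> young_diagram lam" for i c
      unfolding T_S[OF that] by (rule col_strict_fillingsD(1)[OF S_csf \<iota>_cell[OF that]])
    show "T x = undefined" if "x \<notin> young_diagram lam" for x
      using that by (cases x) (simp add: T_def)
    fix i i' c assume ii': "(i, c) \<in> young_diagram lam" "(i', c) \<in> young_diagram lam" "i < i'"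
    have "Suc i \<le> i'" using ii'(3) by simp
    then show "T (i, c) < T (i', c)" using ii'(2)
    proof (induction rule: dec_induct)
      case base
      then show ?case using T_step ii'(1) by (simp add: mem_young_diagram_row)
    next
      case (step j)
      then have j: "1 \<le> j" by simp
      have "T (i, c) < T (j, c)" by (rule step.IH[OF above[OF step.prems j]])
      also have "\<dots> < T (Suc j, c)" by (rule T_step[OF step.prems j])
      finally show ?case .
    qed
  qed
  have E_less: "E i j < E i' j' \<longleftrightarrow> S (i, j) < S (i', j') \<or> (S (i, j) = S (i', j') \<and> (i' < i \<or> (i = i' \<and> j < j')))"
    if "(i, j) \<in> young_diagram lam" "(i', j') \<in> young_diagram lam" for i j i' j'
  proof -
    have bounds: "j < Suc (?R 1)" "j' < Suc (?R 1)" "i \<le> ?K" "i' \<le> ?K"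
      using that row_len_antimono[OF part, of 1 i] row_len_antimono[OF part, of 1 i']
      by (auto simp: mem_young_diagram_row) (auto simp: row_len_def split: if_splits)
    have lt: "S (i, j) * Suc ?K + (?K - i) < S (i', j') * Suc ?K + (?K - i') \<longleftrightarrow> S (i, j) < S (i', j') \<or> (S (i, j) = S (i', j') \<and> i' < i)"
      if "i \<le> ?K" "i' \<le> ?K" for i j i' j'
      using that by (subst lex_pair_less_iff) auto
    have "x = y \<longleftrightarrow> \<not> x < y \<and> \<not> y < x" for x y :: nat by linarith
    then have "S (i, j) * Suc ?K + (?K - i) = S (i', j') * Suc ?K + (?K - i') \<longleftrightarrow> S (i, j) = S (i', j') \<and> i = i'"
      using lt[OF bounds(3,4), of j j'] lt[OF bounds(4,3), of j' j] by (metis linorder_neqE_nat less_irrefl)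
    then have "E i j < E i' j' \<longleftrightarrow> (S (i, j) < S (i', j') \<or> (S (i, j) = S (i', j') \<and> i' < i)) \<or>
        ((S (i, j) = S (i', j') \<and> i = i') \<and> j < j')"
      unfolding E_def lex_pair_less_iff[OF bounds(1,2)] lt[OF bounds(3,4)] by simp
    then show ?thesis by blast
  qed
  have e_less: "e (i, c) < e (i', c') \<longleftrightarrow> T (i, c) < T (i', c') \<or> (T (i, c) = T (i', c') \<and> (i' < i \<or> (i = i' \<and> \<iota> i c < \<iota> i' c')))"
    if "(i, c) \<in> young_diagram lam" "(i', c') \<in> young_diagram lam" for i c i' c'
    using E_less[OF \<iota>_cell[OF that(1)] \<iota>_cell[OF that(2)]] that by (simp add: e_def T_S)
  have "noncrossing_order lam T e"
    unfolding noncrossing_order_def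
  proof (intro conjI ballI allI impI)
    show "inj_on e (young_diagram lam)"
    proof (rule inj_onI)
      fix x y assume xy: "x \<in> young_diagram lam" "y \<in> young_diagram lam" "e x = e y"
      obtain i c where x: "x = (i, c)" by (cases x)
      obtain i' c' where y: "y = (i', c')" by (cases y)
      have "\<not> e x < e y" "\<not> e y < e x" using xy by auto
      then have "i = i'" "\<iota> i c = \<iota> i' c'" using e_less[of i c i' c'] e_less[of i' c' i c] xy unfolding x y
        by (metis linorder_neqE_nat)+
      then show "x = y" using \<pi>_\<iota>[of i c] \<pi>_\<iota>[of i' c'] xy unfolding x y by metis
    qed
    show "e x < e y" if "x \<in> young_diagram lam" "y \<in> young_diagram lam" "T x < T y" for x y
      using that e_less by (cases x; cases y) simp
    fix i c d
    assume c: "(Suc i, c) \<in> young_diagram lam" and d: "(i, d) \<in> young_diagram lam"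
      and less: "e (i, c) < e (i, d)" "e (i, d) < e (Suc i, c)"
    have i: "1 \<le> i" using d by (simp add: mem_young_diagram_row)
    have "\<iota> i c < \<iota> i d"
    proof (rule ccontr)
      assume "\<not> \<iota> i c < \<iota> i d"
      then have "T (i, d) \<le> T (i, c)"
        using ssyt_row_mono[OF part S, of "\<iota> i d" "\<iota> i c" i] \<iota>_in[OF d] \<iota>_in[OF above[OF c i]] i
        by (simp add: T_S[OF d] T_S[OF above[OF c i]])
      then show False using less(1) e_less[OF above[OF c i] d] \<open>\<not> \<iota> i c < \<iota> i d\<close> by auto
    qed
    moreover have "T (i, d) < T (Suc i, c)" using less(2) e_less[OF d c] by auto
    \<comment> \<open>The opener of column \<open>d\<close> was available and lies beyond the one
      taken for \<open>c\<close>. As the last free opener was taken, an earlier closer must already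
      have used it.\<close>
    ultimately have "\<iota> i d \<in> \<phi> i ` {1..<\<iota> (Suc i) c}"
      using \<phi>[OF i] \<iota>_in[OF c] \<iota>_in[OF d] unfolding \<iota>_link[OF c i] T_S[OF d] T_S[OF c] greedy_link_def by blast
    then obtain j where j: "j \<in> {1..<\<iota> (Suc i) c}" "\<iota> i d = \<phi> i j" by blast
    then have j_in: "j \<in> {1..?R (Suc i)}" using \<iota>_in[OF c] by simp
    have "d = \<pi> (Suc i) j" using \<pi>_\<iota>[OF d] j(2) link[OF i j_in] by simp
    then have "(Suc i, d) \<in> young_diagram lam" "\<iota> (Suc i) d = j"
      using bij_betwE[OF \<pi>[of "Suc i"]] j_in \<iota>_\<pi>[of "Suc i" j] by (auto simp: mem_young_diagram_row)
    moreover from this have "T (Suc i, d) \<le> T (Suc i, c)"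
      using ssyt_row_mono[OF part S, of j "\<iota> (Suc i) c" "Suc i"] j \<iota>_in[OF c] by (simp add: T_S c)
    ultimately show "(Suc i, d) \<in> young_diagram lam" "e (Suc i, d) < e (Suc i, c)"
      using e_less[of "Suc i" d "Suc i" c] c j(1) by auto
  qed
  moreover have "row_count lam T i v = row_count lam S i v" if "1 \<le> i" for i v
  proof -
    have "row_count lam T i v = card {c \<in> {1..?R i}. S (i, \<iota> i c) = v}"
      unfolding row_count_def using that by (intro arg_cong[where f = card]) (auto simp: T_def mem_young_diagram_row)
    also have "\<dots> = row_count lam S i v"
      unfolding row_count_def by (rule bij_betw_same_card[OF bij_betw_Collect_comp[OF \<iota>_bij[OF that]]])
    finally show ?thesis .
  qed
  ultimately show ?thesis using that[OF T_csf] by blast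
qed

text \<open>Exchanging two columns of equal length keeps the row contents, and \<open>e\<close> can
  be carried along. Among the finitely many candidates, one that maximises the sum of column numbers
  times codes has no descent of codes within equal lengths.\<close>

lemma arranged_noncrossing_filling_exists:
  assumes S: "S \<in> ssyt lam r"
  obtains T e where "T \<in> col_strict_fillings lam r" "noncrossing_order lam T e" "arranged lam T"
    "\<And>i v. 1 \<le> i \<Longrightarrow> row_count lam T i v = row_count lam S i v"
proof -
  define X where "X = {T \<in> col_strict_fillings lam r. (\<exists>e. noncrossing_order lam T e) \<and>
    (\<forall>i\<ge>1. \<forall>v. row_count lam T i v = row_count lam S i v)}"
  define \<Omega> where "\<Omega> = (\<lambda>T. \<Sum>c\<in>columns lam. c * column_code lam r T c)"
  have "finite X" unfolding X_def by (rule finite_subset[OF _ finite_col_strict_fillings]) auto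
  obtain T0 e0 where "T0 \<in> col_strict_fillings lam r" "noncrossing_order lam T0 e0"
    "\<And>i v. 1 \<le> i \<Longrightarrow> row_count lam T0 i v = row_count lam S i v"
    by (rule noncrossing_filling_exists[OF S]) blast
  then have "T0 \<in> X" by (auto simp: X_def)
  then have "X \<noteq> {}" by blast
  have "Max (\<Omega> ` X) \<in> \<Omega> ` X" using \<open>finite X\<close> \<open>X \<noteq> {}\<close> by (intro Max_in) auto
  then obtain T where T: "T \<in> X" "Max (\<Omega> ` X) = \<Omega> T" by blast
  have max: "\<Omega> U \<le> \<Omega> T" if "U \<in> X" for U
    unfolding T(2)[symmetric] using that \<open>finite X\<close> by (intro Max_ge) auto
  obtain e where T_csf: "T \<in> col_strict_fillings lam r" and e: "noncrossing_order lam T e"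
    and count: "\<And>i v. 1 \<le> i \<Longrightarrow> row_count lam T i v = row_count lam S i v"
    using T(1) by (auto simp: X_def)
  have "arranged lam T"
  proof (rule arrangedI[OF part T_csf], rule ccontr)
    fix c d assume cd: "c \<in> columns lam" "d \<in> columns lam" "c < d" and len: "col_len lam c = col_len lam d"
      and "\<not> column_code lam r T c \<le> column_code lam r T d"
    then have gt: "column_code lam r T d < column_code lam r T c" by simp
    define t where "t = transpose c d"
    have tt: "t (t x) = x" for x by (simp add: t_def)
    have t_cases: "t x = x \<or> (x = c \<and> t x = d) \<or> (x = d \<and> t x = c)" for x
      by (simp add: t_def transpose_def)
    have yd: "(i, t x) \<in> young_diagram lam \<longleftrightarrow> (i, x) \<in> young_diagram lam" for i x
      using t_cases[of x] cd len by (auto simp: mem_young_diagram_col[OF part] columns_iff[OF part])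
    define U where "U = (\<lambda>(i, x). T (i, t x))"
    have U_csf: "U \<in> col_strict_fillings lam r"
    proof (rule col_strict_fillingsI)
      show "U (i, x) \<in> {1..r}" if "(i, x) \<in> young_diagram lam" for i x
        using col_strict_fillingsD(1)[OF T_csf, of i "t x"] that by (simp add: U_def yd)
      show "U x = undefined" if "x \<notin> young_diagram lam" for x
        using col_strict_fillingsD(2)[OF T_csf] that by (cases x) (simp add: U_def yd)
      show "U (i, x) < U (i', x)" if "(i, x) \<in> young_diagram lam" "(i', x) \<in> young_diagram lam" "i < i'" for i i' x
        using col_strict_fillingsD(3)[OF T_csf, of i "t x" i'] that by (simp add: U_def yd)
    qed
    have "noncrossing_order lam U (\<lambda>(i, x). e (i, t x))"
      unfolding noncrossing_order_def
    proof (intro conjI ballI allI impI)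
      show "inj_on (\<lambda>(i, x). e (i, t x)) (young_diagram lam)"
      proof (rule inj_onI)
        fix x y assume "x \<in> young_diagram lam" "y \<in> young_diagram lam"
          "(case x of (i, x) \<Rightarrow> e (i, t x)) = (case y of (i, x) \<Rightarrow> e (i, t x))"
        then have "(fst x, t (snd x)) = (fst y, t (snd y))"
          using e unfolding noncrossing_order_def by (intro inj_onD[of e "young_diagram lam"]) (auto simp: yd case_prod_unfold)
        then show "x = y" using tt by (metis prod.collapse prod.inject)
      qed
      show "(case x of (i, x) \<Rightarrow> e (i, t x)) < (case y of (i, x) \<Rightarrow> e (i, t x))"
        if "x \<in> young_diagram lam" "y \<in> young_diagram lam" "U x < U y" for x y
        using e that unfolding noncrossing_order_def by (cases x; cases y) (simp add: U_def yd)
      fix i x y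
      assume xy: "(Suc i, x) \<in> young_diagram lam" "(i, y) \<in> young_diagram lam"
        "(case (i, x) of (i, x) \<Rightarrow> e (i, t x)) < (case (i, y) of (i, x) \<Rightarrow> e (i, t x))"
        "(case (i, y) of (i, x) \<Rightarrow> e (i, t x)) < (case (Suc i, x) of (i, x) \<Rightarrow> e (i, t x))"
      have "(Suc i, t x) \<in> young_diagram lam" "(i, t y) \<in> young_diagram lam"
        "e (i, t x) < e (i, t y)" "e (i, t y) < e (Suc i, t x)"
        using xy by (simp_all add: yd)
      then have "(Suc i, t y) \<in> young_diagram lam \<and> e (Suc i, t y) < e (Suc i, t x)"
        using e unfolding noncrossing_order_def by blast
      then show "(Suc i, y) \<in> young_diagram lam"
        "(case (Suc i, y) of (i, x) \<Rightarrow> e (i, t x)) < (case (Suc i, x) of (i, x) \<Rightarrow> e (i, t x))"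
        by (auto simp: yd)
    qed
    moreover have "row_count lam U i v = row_count lam S i v" if "1 \<le> i" for i v
    proof -
      have "bij_betw t {1..row_len lam i} {1..row_len lam i}"
        by (rule bij_betw_byWitness[where f' = t]) (use tt yd[of i] that in \<open>auto simp: mem_young_diagram_row\<close>)
      then have "card {c \<in> {1..row_len lam i}. T (i, t c) = v} = card {c \<in> {1..row_len lam i}. T (i, c) = v}"
        by (rule bij_betw_same_card[OF bij_betw_Collect_comp])
      then have "row_count lam U i v = row_count lam T i v" by (simp add: row_count_def U_def)
      then show ?thesis using count[OF that] by simp
    qed
    ultimately have "U \<in> X" using U_csf by (auto simp: X_def)
    moreover have "\<Omega> T < \<Omega> U"
    proof -
      define G where "G = column_code lam r T"
      have code_U: "column_code lam r U x = G (t x)" for x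
        by (simp add: column_code_def G_def U_def yd cong: if_cong)
      let ?rest = "columns lam - {c} - {d}"
      have split: "(\<Sum>x\<in>columns lam. F x) = F c + (F d + sum F ?rest)" for F :: "nat \<Rightarrow> nat"
        using cd finite_columns sum.remove[of "columns lam" c F] sum.remove[of "columns lam - {c}" d F] by simp
      have "(\<Sum>x\<in>?rest. x * G (t x)) = (\<Sum>x\<in>?rest. x * G x)"
        by (intro sum.cong refl) (auto simp: t_def transpose_def)
      \<comment> \<open>The exchange gains the product \<open>a * b\<close> of the two
        differences.\<close>
      moreover have "c * G c + d * G d < c * G d + d * G c"
      proof -
        obtain a where a: "G c = G d + a" "a > 0" using gt less_imp_add_positive unfolding G_def by metis
        obtain b where b: "d = c + b" "b > 0" using cd(3) less_imp_add_positive by metis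
        have "a * b > 0" using a b by simp
        then show ?thesis unfolding a(1) by (simp add: b(1) algebra_simps)
      qed
      ultimately show ?thesis
        unfolding \<Omega>_def code_U split G_def[symmetric] by (simp add: t_def)
    qed
    ultimately show False using max by fastforce
  qed
  then show ?thesis using that[OF T_csf e _ count] by blast
qed

end

section \<open>Non-crossing tableaux and non-crossing orders\<close>

text \<open>One direction only: arcs of \<open>f\<close> against openers of \<open>g\<close>. For
  two columns this has the form of the last conjunct of \<open>noncrossing_order\<close>.\<close>

definition noncrossing_arcs :: "(nat \<Rightarrow> nat) \<Rightarrow> nat \<Rightarrow> (nat \<Rightarrow> nat) \<Rightarrow> nat \<Rightarrow> bool" where
  "noncrossing_arcs f p g q \<longleftrightarrow> (\<forall>i. 1 \<le> i \<longrightarrow> Suc i \<le> p \<longrightarrow> i \<le> q \<longrightarrow> f i < g i \<longrightarrow> g i < f (Suc i) \<longrightarrow>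
     Suc i \<le> q \<and> g (Suc i) < f (Suc i))"

text \<open>Each forbidden pattern with \<open>i < q\<close> violates one of the two arc conditions,
  where disjointness turns a failed inequality into the reverse strict one. At \<open>i = q\<close>
  only \<open>f\<close> can have a further arc, namely when \<open>q < p\<close>; this is the extra
  condition for sets of different sizes.\<close>

lemma noncrossing_larger_first_iff:
  fixes f g :: "nat \<Rightarrow> nat"
  assumes f: "strict_mono_on {1..p} f" and g: "strict_mono_on {1..q} g" and "1 \<le> q" "q \<le> p"
    and disj: "f ` {1..p} \<inter> g ` {1..q} = {}"
  shows "noncrossing_larger_first (f ` {1..p}) (g ` {1..q}) \<longleftrightarrow> noncrossing_arcs f p g q \<and> noncrossing_arcs g q f p"
proof -
  have card: "card (f ` {1..p}) = p" "card (g ` {1..q}) = q"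
    using strict_mono_on_imp_inj_on[OF f] strict_mono_on_imp_inj_on[OF g] by (simp_all add: card_image)
  have F: "nth_elem (f ` {1..p}) i = f i" if "1 \<le> i" "i \<le> p" for i using nth_elem_image[OF f] that by simp
  have G: "nth_elem (g ` {1..q}) i = g i" if "1 \<le> i" "i \<le> q" for i using nth_elem_image[OF g] that by simp
  have ne: "f i \<noteq> g j" if "1 \<le> i" "i \<le> p" "1 \<le> j" "j \<le> q" for i j
  proof -
    have "f i \<in> f ` {1..p}" "g j \<in> g ` {1..q}" using that by simp_all
    then show ?thesis using disj by (metis disjoint_iff)
  qed
  have lf: "noncrossing_larger_first (f ` {1..p}) (g ` {1..q}) \<longleftrightarrow>
     (\<forall>i\<in>{1..q - 1}. \<not> (f i < g i \<and> g i < f (i + 1) \<and> f (i + 1) < g (i + 1)) \<and>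
          \<not> (g i < f i \<and> f i < g (i + 1) \<and> g (i + 1) < f (i + 1))) \<and>
       (p > q \<longrightarrow> \<not> (f q < g q \<and> g q < f (q + 1)))" (is "_ \<longleftrightarrow> (\<forall>i\<in>{1..q - 1}. ?A i) \<and> ?B")
  proof -
    have nth: "nth_elem (f ` {1..p}) i = f i" "nth_elem (f ` {1..p}) (i + 1) = f (i + 1)"
      "nth_elem (g ` {1..q}) i = g i" "nth_elem (g ` {1..q}) (i + 1) = g (i + 1)" if "i \<in> {1..q - 1}" for i
      using F[of i] F[of "i + 1"] G[of i] G[of "i + 1"] that \<open>q \<le> p\<close> by auto
    have last: "nth_elem (f ` {1..p}) q = f q" "nth_elem (g ` {1..q}) q = g q"
      using F[of q] G[of q] \<open>1 \<le> q\<close> \<open>q \<le> p\<close> by auto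
    have succ: "nth_elem (f ` {1..p}) (q + 1) = f (q + 1)" if "p > q" using F[of "q + 1"] that by simp
    show ?thesis
      unfolding noncrossing_larger_first_def Let_def card last
      by (intro arg_cong2[where f = "(\<and>)"] ball_cong imp_cong refl) (simp_all only: nth succ)
  qed
  show ?thesis
    unfolding lf
  proof
    assume *: "(\<forall>i\<in>{1..q - 1}. ?A i) \<and> ?B"
    show "noncrossing_arcs f p g q \<and> noncrossing_arcs g q f p"
      unfolding noncrossing_arcs_def
    proof (intro conjI allI impI)
      fix i assume i: "1 \<le> i" "Suc i \<le> p" "i \<le> q" "f i < g i" "g i < f (Suc i)"
      have "i \<noteq> q" using * i by auto
      then show "Suc i \<le> q" using i by simp
      then have "i \<in> {1..q - 1}" using i by auto
      then have "\<not> f (Suc i) < g (Suc i)" using * i by force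
      then show "g (Suc i) < f (Suc i)" using ne[of "Suc i" "Suc i"] i \<open>Suc i \<le> q\<close> by simp
    next
      fix i assume i: "1 \<le> i" "Suc i \<le> q" "i \<le> p" "g i < f i" "f i < g (Suc i)"
      show "Suc i \<le> p" using i \<open>q \<le> p\<close> by simp
      have "i \<in> {1..q - 1}" using i by auto
      then have "\<not> g (Suc i) < f (Suc i)" using * i by force
      then show "f (Suc i) < g (Suc i)" using ne[of "Suc i" "Suc i"] i \<open>Suc i \<le> p\<close> by simp
    qed
  next
    assume *: "noncrossing_arcs f p g q \<and> noncrossing_arcs g q f p"
    have arcs_fg: "Suc i \<le> q \<and> g (Suc i) < f (Suc i)"
      if "1 \<le> i" "Suc i \<le> p" "i \<le> q" "f i < g i" "g i < f (Suc i)" for i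
      using * that unfolding noncrossing_arcs_def by blast
    have arcs_gf: "f (Suc i) < g (Suc i)"
      if "1 \<le> i" "Suc i \<le> q" "i \<le> p" "g i < f i" "f i < g (Suc i)" for i
      using * that unfolding noncrossing_arcs_def by blast
    show "(\<forall>i\<in>{1..q - 1}. ?A i) \<and> ?B"
    proof (intro conjI ballI)
      fix i assume i: "i \<in> {1..q - 1}"
      then have i': "1 \<le> i" "Suc i \<le> q" "Suc i \<le> p" "i \<le> p" "i \<le> q" using \<open>q \<le> p\<close> by auto
      show "\<not> (f i < g i \<and> g i < f (i + 1) \<and> f (i + 1) < g (i + 1))" using arcs_fg[of i] i' by auto
      show "\<not> (g i < f i \<and> f i < g (i + 1) \<and> g (i + 1) < f (i + 1))" using arcs_gf[of i] i' by auto
    next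
      show ?B using arcs_fg[of q] \<open>1 \<le> q\<close> by auto
    qed
  qed
qed

text \<open>The pair of arc conditions is symmetric, so the case distinction on which set is larger
  disappears.\<close>

lemma noncrossing_iff_arcs:
  fixes f g :: "nat \<Rightarrow> nat"
  assumes f: "strict_mono_on {1..p} f" and g: "strict_mono_on {1..q} g" and "1 \<le> p" "1 \<le> q"
    and disj: "f ` {1..p} \<inter> g ` {1..q} = {}"
  shows "noncrossing (f ` {1..p}) (g ` {1..q}) \<longleftrightarrow> noncrossing_arcs f p g q \<and> noncrossing_arcs g q f p"
proof -
  have card: "card (f ` {1..p}) = p" "card (g ` {1..q}) = q"
    using strict_mono_on_imp_inj_on[OF f] strict_mono_on_imp_inj_on[OF g] by (simp_all add: card_image)
  have disj': "g ` {1..q} \<inter> f ` {1..p} = {}" using disj by (simp add: Int_commute)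
  show ?thesis
    unfolding noncrossing_def card
    using noncrossing_larger_first_iff[OF f g \<open>1 \<le> q\<close> _ disj] noncrossing_larger_first_iff[OF g f \<open>1 \<le> p\<close> _ disj']
    by (cases "q \<le> p") auto
qed

text \<open>Turns the equality of multisets in \<open>nct\<close> into an actual assignment of
  blocks to columns.\<close>

lemma bij_betw_of_image_mset_eq:
  assumes "finite A" "finite B" "image_mset f (mset_set A) = image_mset g (mset_set B)"
  obtains \<beta> where "bij_betw \<beta> A B" "\<And>a. a \<in> A \<Longrightarrow> g (\<beta> a) = f a"
proof -
  have "\<exists>\<beta>. bij_betw \<beta> A B \<and> (\<forall>a\<in>A. g (\<beta> a) = f a)" using assms
  proof (induction A arbitrary: B rule: finite_induct)
    case empty
    then have "B = {}" by (simp add: mset_set_empty_iff)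
    then show ?case by (auto simp: bij_betw_def)
  next
    case (insert a A)
    have "f a \<in># image_mset g (mset_set B)" unfolding insert.prems(2)[symmetric] using insert.hyps by simp
    then obtain b where b: "b \<in> B" "g b = f a" using insert.prems(1) by auto
    have "mset_set B = add_mset b (mset_set (B - {b}))"
      using b(1) insert.prems(1) by (simp add: mset_set.remove)
    then have "image_mset f (mset_set A) = image_mset g (mset_set (B - {b}))"
      using insert.prems(2) insert.hyps b(2) by simp
    then obtain \<beta> where \<beta>: "bij_betw \<beta> A (B - {b})" "\<forall>a\<in>A. g (\<beta> a) = f a"
      using insert.IH[of "B - {b}"] insert.prems(1) by auto
    have "bij_betw (\<beta>(a := b)) (insert a A) (insert b (B - {b}))"
      using \<beta>(1) insert.hyps by (auto simp: bij_betw_def inj_on_def)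
    then have "bij_betw (\<beta>(a := b)) (insert a A) B" using b(1) by (simp add: insert_absorb)
    moreover have "\<forall>x\<in>insert a A. g ((\<beta>(a := b)) x) = f x" using \<beta>(2) b(2) by simp
    ultimately show ?case by blast
  qed
  then show ?thesis using that by blast
qed

lemma increasing_enumeration:
  fixes A :: "nat set"
  assumes "finite A"
  obtains f where "strict_mono_on {1..card A} f" "f ` {1..card A} = A"
proof -
  obtain h where h: "bij_betw h {..<card A} A" "strict_mono_on {..<card A} h"
    using ex_bij_betw_strict_mono_card[OF assms] by blast
  have "(\<lambda>i. i - 1) ` {1..card A} = {..<card A}"
  proof (intro equalityI subsetI)
    fix x assume "x \<in> {..<card A}"
    then show "x \<in> (\<lambda>i. i - 1) ` {1..card A}" by (intro image_eqI[of _ _ "Suc x"]) auto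
  qed auto
  then have "(\<lambda>i. h (i - 1)) ` {1..card A} = A"
    using bij_betw_imp_surj_on[OF h(1)] by (metis image_image)
  moreover have "strict_mono_on {1..card A} (\<lambda>i. h (i - 1))"
    using strict_mono_onD[OF h(2)] by (auto intro!: strict_mono_onI)
  ultimately show ?thesis using that by blast
qed

section \<open>Segments and contents\<close>

lemma segment_less:
  assumes "x \<in> segment \<mu> v" "y \<in> segment \<mu> w" "v < w"
  shows "x < y"
proof -
  have "(\<Sum>u\<in>{1..v}. \<mu> u) \<le> (\<Sum>u\<in>{1..<w}. \<mu> u)" using assms(3) by (intro sum_mono2) auto
  then show ?thesis using assms(1,2) by (auto simp: segment_def)
qed

lemma segment_unique: "x \<in> segment \<mu> v \<Longrightarrow> x \<in> segment \<mu> w \<Longrightarrow> v = w"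
  using segment_less[of x \<mu> v x w] segment_less[of x \<mu> w x v] by (cases v w rule: linorder_cases) auto

lemma segment_cover:
  assumes "1 \<le> x" "x \<le> (\<Sum>u\<in>{1..r}. \<mu> u)"
  obtains v where "v \<in> {1..r}" "x \<in> segment \<mu> v"
proof -
  define v where "v = (LEAST v. x \<le> (\<Sum>u\<in>{1..v}. \<mu> u))"
  have v: "x \<le> (\<Sum>u\<in>{1..v}. \<mu> u)" unfolding v_def by (rule LeastI[where P = "\<lambda>v. x \<le> (\<Sum>u\<in>{1..v}. \<mu> u)", OF assms(2)])
  have "v \<le> r" unfolding v_def by (rule Least_le) (fact assms(2))
  have "v \<noteq> 0" using v assms(1) by (cases v) auto
  then have "\<not> x \<le> (\<Sum>u\<in>{1..v - 1}. \<mu> u)"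
    using not_less_Least[of "v - 1" "\<lambda>v. x \<le> (\<Sum>u\<in>{1..v}. \<mu> u)"] unfolding v_def[symmetric] by simp
  moreover have "{1..<v} = {1..v - 1}" using \<open>v \<noteq> 0\<close> by auto
  ultimately have "x \<in> segment \<mu> v" using v by (simp add: segment_def)
  then show ?thesis using that[of v] \<open>v \<le> r\<close> \<open>v \<noteq> 0\<close> by simp
qed

lemma card_young_diagram: "card (young_diagram lam) = sum_list lam"
proof -
  have "young_diagram lam = (SIGMA i:{1..length lam}. {1..lam ! (i - 1)})"
    by (auto simp: young_diagram_def)
  then have "card (young_diagram lam) = (\<Sum>i\<in>{1..length lam}. lam ! (i - 1))" by simp
  also have "\<dots> = (\<Sum>i\<in>{0..<length lam}. lam ! i)"
    by (rule sum.reindex_bij_witness[of _ Suc "\<lambda>i. i - 1"]) auto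
  finally show ?thesis by (simp add: sum_list_sum_nth)
qed

lemma sum_content:
  assumes "finite A"
  shows "(\<Sum>v\<in>A. content lam T v) = card {x \<in> young_diagram lam. T x \<in> A}"
proof -
  have "(\<Sum>v\<in>A. sum (\<lambda>_. 1 :: nat) {x. x \<in> {x \<in> young_diagram lam. T x \<in> A} \<and> T x = v}) = sum (\<lambda>_. 1 :: nat) {x \<in> young_diagram lam. T x \<in> A}"
    using finite_young_diagram assms by (intro sum.group) auto
  moreover have "{x. x \<in> {x \<in> young_diagram lam. T x \<in> A} \<and> T x = v} = {x \<in> young_diagram lam. T x = v}" if "v \<in> A" for v
    using that by auto
  ultimately show ?thesis by (simp add: content_def)
qed

text \<open>The partial sums of the contents count the cells with entries below \<open>v\<close> and
  up to \<open>v\<close>. In this form membership in a segment can be checked for the rank of a cell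
  by comparing sets of cells.\<close>

lemma segment_content_iff:
  assumes T: "T \<in> col_strict_fillings lam r"
  shows "x \<in> segment (content lam T) v \<longleftrightarrow>
    card {y \<in> young_diagram lam. T y < v} < x \<and> x \<le> card {y \<in> young_diagram lam. T y \<le> v}"
proof -
  have "T y \<in> {1..r}" if "y \<in> young_diagram lam" for y using col_strict_fillingsD(1)[OF T] that by (cases y) auto
  then have "{y \<in> young_diagram lam. T y \<in> {1..<v}} = {y \<in> young_diagram lam. T y < v}"
    "{y \<in> young_diagram lam. T y \<in> {1..v}} = {y \<in> young_diagram lam. T y \<le> v}" by fastforce+
  then show ?thesis
    unfolding segment_def sum_content[OF finite_atLeastLessThan] sum_content[OF finite_atLeastAtMost] by simp
qed

lemma sum_content_eq:
  assumes T: "T \<in> col_strict_fillings lam r"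
  shows "(\<Sum>v\<in>{1..r}. content lam T v) = sum_list lam"
proof -
  have "{x \<in> young_diagram lam. T x \<in> {1..r}} = young_diagram lam"
    using col_strict_fillingsD(1)[OF T] by force
  then show ?thesis unfolding sum_content[OF finite_atLeastAtMost] card_young_diagram[symmetric] by simp
qed

context
  fixes lam :: "nat list"
  assumes part: "is_partition lam"
begin

text \<open>The cell \<open>(i, c)\<close> is placed at the \<open>i\<close>-th smallest element of
  the block assigned to column \<open>c\<close>. The blocks are disjoint, which gives injectivity,
  and their non-crossing is the arc condition.\<close>

lemma noncrossing_order_of_nct:
  assumes "T \<in> nct lam r"
  obtains e where "noncrossing_order lam T e"
proof -
  let ?seg = "segment (content lam T)" and ?N = "sum_list lam"
  have T: "T \<in> col_strict_fillings lam r" using assms by (simp add: nct_def)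
  obtain P where P: "multfree_nct lam P" and le1: "\<And>b v. b \<in> P \<Longrightarrow> v \<in> {1..r} \<Longrightarrow> card (b \<inter> ?seg v) \<le> 1"
    and values_eq: "image_mset (\<lambda>b. {v \<in> {1..r}. b \<inter> ?seg v \<noteq> {}}) (mset_set P)
          = image_mset (col_entries lam T) (mset_set (columns lam))"
    using assms unfolding nct_def by blast
  have part_P: "partition_on {1..?N} P" and nc: "pairwise noncrossing P" using P by (simp_all add: multfree_nct_def)
  have "finite P" by (rule finite_elements[OF _ part_P]) simp
  obtain \<beta> where \<beta>: "bij_betw \<beta> (columns lam) P"
    "\<And>c. c \<in> columns lam \<Longrightarrow> {v \<in> {1..r}. \<beta> c \<inter> ?seg v \<noteq> {}} = col_entries lam T c"
    using bij_betw_of_image_mset_eq[OF finite_columns \<open>finite P\<close> values_eq[symmetric]] by blast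
  have \<beta>_P: "\<beta> c \<in> P" if "c \<in> columns lam" for c using bij_betwE[OF \<beta>(1)] that by blast
  have block: "\<beta> c \<subseteq> {1..?N}" if "c \<in> columns lam" for c
    using \<beta>_P[OF that] part_P by (auto simp: partition_on_def)
  have fin: "finite (\<beta> c)" if "c \<in> columns lam" for c using block[OF that] by (rule finite_subset) simp
  define \<sigma> where "\<sigma> = (\<lambda>x. SOME v. v \<in> {1..r} \<and> x \<in> ?seg v)"
  have \<sigma>: "\<sigma> x \<in> {1..r} \<and> x \<in> ?seg (\<sigma> x)" if "x \<in> \<beta> c" "c \<in> columns lam" for x c
  proof -
    have "1 \<le> x" "x \<le> (\<Sum>u\<in>{1..r}. content lam T u)"
      unfolding sum_content_eq[OF T] using block[OF that(2)] that(1) by auto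
    then obtain v where "v \<in> {1..r} \<and> x \<in> ?seg v" using segment_cover by metis
    then show ?thesis unfolding \<sigma>_def by (rule someI)
  qed
  have \<sigma>_eq: "\<sigma> x = v" if "x \<in> \<beta> c" "c \<in> columns lam" "x \<in> ?seg v" for x c v
    using segment_unique[of x _ "\<sigma> x" v] \<sigma>[OF that(1,2)] that(3) by blast
  \<comment> \<open>The segments follow one another, so \<open>\<sigma>\<close> increases weakly; it
    increases strictly on a block because a block has at most one element in each segment.\<close>
  have \<sigma>_less: "\<sigma> x < \<sigma> y" if "x \<in> \<beta> c" "y \<in> \<beta> c" "c \<in> columns lam" "x < y" for x y c
  proof (rule ccontr)
    assume "\<not> \<sigma> x < \<sigma> y"
    moreover have "\<not> \<sigma> y < \<sigma> x" using segment_less[of y _ "\<sigma> y" x "\<sigma> x"] \<sigma> that by force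
    ultimately have "\<sigma> x = \<sigma> y" by simp
    then have "{x, y} \<subseteq> \<beta> c \<inter> ?seg (\<sigma> x)" using \<sigma>[OF that(1,3)] \<sigma>[OF that(2,3)] that by simp
    then have "card {x, y} \<le> card (\<beta> c \<inter> ?seg (\<sigma> x))" using fin[OF that(3)] by (intro card_mono) auto
    then show False using le1[OF \<beta>_P[OF that(3)], of "\<sigma> x"] \<sigma>[OF that(1,3)] that(4) by simp
  qed
  have \<sigma>_img: "\<sigma> ` \<beta> c = col_entries lam T c" if c: "c \<in> columns lam" for c
    unfolding \<beta>(2)[OF c, symmetric] using \<sigma>[OF _ c] \<sigma>_eq[OF _ c] by blast
  have "inj_on \<sigma> (\<beta> c)" if "c \<in> columns lam" for c
    by (rule linorder_inj_onI) (use \<sigma>_less that in force)+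
  then have card_\<beta>: "card (\<beta> c) = col_len lam c" if c: "c \<in> columns lam" for c
    using card_image[of \<sigma> "\<beta> c"] card_image[OF strict_mono_on_imp_inj_on[OF strict_mono_on_column'[OF part T c]]]
      c \<sigma>_img[OF c] unfolding col_entries_def by simp
  have "\<exists>f. strict_mono_on {1..col_len lam c} f \<and> f ` {1..col_len lam c} = \<beta> c" if "c \<in> columns lam" for c
    using increasing_enumeration[OF fin[OF that]] card_\<beta>[OF that] by metis
  then obtain F where F: "\<And>c. c \<in> columns lam \<Longrightarrow> strict_mono_on {1..col_len lam c} (F c)"
    "\<And>c. c \<in> columns lam \<Longrightarrow> F c ` {1..col_len lam c} = \<beta> c" by metis
  \<comment> \<open>\<open>\<sigma>\<close> carries the increasing enumeration of the block to an
    increasing enumeration of the entries of the column, and there is only one.\<close>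
  have F_seg: "F c i \<in> ?seg (T (i, c))" if c: "c \<in> columns lam" and i: "i \<in> {1..col_len lam c}" for c i
  proof -
    have F_in: "F c j \<in> \<beta> c" if "j \<in> {1..col_len lam c}" for j using F(2)[OF c] that by blast
    have "strict_mono_on {1..col_len lam c} (\<lambda>i. \<sigma> (F c i))"
      by (intro strict_mono_onI \<sigma>_less[OF F_in F_in c] strict_mono_onD[OF F(1)[OF c]])
    then have "nth_elem ((\<lambda>i. \<sigma> (F c i)) ` {1..col_len lam c}) i = \<sigma> (F c i)" using i by (rule nth_elem_image)
    moreover have "(\<lambda>i. \<sigma> (F c i)) ` {1..col_len lam c} = col_entries lam T c"
      using F(2)[OF c] \<sigma>_img[OF c] by (metis image_image)
    moreover have "nth_elem (col_entries lam T c) i = T (i, c)"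
      unfolding col_entries_def by (rule nth_elem_image[OF strict_mono_on_column'[OF part T c] i])
    ultimately have "\<sigma> (F c i) = T (i, c)" by simp
    then show ?thesis using \<sigma>[OF F_in[OF i] c] by simp
  qed
  have cell: "c \<in> columns lam \<and> i \<in> {1..col_len lam c}" if "(i, c) \<in> young_diagram lam" for i c
    using that by (simp add: mem_young_diagram_col[OF part] columns_iff[OF part])
  have disjoint: "\<beta> c \<inter> \<beta> d = {}" if "c \<in> columns lam" "d \<in> columns lam" "c \<noteq> d" for c d
  proof -
    have "\<beta> c \<noteq> \<beta> d" using inj_onD[OF bij_betw_imp_inj_on[OF \<beta>(1)]] that by blast
    then show ?thesis using partition_onD2[OF part_P] \<beta>_P[OF that(1)] \<beta>_P[OF that(2)] by (simp add: disjoint_def)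
  qed
  have "noncrossing_order lam T (\<lambda>(i, c). F c i)"
    unfolding noncrossing_order_def
  proof (intro conjI ballI allI impI)
    show "inj_on (\<lambda>(i, c). F c i) (young_diagram lam)"
    proof (rule inj_onI)
      fix x y assume xy: "x \<in> young_diagram lam" "y \<in> young_diagram lam"
        "(case x of (i, c) \<Rightarrow> F c i) = (case y of (i, c) \<Rightarrow> F c i)"
      obtain i c where x: "x = (i, c)" by (cases x)
      obtain j d where y: "y = (j, d)" by (cases y)
      have c: "c \<in> columns lam" "i \<in> {1..col_len lam c}" and d: "d \<in> columns lam" "j \<in> {1..col_len lam d}"
        using cell xy x y by blast+
      have eq: "F c i = F d j" using xy x y by simp
      have "F c i \<in> \<beta> c" "F d j \<in> \<beta> d" using F(2)[OF c(1)] F(2)[OF d(1)] c(2) d(2) by blast+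
      then have "c = d" using disjoint[OF c(1) d(1)] eq by auto
      then show "x = y" using strict_mono_on_eqD[OF F(1)[OF c(1)], of i j] eq c d x y by simp
    qed
    show "(case x of (i, c) \<Rightarrow> F c i) < (case y of (i, c) \<Rightarrow> F c i)"
      if "x \<in> young_diagram lam" "y \<in> young_diagram lam" "T x < T y" for x y
    proof -
      obtain i c where x: "x = (i, c)" by (cases x)
      obtain j d where y: "y = (j, d)" by (cases y)
      have "F c i < F d j"
        using segment_less[OF F_seg F_seg, of c i d j] cell[of i c] cell[of j d] that unfolding x y by blast
      then show ?thesis by (simp add: x y)
    qed
    fix i c d
    assume *: "(Suc i, c) \<in> young_diagram lam" "(i, d) \<in> young_diagram lam"
      "(case (i, c) of (i, c) \<Rightarrow> F c i) < (case (i, d) of (i, c) \<Rightarrow> F c i)"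
      "(case (i, d) of (i, c) \<Rightarrow> F c i) < (case (Suc i, c) of (i, c) \<Rightarrow> F c i)"
    have c: "c \<in> columns lam" "Suc i \<le> col_len lam c" and d: "d \<in> columns lam" "1 \<le> i" "i \<le> col_len lam d"
      using cell[OF *(1)] cell[OF *(2)] by auto
    have "c \<noteq> d" using *(3) by auto
    then have "\<beta> c \<noteq> \<beta> d" using inj_onD[OF bij_betw_imp_inj_on[OF \<beta>(1)]] c(1) d(1) by blast
    then have "noncrossing (\<beta> c) (\<beta> d)" using nc \<beta>_P[OF c(1)] \<beta>_P[OF d(1)] by (auto simp: pairwise_def)
    then have "noncrossing_arcs (F c) (col_len lam c) (F d) (col_len lam d)"
      using noncrossing_iff_arcs[OF F(1)[OF c(1)] F(1)[OF d(1)]] disjoint[OF c(1) d(1) \<open>c \<noteq> d\<close>] c d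
      unfolding F(2)[OF c(1)] F(2)[OF d(1)] by simp
    then have "Suc i \<le> col_len lam d \<and> F d (Suc i) < F c (Suc i)"
      using c d * unfolding noncrossing_arcs_def by simp
    then show "(Suc i, d) \<in> young_diagram lam" "(case (Suc i, d) of (i, c) \<Rightarrow> F c i) < (case (Suc i, c) of (i, c) \<Rightarrow> F c i)"
      using d by (auto simp: mem_young_diagram_col[OF part] columns_iff[OF part])
  qed
  then show ?thesis by (rule that)
qed

text \<open>\<open>rk\<close> carries the order \<open>e\<close> isomorphically onto
  \<open>{1..?N}\<close>, so the arc conditions survive. Cells with smaller entries come before a
  cell and none with larger entries does, so its rank falls into the segment of its entry, which
  makes the blocks read as the columns.\<close>

lemma nct_of_noncrossing_order:
  assumes T: "T \<in> col_strict_fillings lam r" and e: "noncrossing_order lam T e" and arr: "arranged lam T"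
  shows "T \<in> nct lam r"
proof -
  let ?seg = "segment (content lam T)" and ?N = "sum_list lam" and ?Y = "young_diagram lam"
  define rk where "rk = (\<lambda>x. card {y \<in> ?Y. e y \<le> e x})"
  have rk_less: "rk x < rk y" if "x \<in> ?Y" "y \<in> ?Y" "e x < e y" for x y
    unfolding rk_def
  proof (rule psubset_card_mono)
    show "finite {z \<in> ?Y. e z \<le> e y}" using finite_young_diagram by simp
    have "y \<in> {z \<in> ?Y. e z \<le> e y}" "y \<notin> {z \<in> ?Y. e z \<le> e x}" using that by auto
    moreover have "{z \<in> ?Y. e z \<le> e x} \<subseteq> {z \<in> ?Y. e z \<le> e y}" using that by auto
    ultimately show "{z \<in> ?Y. e z \<le> e x} \<subset> {z \<in> ?Y. e z \<le> e y}" by blast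
  qed
  have rk_less_iff: "rk x < rk y \<longleftrightarrow> e x < e y" if "x \<in> ?Y" "y \<in> ?Y" for x y
  proof -
    have "e x = e y \<Longrightarrow> rk x = rk y" by (simp add: rk_def)
    then show ?thesis using rk_less[OF that] rk_less[OF that(2,1)] by (cases "e x" "e y" rule: linorder_cases) auto
  qed
  have rk_inj: "inj_on rk ?Y"
  proof (rule inj_onI)
    fix x y assume xy: "x \<in> ?Y" "y \<in> ?Y" "rk x = rk y"
    then have "e x = e y" using rk_less_iff[of x y] rk_less_iff[of y x] by auto
    then show "x = y" using e xy unfolding noncrossing_order_def by (auto dest: inj_onD)
  qed
  have rk_img: "rk ` ?Y = {1..?N}"
  proof (rule card_subset_eq)
    show "rk ` ?Y \<subseteq> {1..?N}"
    proof clarify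
      fix i c assume x: "(i, c) \<in> ?Y"
      have "0 < rk (i, c)" unfolding rk_def using x finite_young_diagram by (subst card_gt_0_iff) auto
      moreover have "rk (i, c) \<le> card ?Y" unfolding rk_def by (intro card_mono finite_young_diagram) auto
      ultimately show "rk (i, c) \<in> {1..?N}" by (simp add: card_young_diagram)
    qed
    show "card (rk ` ?Y) = card {1..?N}" using card_image[OF rk_inj] by (simp add: card_young_diagram)
  qed simp
  have rk_seg: "rk x \<in> ?seg (T x)" if x: "x \<in> ?Y" for x
    unfolding segment_content_iff[OF T]
  proof
    have "y \<in> ?Y \<Longrightarrow> T y < T x \<Longrightarrow> e y < e x" for y using e x by (simp add: noncrossing_order_def)
    then have "{y \<in> ?Y. T y < T x} \<subseteq> {y \<in> ?Y. e y \<le> e x}" by (auto intro: less_imp_le)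
    moreover have "x \<in> {y \<in> ?Y. e y \<le> e x}" "x \<notin> {y \<in> ?Y. T y < T x}" using x by auto
    ultimately have "{y \<in> ?Y. T y < T x} \<subset> {y \<in> ?Y. e y \<le> e x}" by blast
    then show "card {y \<in> ?Y. T y < T x} < rk x"
      unfolding rk_def using finite_young_diagram by (intro psubset_card_mono) auto
    have "y \<in> ?Y \<Longrightarrow> e y \<le> e x \<Longrightarrow> T y \<le> T x" for y using e x unfolding noncrossing_order_def by (meson leD leI)
    then show "rk x \<le> card {y \<in> ?Y. T y \<le> T x}"
      unfolding rk_def using finite_young_diagram by (intro card_mono) auto
  qed
  have seg_eq: "v = T x" if "x \<in> ?Y" "rk x \<in> ?seg v" for x v
    using segment_unique[OF that(2) rk_seg[OF that(1)]] .
  define b where "b = (\<lambda>c. (\<lambda>i. rk (i, c)) ` {1..col_len lam c})"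
  have cell: "(i, c) \<in> ?Y \<longleftrightarrow> c \<in> columns lam \<and> i \<in> {1..col_len lam c}" for i c
    by (auto simp: mem_young_diagram_col[OF part] columns_iff[OF part])
  have b_mono: "strict_mono_on {1..col_len lam c} (\<lambda>i. rk (i, c))" if "c \<in> columns lam" for c
  proof (rule strict_mono_onI)
    fix i j assume ij: "i \<in> {1..col_len lam c}" "j \<in> {1..col_len lam c}" "i < j"
    then have "T (i, c) < T (j, c)" using that by (intro col_strict_fillingsD(3)[OF T]) (simp_all add: cell)
    then show "rk (i, c) < rk (j, c)" using e ij that by (intro rk_less) (simp_all add: cell noncrossing_order_def)
  qed
  have b_disj: "b c \<inter> b d = {}" if "c \<in> columns lam" "d \<in> columns lam" "c \<noteq> d" for c d
  proof -
    have False if "i \<in> {1..col_len lam c}" "j \<in> {1..col_len lam d}" "rk (i, c) = rk (j, d)" for i j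
      using inj_onD[OF rk_inj that(3)] that \<open>c \<in> _\<close> \<open>d \<in> _\<close> \<open>c \<noteq> d\<close> by (simp add: cell)
    then show ?thesis unfolding b_def by blast
  qed
  have b_ne: "b c \<noteq> {}" if "c \<in> columns lam" for c using that by (auto simp: b_def columns_iff[OF part])
  have b_inj: "inj_on b (columns lam)"
    using b_disj b_ne by (intro inj_onI) (metis Int_absorb)
  have b_card: "card (b c) = col_len lam c" if "c \<in> columns lam" for c
    unfolding b_def using card_image[OF strict_mono_on_imp_inj_on[OF b_mono[OF that]]] by simp
  have b_arcs: "noncrossing_arcs (\<lambda>i. rk (i, c)) (col_len lam c) (\<lambda>i. rk (i, d)) (col_len lam d)"
    if "c \<in> columns lam" "d \<in> columns lam" for c d
    unfolding noncrossing_arcs_def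
  proof (intro allI impI)
    fix i assume i: "1 \<le> i" "Suc i \<le> col_len lam c" "i \<le> col_len lam d" "rk (i, c) < rk (i, d)" "rk (i, d) < rk (Suc i, c)"
    have Y: "(Suc i, c) \<in> ?Y" "(i, c) \<in> ?Y" "(i, d) \<in> ?Y" using i that by (auto simp: cell)
    have "(Suc i, d) \<in> ?Y \<and> e (Suc i, d) < e (Suc i, c)"
      using e i Y unfolding noncrossing_order_def by (simp add: rk_less_iff)
    then show "Suc i \<le> col_len lam d \<and> rk (Suc i, d) < rk (Suc i, c)" using Y by (simp add: rk_less_iff cell)
  qed
  let ?P = "b ` columns lam"
  have mset_P: "mset_set ?P = image_mset b (mset_set (columns lam))"
    by (rule image_mset_mset_set[OF b_inj, symmetric])
  have union: "\<Union>?P = {1..?N}"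
  proof -
    have "\<Union>?P = rk ` ?Y"
    proof (intro equalityI subsetI)
      fix x assume "x \<in> rk ` ?Y"
      then obtain i c where "(i, c) \<in> ?Y" "x = rk (i, c)" by auto
      then have "c \<in> columns lam" "x \<in> b c" unfolding b_def cell by blast+
      then show "x \<in> \<Union>?P" by blast
    next
      fix x assume "x \<in> \<Union>?P"
      then obtain i c where "c \<in> columns lam" "i \<in> {1..col_len lam c}" "x = rk (i, c)" by (auto simp: b_def)
      then show "x \<in> rk ` ?Y" by (auto simp: cell)
    qed
    then show ?thesis using rk_img by simp
  qed
  have "multfree_nct lam ?P"
    unfolding multfree_nct_def
  proof (intro conjI)
    show "partition_on {1..?N} ?P"
      unfolding partition_on_def disjoint_def using union b_ne b_disj by blast
    show "pairwise noncrossing ?P"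
      unfolding pairwise_image
    proof (rule pairwiseI, intro impI)
      fix c d assume cd: "c \<in> columns lam" "d \<in> columns lam" "c \<noteq> d"
      then show "noncrossing (b c) (b d)"
        using noncrossing_iff_arcs[OF b_mono b_mono, of c d] b_arcs b_disj[OF cd]
        unfolding b_def by (simp add: columns_iff[OF part])
    qed
    show "image_mset card (mset_set ?P) = image_mset (col_len lam) (mset_set (columns lam))"
      unfolding mset_P image_mset.compositionality using b_card finite_columns by (intro image_mset_cong) auto
  qed
  moreover have "card (B \<inter> ?seg v) \<le> 1" if B: "B \<in> ?P" for B v
  proof -
    obtain c where c: "c \<in> columns lam" "B = b c" using B by blast
    have "x = y" if xy: "x \<in> B \<inter> ?seg v" "y \<in> B \<inter> ?seg v" for x y
    proof -
      obtain i j where ij: "i \<in> {1..col_len lam c}" "x = rk (i, c)" "j \<in> {1..col_len lam c}" "y = rk (j, c)"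
        using xy c by (auto simp: b_def)
      then have "T (i, c) = T (j, c)" using seg_eq[of "(i, c)" v] seg_eq[of "(j, c)" v] xy c(1) cell by auto
      then have "i = j" using strict_mono_on_eqD[OF strict_mono_on_column'[OF part T c(1)], of i j] ij by simp
      then show ?thesis using ij by simp
    qed
    moreover have "finite (B \<inter> ?seg v)" using c by (simp add: b_def)
    ultimately show ?thesis by (simp add: card_le_Suc0_iff_eq)
  qed
  moreover have "image_mset (\<lambda>b. {v \<in> {1..r}. b \<inter> ?seg v \<noteq> {}}) (mset_set ?P)
          = image_mset (col_entries lam T) (mset_set (columns lam))"
    unfolding mset_P image_mset.compositionality
  proof (rule image_mset_cong)
    fix c assume "c \<in># mset_set (columns lam)"
    then have c: "c \<in> columns lam" using finite_columns by simp
    have "v \<in> {1..r} \<and> b c \<inter> ?seg v \<noteq> {} \<longleftrightarrow> v \<in> col_entries lam T c" for v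
    proof
      assume "v \<in> {1..r} \<and> b c \<inter> ?seg v \<noteq> {}"
      then obtain i where "i \<in> {1..col_len lam c}" "rk (i, c) \<in> ?seg v" unfolding b_def by blast
      then show "v \<in> col_entries lam T c" using seg_eq[of "(i, c)" v] c by (auto simp: col_entries_def cell)
    next
      assume "v \<in> col_entries lam T c"
      then obtain i where i: "i \<in> {1..col_len lam c}" "v = T (i, c)" by (auto simp: col_entries_def)
      then have "(i, c) \<in> ?Y" using c by (simp add: cell)
      then have "v \<in> {1..r}" "rk (i, c) \<in> b c \<inter> ?seg v"
        using col_strict_fillingsD(1)[OF T, of i c] rk_seg[of "(i, c)"] i by (auto simp: b_def)
      then show "v \<in> {1..r} \<and> b c \<inter> ?seg v \<noteq> {}" by blast
    qed
    then show "((\<lambda>b. {v \<in> {1..r}. b \<inter> ?seg v \<noteq> {}}) \<circ> b) c = col_entries lam T c" by auto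
  qed
  ultimately show ?thesis using T arr unfolding nct_def arranged_def by blast
qed

lemma nct_iff: "T \<in> nct lam r \<longleftrightarrow> T \<in> col_strict_fillings lam r \<and> (\<exists>e. noncrossing_order lam T e) \<and> arranged lam T"
proof
  assume T: "T \<in> nct lam r"
  then have "T \<in> col_strict_fillings lam r" "arranged lam T" by (simp_all add: nct_def arranged_def)
  then show "T \<in> col_strict_fillings lam r \<and> (\<exists>e. noncrossing_order lam T e) \<and> arranged lam T"
    using noncrossing_order_of_nct[OF T] by blast
qed (use nct_of_noncrossing_order in blast)

end

section \<open>The basis theorem\<close>

theorem theorem32:
  fixes n r :: nat and lam :: "nat list"
  assumes "is_partition lam" and "length lam \<le> n"
  shows "inj_on (bideterminant n r lam) (nct lam r) \<and>
         cpoly.independent (bideterminant n r lam ` nct lam r) \<and>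
         cpoly.span (bideterminant n r lam ` nct lam r) = bidet_space n r lam"
proof -
  let ?M = "bideterminant n r lam" and ?N = "nct lam r" and ?S = "ssyt lam r" and ?C = "col_strict_fillings lam r"
  have N_C: "?N \<subseteq> ?C" and S_C: "?S \<subseteq> ?C" by (auto simp: nct_def ssyt_def)
  have fin: "finite ?N" "finite ?S"
    using finite_subset[OF N_C finite_col_strict_fillings] finite_subset[OF S_C finite_col_strict_fillings] .
  have "inj_on (row_monomial lam) ?N"
  proof (rule inj_onI)
    fix T T' assume "T \<in> ?N" "T' \<in> ?N" "row_monomial lam T = row_monomial lam T'"
    then show "T = T'"
      unfolding nct_iff[OF assms(1)] row_monomial_eq_iff
      using arranged_noncrossing_unique[OF assms(1), of T r _ T'] by blast
  qed
  moreover have "leads (?M T) (row_monomial lam T)" if "T \<in> ?N" for T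
    using leads_bideterminant[OF assms(1) _ assms(2)] that N_C by blast
  ultimately have inj: "inj_on ?M ?N" and ind: "cpoly.independent (?M ` ?N)"
    using independent_of_leads[of ?N ?M "row_monomial lam"] by blast+
  have "\<exists>T\<in>?N. row_monomial lam T = row_monomial lam S" if "S \<in> ?S" for S
    using arranged_noncrossing_filling_exists[OF assms(1) that]
    unfolding row_monomial_eq_iff Bex_def nct_iff[OF assms(1)] by metis
  then obtain \<Theta> where \<Theta>: "\<And>S. S \<in> ?S \<Longrightarrow> \<Theta> S \<in> ?N \<and> row_monomial lam (\<Theta> S) = row_monomial lam S" by metis
  have "inj_on \<Theta> ?S"
  proof (rule inj_onI)
    fix S S' assume "S \<in> ?S" "S' \<in> ?S" "\<Theta> S = \<Theta> S'"
    then have "row_monomial lam S = row_monomial lam S'" using \<Theta> by metis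
    then show "S = S'"
      using ssyt_eq_of_row_count[OF assms(1) \<open>S \<in> ?S\<close> \<open>S' \<in> ?S\<close>] unfolding row_monomial_eq_iff by blast
  qed
  then have "card ?S \<le> card ?N" using \<Theta> fin by (intro card_inj_on_le[of \<Theta>]) auto
  \<comment> \<open>Bideterminants of distinct semistandard tableaux might coincide a priori, which
    only lowers the left side; on the right side injectivity is already known.\<close>
  then have card: "card (?M ` ?S) \<le> card (?M ` ?N)"
    using card_image_le[OF fin(2), of ?M] card_image[OF inj] by simp
  have C_span: "?M ` ?C \<subseteq> cpoly.span (?M ` ?S)"
    using bideterminant_in_span_ssyt[OF assms(1) _ assms(2)] by blast
  have "?M ` ?C \<subseteq> cpoly.span (?M ` ?N)"
  proof (rule subsetI, rule ccontr)
    fix x assume x: "x \<in> ?M ` ?C" "x \<notin> cpoly.span (?M ` ?N)"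
    then have "cpoly.independent (insert x (?M ` ?N))" using ind by (intro cpoly.independent_insertI)
    moreover have "insert x (?M ` ?N) \<subseteq> cpoly.span (?M ` ?S)" using C_span N_C x(1) by blast
    ultimately have "card (insert x (?M ` ?N)) \<le> card (?M ` ?S)"
      using cpoly.independent_span_bound[of "?M ` ?S"] fin(2) by blast
    moreover have "x \<notin> ?M ` ?N" using x(2) cpoly.span_base by blast
    ultimately show False using card fin(1) by simp
  qed
  then have "cpoly.span (?M ` ?C) \<subseteq> cpoly.span (?M ` ?N)"
    by (rule cpoly.span_minimal) (rule cpoly.subspace_span)
  moreover have "cpoly.span (?M ` ?N) \<subseteq> cpoly.span (?M ` ?C)"
    using N_C by (intro cpoly.span_mono image_mono)
  ultimately show ?thesis using inj ind by (simp add: bidet_space_def)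
qed

end
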